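(* Let $N\ge 2$ and let $B_1$ be the unit ball in $\mathbb{R}^N$. Let $k\ge 2$ be an integer and let $f$ satisfy: (A1) $f\in C^1([0,\infty),\mathbb{R})$ and $f(0)=0$; (A2) the limit $f_{+\infty}:=\lim_{s\to+\infty} f(s)/s$ exists and $f_{+\infty}<\infty$; (A3) there exists $\beta>0$ such that $f(\beta)=\beta$, $f(s)<s$ for $s\in(0,\beta)$, $f(s)>s$ for $s\in(\beta,\infty)$, and $f'(\beta)>\lambda_k^r$. Then for each $j\in\{2,\dots,k\}$ the problem $$-\Delta u+u=f(u)\ \text{ in } B_1,\qquad u>0\ \text{ in } B_1,\qquad \partial_\nu u=0\ \text{ on }\partial B_1$$ has two nonconstant radial solutions $u_j^+$ and $u_j^-$ such that, regarded as functions of $r=|x|$, $u_j^+-\beta$ changes sign exactly $j-1$ times in $(0,1)$ and is positive near $0$, and $u_j^--\beta$ changes sign exactly $j-1$ times in $(0,1)$ and is negative near $0$. Moreover, if in addition (A4) $[f(s+\beta)-(s+\beta)]\,s>0$ for all $s\in(-\beta,0)\cup(0,\infty)$ holds, then $u_2^+$ is decreasing in $[0,1]$ and $u_2^-$ is increasing in $[0,1]$ (as functions of $r$).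
   Context: $\lambda_k^r$ ($k=1,2,\dots$) denotes the $k$-th radial eigenvalue (i.e. eigenvalue with a radial eigenfunction) of $-\Delta+I$ in $B_1$ with homogeneous Neumann boundary conditions, listed in increasing order, so $1=\lambda_1^r<\lambda_2^r<\cdots$. $\partial_\nu$ is the outward normal derivative. *)

theory Defs
  imports "HOL-Analysis.Analysis"
begin

(* Derivatives are taken within S, hence one-sided at boundary points: C1_on {0..} f depends
   only on the values of f on the closed half-line, C1_on (cball 0 1) u only on those of u on
   the closed ball. *)
definition C1_on :: "'a::euclidean_space set \<Rightarrow> ('a \<Rightarrow> real) \<Rightarrow> bool" where
  "C1_on S u \<longleftrightarrow>
     (\<exists>G :: 'a \<Rightarrow> 'a. continuous_on S G \<and>
        (\<forall>x\<in>S. (u has_derivative (\<lambda>h. G x \<bullet> h)) (at x within S)))"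

definition C2_on :: "'a::euclidean_space set \<Rightarrow> ('a \<Rightarrow> real) \<Rightarrow> bool" where
  "C2_on S u \<longleftrightarrow>
     (\<exists>G :: 'a \<Rightarrow> 'a. (\<forall>b\<in>Basis. C1_on S (\<lambda>x. G x \<bullet> b)) \<and>
        (\<forall>x\<in>S. (u has_derivative (\<lambda>h. G x \<bullet> h)) (at x within S)))"

definition laplacian :: "('a::euclidean_space \<Rightarrow> real) \<Rightarrow> 'a \<Rightarrow> real" where
  "laplacian u x = (\<Sum>b\<in>Basis. deriv (deriv (\<lambda>t. u (x + t *\<^sub>R b))) 0)"

(* Classical solutions of - Laplace u + u = g(u) in the unit ball with homogeneous Neumann
   condition. The outward unit normal at x on the unit sphere is x itself, and the normal
   derivative is the derivative from inside the ball. *)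
definition neumann_solution :: "(real \<Rightarrow> real) \<Rightarrow> ('a::euclidean_space \<Rightarrow> real) \<Rightarrow> bool" where
  "neumann_solution g u \<longleftrightarrow>
     C2_on (ball 0 1) u \<and> C1_on (cball 0 1) u \<and>
     (\<forall>x\<in>ball 0 1. - laplacian u x + u x = g (u x)) \<and>
     (\<forall>x\<in>sphere 0 1. ((\<lambda>t. u (x + t *\<^sub>R x)) has_real_derivative 0) (at_left 0))"

(* Radial functions are represented by their profile U, i.e. u(x) = U(|x|). The type argument
   fixes the Euclidean space containing the ball. *)
definition radial_eigenvalues :: "'a::euclidean_space itself \<Rightarrow> real set" where
  "radial_eigenvalues T =
     {\<mu>. \<exists>U :: real \<Rightarrow> real. neumann_solution (\<lambda>s. \<mu> * s) (\<lambda>x::'a. U (norm x)) \<and>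
        (\<exists>x\<in>cball (0::'a) 1. U (norm x) \<noteq> 0)}"

(* The k-th radial eigenvalue in increasing order, counted from k = 1. Eigenvalues are listed
   without multiplicity, in accordance with the strict chain 1 = lambda_1 < lambda_2 < ... *)
definition radial_eigenvalue :: "'a::euclidean_space itself \<Rightarrow> nat \<Rightarrow> real" where
  "radial_eigenvalue T k =
     (THE \<mu>. \<mu> \<in> radial_eigenvalues T \<and>
        finite {\<nu> \<in> radial_eigenvalues T. \<nu> < \<mu>} \<and>
        Suc (card {\<nu> \<in> radial_eigenvalues T. \<nu> < \<mu>}) = k)"

definition alternates :: "(real \<Rightarrow> real) \<Rightarrow> real set \<Rightarrow> nat \<Rightarrow> bool" where
  "alternates g S m \<longleftrightarrow>
     (\<exists>t :: nat \<Rightarrow> real. (\<forall>i\<le>m. t i \<in> S) \<and> strict_mono_on {..m} t \<and>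
        (\<forall>i<m. g (t i) * g (t (Suc i)) < 0))"

(* The number of sign changes of g on S is the largest m for which g takes values of strictly
   alternating sign at some m + 1 successive points of S. *)
definition changes_sign_exactly :: "(real \<Rightarrow> real) \<Rightarrow> real set \<Rightarrow> nat \<Rightarrow> bool" where
  "changes_sign_exactly g S m \<longleftrightarrow> alternates g S m \<and> \<not> alternates g S (Suc m)"

end

theory Submission
  imports Defs
begin

text \<open>
  With \<open>n = N - 1\<close>, radial solutions solve \<open>(r\<^sup>n u')' = - r\<^sup>n g(u)\<close>, \<open>g(s) = f(s) - s\<close>, and are
  parametrised by \<open>u(0) = \<beta> + \<epsilon>\<close>. The normalised functions \<open>y = (u - \<beta>) / \<epsilon>\<close> satisfy
  \<open>y(0) = 1\<close> and an equation of the same kind whose nonlinearity extends continuously to \<open>\<epsilon> = 0\<close>,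
  where it is the linearisation at \<open>\<beta>\<close>. By uniqueness \<open>(y, r\<^sup>n y')\<close> never vanishes, so it has an
  angle \<open>\<theta>(\<epsilon>, r)\<close> continuous in both variables, and the Neumann condition says that
  \<open>\<theta>(\<epsilon>, 1)\<close> is a multiple of \<open>\<pi>\<close>. For the linear equation the angle at \<open>r = 1\<close> increases strictly
  with the eigenvalue parameter, so \<open>f'(\<beta>) > \<lambda>\<^sub>k\<close> means \<open>\<theta>(0, 1) > (k - 1) \<pi>\<close>. On the other
  hand \<open>\<theta>(\<epsilon>, 1) < \<pi>\<close> if \<open>u(0)\<close> is small (then \<open>u < \<beta>\<close> throughout) or large (then \<open>u\<close> crosses \<open>\<beta>\<close>
  at most once, steeply). The intermediate value theorem gives \<open>\<theta>(\<epsilon>, 1) = (j - 1) \<pi>\<close> on both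
  sides of \<open>\<epsilon> = 0\<close>. Such solutions are positive because \<open>f\<close> is extended by \<open>0\<close> to negative values,
  and then \<open>(f(u) - u)(u - \<beta>) > 0\<close> for \<open>u \<noteq> \<beta>\<close> makes \<open>\<theta>\<close> increasing in \<open>r\<close>, which counts the sign changes.
\<close>

section \<open>The singular initial value problem\<close>

text \<open>The division by \<epsilon> is forced: at \<epsilon> = 0 the solution is the constant
  \<beta>, which has no angle, and the intermediate value argument needs an angle exactly there. Two
  further obstacles shape the proof. First, global solvability needs a global Lipschitz bound, but
  f' may be unbounded at infinity, so f is truncated; the truncation level must lie above all
  solutions that are used, and circularity is avoided because every a priori estimate involves only
  the linear growth constant of the nonlinearity and never its Lipschitz constant. Second,
  \<open>radial_eigenvalue\<close> is a definite description over classical solutions on the ball.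
  Before eigenvalues can be counted by angles, every radial eigenfunction must be reduced to the
  initial value problem, although nothing is assumed about its profile beyond the regularity on the
  ball, and the ordinary differential equation is singular at the origin.\<close>

lemma antiderivative_on_reals:
  fixes f :: "real \<Rightarrow> real"
  assumes "continuous_on UNIV f"
  obtains F where "\<And>x. (F has_real_derivative f x) (at x)"
proof -
  have "\<exists>F. \<forall>x::real. -\<infinity> < ereal x \<longrightarrow> ereal x < \<infinity> \<longrightarrow> (F has_vector_derivative f x) (at x)"
    by (rule einterval_antiderivative) (use assms in \<open>auto simp: continuous_on_eq_continuous_at\<close>)
  then show ?thesis using that by (auto simp: has_real_derivative_iff_has_vector_derivative)
qed

text \<open>The substitution \<open>t = r * \<tau>\<close> turns the expression into the integral of
  \<open>t ^ n * q t\<close> from 0 to r. The scaled form makes sense for r of either sign, and its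
  quotient by \<open>r ^ Suc n\<close> remains continuous at 0.\<close>

lemma has_derivative_scaled_integral:
  fixes q :: "real \<Rightarrow> real"
  assumes "continuous_on UNIV q"
  shows "((\<lambda>r. r ^ Suc n * integral {0..1} (\<lambda>\<tau>. \<tau> ^ n * q (r * \<tau>))) has_real_derivative r ^ n * q r) (at r)"
proof -
  have c: "continuous_on UNIV (\<lambda>t. t ^ n * q t)"
    by (intro continuous_intros assms)
  obtain F where F: "\<And>x. (F has_real_derivative x ^ n * q x) (at x)"
    using antiderivative_on_reals[OF c] by blast
  have "r ^ Suc n * integral {0..1} (\<lambda>\<tau>. \<tau> ^ n * q (r * \<tau>)) = F r - F 0" for r
  proof -
    have "((\<lambda>\<tau>. r * ((r * \<tau>) ^ n * q (r * \<tau>))) has_integral F (r * 1) - F (r * 0)) {0..1}"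
    proof (rule fundamental_theorem_of_calculus)
      fix \<tau> :: real
      have "((\<lambda>\<tau>. F (r * \<tau>)) has_real_derivative (r * \<tau>) ^ n * q (r * \<tau>) * r) (at \<tau>)"
        by (rule DERIV_chain2[OF F]) (auto intro!: derivative_eq_intros)
      then show "((\<lambda>\<tau>. F (r * \<tau>)) has_vector_derivative r * ((r * \<tau>) ^ n * q (r * \<tau>))) (at \<tau> within {0..1})"
        by (simp add: has_real_derivative_iff_has_vector_derivative mult.commute has_vector_derivative_at_within)
    qed simp
    then have "integral {0..1} (\<lambda>\<tau>. r ^ Suc n * (\<tau> ^ n * q (r * \<tau>))) = F r - F 0"
      by (intro integral_unique) (simp add: power_mult_distrib mult_ac)
    then show ?thesis by simp
  qed
  then have "(\<lambda>r. r ^ Suc n * integral {0..1} (\<lambda>\<tau>. \<tau> ^ n * q (r * \<tau>))) = (\<lambda>r. F r - F 0)" by auto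
  then show ?thesis by (auto intro!: derivative_eq_intros F)
qed

text \<open>Integrating an exponential of rate c gains a factor 1 / c; this gain makes the weighted
  integral operator contract.\<close>

lemma abs_scaled_integral_le:
  fixes f :: "real \<Rightarrow> real"
  assumes f: "continuous_on {0..1} f" and b: "\<And>\<tau>. \<tau> \<in> {0..1} \<Longrightarrow> \<bar>f \<tau>\<bar> \<le> K * exp (c * (s * \<tau>))"
    and c: "c > 0" and s: "s \<ge> 0" and K: "K \<ge> 0"
  shows "s * \<bar>integral {0..1} f\<bar> \<le> K / c * exp (c * s)"
proof -
  have "((\<lambda>\<tau>. s * (K * exp (c * (s * \<tau>)))) has_integral K / c * exp (c * (s * 1)) - K / c * exp (c * (s * 0))) {0..1}"
    by (rule fundamental_theorem_of_calculus)
       (use c in \<open>auto intro!: derivative_eq_intros simp flip: has_real_derivative_iff_has_vector_derivative\<close>)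
  then have I: "((\<lambda>\<tau>. s * (K * exp (c * (s * \<tau>)))) has_integral K / c * exp (c * s) - K / c) {0..1}" by simp
  have "norm (integral {0..1} (\<lambda>\<tau>. s * f \<tau>)) \<le> integral {0..1} (\<lambda>\<tau>. s * (K * exp (c * (s * \<tau>))))"
  proof (rule integral_norm_bound_integral)
    show "(\<lambda>\<tau>. s * f \<tau>) integrable_on {0..1}"
      by (intro integrable_continuous_real continuous_intros f)
    show "(\<lambda>\<tau>. s * (K * exp (c * (s * \<tau>)))) integrable_on {0..1}" using I by blast
    fix \<tau> :: real assume "\<tau> \<in> {0..1}"
    then show "norm (s * f \<tau>) \<le> s * (K * exp (c * (s * \<tau>)))"
      using b s by (simp add: abs_mult mult_left_mono)
  qed
  also have "\<dots> \<le> K / c * exp (c * s)" using integral_unique[OF I] c K by simp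
  finally show ?thesis using s by (simp add: abs_mult)
qed

text \<open>Here \<open>P\<close> is \<open>u' / r\<close>, extended to \<open>r = 0\<close>; the equation is required on all of \<open>\<real>\<close>, where solutions are
  even, so that no one-sided derivatives occur at \<open>r = 0\<close> and \<open>r = 1\<close>.\<close>

definition radial_solution :: "nat \<Rightarrow> (real \<Rightarrow> real) \<Rightarrow> (real \<Rightarrow> real) \<Rightarrow> (real \<Rightarrow> real) \<Rightarrow> bool" where
  "radial_solution n g u P \<longleftrightarrow> continuous_on UNIV P \<and>
     (\<forall>r. (u has_real_derivative r * P r) (at r)) \<and>
     (\<forall>r. ((\<lambda>r. r ^ Suc n * P r) has_real_derivative - (r ^ n * g (u r))) (at r))"

lemma continuous_on_section:
  assumes "continuous_on (A \<times> B) (\<lambda>(x, y). F x y)"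
  shows "x \<in> A \<Longrightarrow> continuous_on B (F x)" "y \<in> B \<Longrightarrow> continuous_on A (\<lambda>x. F x y)"
proof -
  have c: "continuous_on B (\<lambda>y. (x, y))" "continuous_on A (\<lambda>x. (x, y))" by (intro continuous_intros)+
  show "continuous_on B (F x)" if "x \<in> A"
    using continuous_on_compose2[OF assms c(1)] that by auto
  show "continuous_on A (\<lambda>x. F x y)" if "y \<in> B"
    using continuous_on_compose2[OF assms c(2)] that by auto
qed

lemma continuous_integral_param:
  fixes F :: "'a::topological_space \<Rightarrow> real \<Rightarrow> real"
  assumes "continuous_on UNIV (\<lambda>(x, t). F x t)"
  shows "continuous_on UNIV (\<lambda>x. integral {0..1} (F x))"
  using integral_continuous_on_param[of UNIV 0 1 F] continuous_on_subset[OF assms] 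
  by (simp add: cbox_interval)

text \<open>This is u' / r expressed through u: integrating
  \<open>(r ^ n * u')' = - (r ^ n * h p u)\<close> from 0 and scaling to [0, 1] cancels a factor
  \<open>r ^ Suc n\<close>.\<close>

definition radial_operator ::
  "nat \<Rightarrow> (real \<Rightarrow> real \<Rightarrow> real) \<Rightarrow> (real \<times> real \<Rightarrow> real) \<Rightarrow> real \<times> real \<Rightarrow> real" where
  "radial_operator n h Y = (\<lambda>(p, r). - integral {0..1} (\<lambda>\<tau>. \<tau> ^ n * h p (Y (p, r * \<tau>))))"

lemma continuous_radial_operator:
  assumes h: "continuous_on UNIV (\<lambda>(p, y). h p y)" and Y: "continuous_on UNIV Y"
  shows "continuous_on UNIV (radial_operator n h Y)"
proof -
  have "continuous_on UNIV (\<lambda>((p, r), \<tau>). \<tau> ^ n * h p (Y (p, r * \<tau>)))"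
    unfolding split_beta
    by (intro continuous_intros continuous_on_compose2[OF h[unfolded split_beta], of _ "\<lambda>x. (fst (fst x), Y (fst (fst x), snd (fst x) * snd x))", simplified] continuous_on_compose2[OF Y]) auto
  then show ?thesis unfolding radial_operator_def split_beta
    by (intro continuous_intros continuous_integral_param) (auto simp: split_beta)
qed

text \<open>Banach's fixed point theorem on bounded continuous functions of the parameter and the radius
  jointly gives continuous dependence at once. The weight \<open>exp (- l p \<bar>r\<bar>)\<close> makes the operator a contraction on
  the whole line, and scaling the integration variables to \<open>[0, 1]\<close> removes the singularity at \<open>r = 0\<close>.\<close>

lemma radial_family_exists:
  fixes h :: "real \<Rightarrow> real \<Rightarrow> real" and L :: "real \<Rightarrow> real"
  assumes h: "continuous_on UNIV (\<lambda>(p, y). h p y)" and L: "continuous_on UNIV L" "\<And>p. L p > 0"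
    and lip: "\<And>p y z. \<bar>h p y - h p z\<bar> \<le> L p * \<bar>y - z\<bar>" and h0: "\<And>p. h p 0 = 0"
  obtains y P where "continuous_on UNIV (\<lambda>(p, r). y p r)" "continuous_on UNIV (\<lambda>(p, r). P p r)"
    "\<And>p. y p 0 = 1" "\<And>p. radial_solution n (h p) (y p) (P p)"
proof -
  \<comment> \<open>Two integrations divide \<open>L p\<close> by \<open>l p\<close> twice, so this
    rate gives the contraction factor 1/2.\<close>
  define l where "l p = sqrt (2 * L p)" for p
  have lpos: "l p > 0" and l2: "l p * l p = 2 * L p" for p
    using L(2)[of p] by (auto simp: l_def)
  have lc: "continuous_on UNIV l" unfolding l_def by (intro continuous_intros L)
  \<comment> \<open>\<open>E\<close> recovers y from the bounded unknown, \<open>S\<close> is the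
    Picard operator for y(0) = 1, and \<open>T\<close> is \<open>S\<close> conjugated by the
    weight.\<close>
  define E where "E F = (\<lambda>(p, r). exp (l p * \<bar>r\<bar>) * F (p, r))" for F :: "real \<times> real \<Rightarrow> real"
  define S where "S Y = (\<lambda>(p, r). 1 + r\<^sup>2 * integral {0..1} (\<lambda>\<sigma>. \<sigma> * radial_operator n h Y (p, r * \<sigma>)))" 
    for Y :: "real \<times> real \<Rightarrow> real"
  define T where "T F = (\<lambda>(p, r). exp (- (l p * \<bar>r\<bar>)) * S (E F) (p, r))" for F :: "real \<times> real \<Rightarrow> real"
  have Ec: "continuous_on UNIV (E F)" if "continuous_on UNIV F" for F
    unfolding E_def split_beta 
    by (intro continuous_intros continuous_on_compose2[OF lc] that continuous_on_compose2[OF that]) auto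
  have Sc: "continuous_on UNIV (S Y)" if "continuous_on UNIV Y" for Y
  proof -
    have "continuous_on UNIV (\<lambda>x. integral {0..1} (\<lambda>\<sigma>. \<sigma> * radial_operator n h Y (fst x, snd x * \<sigma>)))"
      unfolding split_beta
      by (intro continuous_integral_param, unfold split_beta)
         (intro continuous_intros continuous_on_compose2[OF continuous_radial_operator[OF h that]], auto)
    then show ?thesis unfolding S_def split_beta
      by (intro continuous_intros)
  qed
  have Tc: "continuous_on UNIV (T F)" if "continuous_on UNIV F" for F
    using Sc[OF Ec[OF that]] unfolding T_def split_beta
    by (intro continuous_intros continuous_on_compose2[OF lc]) auto
  have diff: "\<bar>T F1 (p, r) - T F2 (p, r)\<bar> \<le> A / 2"
    if F: "continuous_on UNIV F1" "continuous_on UNIV F2" and A: "\<And>x. \<bar>F1 x - F2 x\<bar> \<le> A" for F1 F2 A p r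
  proof -
    have A0: "A \<ge> 0" using A[of undefined] by linarith
    let ?P = "\<lambda>F s. radial_operator n h (E F) (p, s)"
    have cP: "continuous_on UNIV (?P F)" if "continuous_on UNIV F" for F
      by (intro continuous_on_compose2[OF continuous_radial_operator[OF h Ec[OF that]]] continuous_intros) auto
    have ch: "continuous_on UNIV (\<lambda>\<tau>. \<tau> ^ n * h p (E F (p, s * \<tau>)))" if "continuous_on UNIV F" for F s
      by (intro continuous_intros continuous_on_compose2[OF h[unfolded split_beta], of _ "\<lambda>\<tau>. (p, E F (p, s * \<tau>))", simplified]
         continuous_on_compose2[OF Ec[OF that]]) auto
    have 1: "\<bar>s\<bar> * \<bar>?P F1 s - ?P F2 s\<bar> \<le> (L p * A) / l p * exp (l p * \<bar>s\<bar>)" for s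
    proof -
      let ?f = "\<lambda>\<tau>. \<tau> ^ n * h p (E F2 (p, s * \<tau>)) - \<tau> ^ n * h p (E F1 (p, s * \<tau>))"
      have "?P F1 s - ?P F2 s = integral {0..1} ?f"
        unfolding radial_operator_def
        by (simp, subst integral_diff) 
           (auto intro!: integrable_continuous_real continuous_on_subset[OF ch] F)
      moreover have "\<bar>s\<bar> * \<bar>integral {0..1} ?f\<bar> \<le> (L p * A) / l p * exp (l p * \<bar>s\<bar>)"
      proof (rule abs_scaled_integral_le)
        show "continuous_on {0..1} ?f"
          by (intro continuous_on_diff continuous_on_subset[OF ch] F) auto
        fix \<tau> :: real assume t: "\<tau> \<in> {0..1}"
        have "\<bar>?f \<tau>\<bar> = \<tau> ^ n * \<bar>h p (E F2 (p, s * \<tau>)) - h p (E F1 (p, s * \<tau>))\<bar>"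
          using t by (simp add: abs_mult flip: right_diff_distrib)
        also have "\<dots> \<le> 1 * (L p * \<bar>E F2 (p, s * \<tau>) - E F1 (p, s * \<tau>)\<bar>)"
          using t by (intro mult_mono lip power_le_one) auto
        also have "\<bar>E F2 (p, s * \<tau>) - E F1 (p, s * \<tau>)\<bar> = exp (l p * (\<bar>s\<bar> * \<tau>)) * \<bar>F1 (p, s * \<tau>) - F2 (p, s * \<tau>)\<bar>"
          using t by (simp add: E_def abs_mult abs_minus_commute flip: right_diff_distrib)
        also have "1 * (L p * (exp (l p * (\<bar>s\<bar> * \<tau>)) * \<bar>F1 (p, s * \<tau>) - F2 (p, s * \<tau>)\<bar>)) \<le> 1 * (L p * (exp (l p * (\<bar>s\<bar> * \<tau>)) * A))"
          using A L(2)[of p] by (intro mult_left_mono) (auto intro: less_imp_le)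
        finally show "\<bar>?f \<tau>\<bar> \<le> (L p * A) * exp (l p * (\<bar>s\<bar> * \<tau>))" by (simp add: mult_ac)
      qed (use lpos[of p] L(2)[of p] A0 in auto)
      ultimately show ?thesis by simp
    qed
    have 2: "S (E F1) (p, r) - S (E F2) (p, r) = r * integral {0..1} (\<lambda>\<sigma>. (r * \<sigma>) * (?P F1 (r * \<sigma>) - ?P F2 (r * \<sigma>)))"
    proof -
      have c: "continuous_on {0..1} (\<lambda>\<sigma>. ?P F (r * \<sigma>))" if "continuous_on UNIV F" for F
        by (intro continuous_on_compose2[OF cP[OF that]] continuous_intros) auto
      have "S (E F1) (p, r) - S (E F2) (p, r) = r\<^sup>2 * (integral {0..1} (\<lambda>\<sigma>. \<sigma> * ?P F1 (r * \<sigma>)) - integral {0..1} (\<lambda>\<sigma>. \<sigma> * ?P F2 (r * \<sigma>)))"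
        by (simp add: S_def algebra_simps)
      also have "\<dots> = r\<^sup>2 * integral {0..1} (\<lambda>\<sigma>. \<sigma> * ?P F1 (r * \<sigma>) - \<sigma> * ?P F2 (r * \<sigma>))"
        by (subst integral_diff) (auto intro!: integrable_continuous_real continuous_intros c F)
      also have "\<dots> = r * integral {0..1} (\<lambda>\<sigma>. r * (\<sigma> * ?P F1 (r * \<sigma>) - \<sigma> * ?P F2 (r * \<sigma>)))"
        by (simp add: power2_eq_square)
      finally show ?thesis by (simp add: algebra_simps)
    qed
    have "\<bar>r\<bar> * \<bar>integral {0..1} (\<lambda>\<sigma>. (r * \<sigma>) * (?P F1 (r * \<sigma>) - ?P F2 (r * \<sigma>)))\<bar> \<le> (L p * A / l p) / l p * exp (l p * \<bar>r\<bar>)"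
    proof (rule abs_scaled_integral_le)
      show "continuous_on {0..1} (\<lambda>\<sigma>. (r * \<sigma>) * (?P F1 (r * \<sigma>) - ?P F2 (r * \<sigma>)))"
        by (intro continuous_intros continuous_on_compose2[OF cP] F) auto
      fix \<sigma> :: real assume "\<sigma> \<in> {0..1}"
      then show "\<bar>(r * \<sigma>) * (?P F1 (r * \<sigma>) - ?P F2 (r * \<sigma>))\<bar> \<le> L p * A / l p * exp (l p * (\<bar>r\<bar> * \<sigma>))"
        using 1[of "r * \<sigma>"] by (simp add: abs_mult)
    qed (use lpos[of p] L(2)[of p] A0 in auto)
    moreover have "L p * A / l p / l p = A / 2" using l2[of p] L(2)[of p] by (simp add: field_simps)
    ultimately have "\<bar>S (E F1) (p, r) - S (E F2) (p, r)\<bar> \<le> A / 2 * exp (l p * \<bar>r\<bar>)"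
      unfolding 2 abs_mult by metis
    then have "exp (- (l p * \<bar>r\<bar>)) * \<bar>S (E F1) (p, r) - S (E F2) (p, r)\<bar> \<le> exp (- (l p * \<bar>r\<bar>)) * (A / 2 * exp (l p * \<bar>r\<bar>))"
      by (intro mult_left_mono) auto
    then show ?thesis by (simp add: T_def abs_mult exp_minus field_simps flip: right_diff_distrib)
  qed
  \<comment> \<open>Since \<open>h p 0 = 0\<close>, \<open>S\<close> sends 0 to the constant 1;
    together with \<open>diff\<close> this shows that \<open>T\<close> preserves
    boundedness.\<close>
  have T0: "\<bar>T (\<lambda>_. 0) (p, r)\<bar> \<le> 1" for p r
    using lpos[of p] by (simp add: T_def S_def E_def radial_operator_def h0)
  define TT where "TT F = Bcontfun (T (apply_bcontfun F))" for F :: "(real \<times> real) \<Rightarrow>\<^sub>C real"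
  have mem: "T (apply_bcontfun F) \<in> bcontfun" for F
  proof (rule bcontfun_normI)
    show "continuous_on UNIV (T (apply_bcontfun F))" by (intro Tc) simp
    fix x :: "real \<times> real"
    obtain p r where x: "x = (p, r)" by force
    have "\<bar>T (apply_bcontfun F) (p, r) - T (\<lambda>_. 0) (p, r)\<bar> \<le> norm F / 2"
      by (rule diff) (use norm_bounded[of F] in auto)
    then show "norm (T (apply_bcontfun F) x) \<le> 1 + norm F / 2"
      using T0[of p r] unfolding x real_norm_def by linarith
  qed
  have app: "apply_bcontfun (TT F) = T (apply_bcontfun F)" for F
    unfolding TT_def using mem by (rule Bcontfun_inverse)
  have "\<exists>!F. TT F = F"
  proof (rule banach_fix_type[of "1/2"])
    show "\<forall>F G. dist (TT F) (TT G) \<le> 1 / 2 * dist F G"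
    proof (intro allI)
      fix F G
      show "dist (TT F) (TT G) \<le> 1 / 2 * dist F G"
      proof (rule dist_bound)
        fix x :: "real \<times> real"
        obtain p r where x: "x = (p, r)" by force
        show "dist (apply_bcontfun (TT F) x) (apply_bcontfun (TT G) x) \<le> 1 / 2 * dist F G"
          using diff[of "apply_bcontfun F" "apply_bcontfun G" "dist F G" p r] dist_bounded[of F _ G]
          by (auto simp: app x dist_real_def)
      qed
    qed
  qed auto
  then obtain FF where "TT FF = FF" by blast
  then have fixed: "T (apply_bcontfun FF) = apply_bcontfun FF" using app by metis
  define Y where "Y = E (apply_bcontfun FF)"
  have Yc: "continuous_on UNIV Y" unfolding Y_def by (intro Ec) simp
  have YS: "Y = S Y"
  proof
    fix x :: "real \<times> real"
    obtain p r where x: "x = (p, r)" by force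
    have "Y (p, r) = exp (l p * \<bar>r\<bar>) * T (apply_bcontfun FF) (p, r)"
      unfolding fixed by (simp add: Y_def E_def)
    also have "\<dots> = S Y (p, r)" by (simp add: T_def Y_def exp_minus)
    finally show "Y x = S Y x" using x by simp
  qed
  define y where "y = curry Y"
  define P where "P p r = radial_operator n h Y (p, r)" for p r
  have Pc: "continuous_on UNIV (\<lambda>(p, r). P p r)"
    using continuous_radial_operator[OF h Yc] by (simp add: P_def)
  have y: "y p r = 1 + r ^ Suc 1 * integral {0..1} (\<lambda>\<sigma>. \<sigma> ^ 1 * P p (r * \<sigma>))" for p r
    using YS by (simp add: y_def P_def S_def fun_eq_iff power2_eq_square)
  show thesis
  proof
    show "continuous_on UNIV (\<lambda>(p, r). y p r)" using Yc by (simp add: y_def)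
    show "y p 0 = 1" for p by (simp add: y)
    show "radial_solution n (h p) (y p) (P p)" for p
      unfolding radial_solution_def
    proof (intro conjI allI)
      show Pp: "continuous_on UNIV (P p)"
        using continuous_on_section(1)[of UNIV UNIV P] Pc by simp
      fix r
      show "(y p has_real_derivative r * P p r) (at r)"
        unfolding y[abs_def] using DERIV_add[OF DERIV_const has_derivative_scaled_integral[OF Pp, of 1 r], of 1] by simp
      have c: "continuous_on UNIV (\<lambda>t. h p (y p t))"
        using continuous_on_compose2[OF continuous_on_section(1)[of UNIV UNIV h], of p UNIV "y p"] h
          continuous_on_section(1)[of UNIV UNIV y p] Yc
        by (auto simp: y_def)
      show "((\<lambda>r. r ^ Suc n * P p r) has_real_derivative - (r ^ n * h p (y p r))) (at r)"
        using DERIV_minus[OF has_derivative_scaled_integral[OF c, of n r]]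
        by (simp add: P_def radial_operator_def y_def)
    qed
  qed (fact Pc)
qed

section \<open>Uniqueness and angle functions\<close>

text \<open>The sum of squares times \<open>exp (2 * C * r)\<close> is nondecreasing, so it vanishes
  at a if it vanishes at b.\<close>

lemma backward_uniqueness:
  fixes u v :: "real \<Rightarrow> real"
  assumes ab: "a \<le> b" and c: "continuous_on {a..b} u" "continuous_on {a..b} v"
    and d: "\<And>r. a < r \<Longrightarrow> r < b \<Longrightarrow> (u has_real_derivative u' r) (at r)"
      "\<And>r. a < r \<Longrightarrow> r < b \<Longrightarrow> (v has_real_derivative v' r) (at r)"
    and bd: "\<And>r. a < r \<Longrightarrow> r < b \<Longrightarrow> \<bar>u' r\<bar> \<le> C * \<bar>v r\<bar>" "\<And>r. a < r \<Longrightarrow> r < b \<Longrightarrow> \<bar>v' r\<bar> \<le> C * \<bar>u r\<bar>"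
    and z: "u b = 0" "v b = 0"
  shows "u a = 0 \<and> v a = 0"
proof -
  let ?E = "\<lambda>r. ((u r)\<^sup>2 + (v r)\<^sup>2) * exp (2 * C * r)"
  have "?E a \<le> ?E b"
  proof (rule DERIV_nonneg_imp_increasing_open[OF ab])
    show "continuous_on {a..b} ?E" by (intro continuous_intros c)
    fix r assume r: "a < r" "r < b"
    have "(?E has_real_derivative (2 * (u r * u' r) + 2 * (v r * v' r) + 2 * C * ((u r)\<^sup>2 + (v r)\<^sup>2)) * exp (2 * C * r)) (at r)"
      by (auto intro!: derivative_eq_intros d r simp: algebra_simps)
    moreover have "2 * (u r * u' r) + 2 * (v r * v' r) + 2 * C * ((u r)\<^sup>2 + (v r)\<^sup>2) \<ge> 0"
    proof -
      have "\<bar>u r * u' r\<bar> \<le> \<bar>u r\<bar> * (C * \<bar>v r\<bar>)" "\<bar>v r * v' r\<bar> \<le> \<bar>v r\<bar> * (C * \<bar>u r\<bar>)"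
        using bd r by (auto simp: abs_mult intro: mult_left_mono)
      moreover have "2 * (\<bar>u r\<bar> * (C * \<bar>v r\<bar>)) \<le> C * ((u r)\<^sup>2 + (v r)\<^sup>2)" if "C \<ge> 0"
        using sum_squares_bound[of "\<bar>u r\<bar>" "\<bar>v r\<bar>"] mult_left_mono[OF _ that, of "2 * \<bar>u r\<bar> * \<bar>v r\<bar>" "(u r)\<^sup>2 + (v r)\<^sup>2"] 
        by (auto simp: mult_ac)
      moreover have "\<bar>v r\<bar> * (C * \<bar>u r\<bar>) = \<bar>u r\<bar> * (C * \<bar>v r\<bar>)" by simp
      ultimately have "C \<ge> 0 \<Longrightarrow> ?thesis" by linarith
      \<comment> \<open>No sign of C is assumed; for negative C the bounds themselves force both
        functions to vanish.\<close>
      moreover have "u r = 0 \<and> v r = 0" if "C < 0"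
        using bd[OF r] that by (smt (verit) mult_neg_pos)
      ultimately show ?thesis by fastforce
    qed
    ultimately show "\<exists>y. DERIV ?E r :> y \<and> 0 \<le> y" by fastforce
  qed
  then have "(u a)\<^sup>2 + (v a)\<^sup>2 \<le> 0" using z by (simp add: mult_le_0_iff)
  then show ?thesis by (simp add: sum_power2_le_zero_iff)
qed

lemma radial_solutionD:
  assumes "radial_solution n g u P"
  shows "continuous_on S P" "continuous_on S u" "(u has_real_derivative r * P r) (at r within S)"
    "((\<lambda>r. r ^ Suc n * P r) has_real_derivative - (r ^ n * g (u r))) (at r within S)"
proof -
  have d: "(u has_real_derivative r * P r) (at r within S)" for r S
    using assms unfolding radial_solution_def by (blast intro: has_field_derivative_at_within)
  show "(u has_real_derivative r * P r) (at r within S)" by (rule d)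
  show "continuous_on S u" using d by (rule DERIV_continuous_on)
  show "continuous_on S P" 
    using assms continuous_on_subset unfolding radial_solution_def by blast
  show "((\<lambda>r. r ^ Suc n * P r) has_real_derivative - (r ^ n * g (u r))) (at r within S)"
    using assms unfolding radial_solution_def by (blast intro: has_field_derivative_at_within)
qed

text \<open>In terms of u and \<open>s ^ n * u'\<close> the first equation has the coefficient
  \<open>1 / s ^ n\<close>. It is bounded on [r, b] only for positive r, so the constant of the
  estimate depends on r and the centre is left to a continuity argument.\<close>

lemma radial_solution_zero:
  assumes sol: "radial_solution n g u P" and L: "\<And>s. \<bar>g s\<bar> \<le> L * \<bar>s\<bar>"
    and b: "0 < b" "b \<le> 1" "u b = 0" "P b = 0" and r: "0 < r" "r \<le> b"
  shows "u r = 0"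
proof -
  have L0: "L \<ge> 0" using L[of 1] by simp
  define C where "C = 1 / r ^ n + L"
  have "u r = 0 \<and> r ^ Suc n * P r = 0"
  proof (rule backward_uniqueness[OF r(2) radial_solutionD(2)[OF sol] _ radial_solutionD(3)[OF sol] radial_solutionD(4)[OF sol], where C = C])
    show "continuous_on {r..b} (\<lambda>r. r ^ Suc n * P r)"
      by (intro continuous_intros radial_solutionD(1)[OF sol])
    fix s assume s: "r < s" "s < b"
    have "s * (r ^ n * \<bar>P s\<bar>) \<le> s * (s ^ n * \<bar>P s\<bar>)"
      using s r by (intro mult_left_mono mult_right_mono power_mono) auto
    then have "\<bar>s * P s\<bar> \<le> 1 / r ^ n * \<bar>s ^ Suc n * P s\<bar>" using r s
      by (simp add: field_simps abs_mult)
    also have "\<dots> \<le> C * \<bar>s ^ Suc n * P s\<bar>" using L0 by (intro mult_right_mono) (auto simp: C_def)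
    finally show "\<bar>s * P s\<bar> \<le> C * \<bar>s ^ Suc n * P s\<bar>" .
    have "\<bar>- (s ^ n * g (u s))\<bar> \<le> 1 * (L * \<bar>u s\<bar>)"
      unfolding abs_minus_cancel abs_mult using s r b L by (intro mult_mono) (auto intro!: power_le_one)
    also have "\<dots> \<le> C * \<bar>u s\<bar>" unfolding mult_1 using r by (intro mult_right_mono) (auto simp: C_def)
    finally show "\<bar>- (s ^ n * g (u s))\<bar> \<le> C * \<bar>u s\<bar>" .
  qed (use b in auto)
  then show ?thesis by simp
qed

lemma radial_solution_nonzero:
  assumes sol: "radial_solution n g u P" and L: "\<And>s. \<bar>g s\<bar> \<le> L * \<bar>s\<bar>"
    and b: "0 \<le> b" "b \<le> 1" and u0: "u 0 \<noteq> 0"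
  shows "u b \<noteq> 0 \<or> P b \<noteq> 0"
proof (rule ccontr)
  assume *: "\<not> ?thesis"
  then have "b > 0" using u0 b by (cases "b = 0") auto
  then have "u r = 0" if "r \<in> {0<..b}" for r
    using radial_solution_zero[OF sol L] b * that by auto
  moreover have "(u \<longlongrightarrow> u 0) (at_right 0)"
    using radial_solutionD(2)[OF sol, of UNIV] by (auto simp: continuous_on_def intro: filterlim_at_within_If tendsto_mono[OF at_le])
  moreover have "eventually (\<lambda>r. r \<in> {0<..b}) (at_right 0)"
    using \<open>b > 0\<close> eventually_at_right[of 0] by (metis greaterThanAtMost_iff less_imp_le)
  ultimately have "u 0 = 0"
    by (metis (mono_tags, lifting) eventually_mono tendsto_eventually tendsto_unique trivial_limit_at_right_real)
  then show False using u0 by simp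
qed

text \<open>The domain is convex, hence contractible, so Z has a logarithm G that is continuous in
  parameter and radius jointly. At r = 0 the value of Z is a positive real, so Im G is a multiple of
  2 pi there, and subtracting it normalises the angle without changing directions.\<close>

lemma angle_function_exists:
  fixes Z :: "'a::real_normed_vector \<times> real \<Rightarrow> complex"
  assumes c: "continuous_on (UNIV \<times> {0..1}) Z" and nz: "\<And>p r. r \<in> {0..1} \<Longrightarrow> Z (p, r) \<noteq> 0"
    and Z0: "\<And>p. Im (Z (p, 0)) = 0" "\<And>p. Re (Z (p, 0)) > 0"
  obtains \<theta> :: "'a \<Rightarrow> real \<Rightarrow> real" where "continuous_on (UNIV \<times> {0..1}) (\<lambda>(p, r). \<theta> p r)" "\<And>p. \<theta> p 0 = 0"
    "\<And>p r. r \<in> {0..1} \<Longrightarrow> Z (p, r) = of_real (cmod (Z (p, r))) * cis (\<theta> p r)"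
proof -
  have "contractible ((UNIV :: 'a set) \<times> {0..1::real})" 
    by (intro convex_imp_contractible convex_Times) auto
  then obtain G where G: "continuous_on (UNIV \<times> {0..1}) G" "\<And>x. x \<in> UNIV \<times> {0..1} \<Longrightarrow> Z x = exp (G x)"
    using continuous_logarithm_on_contractible[OF c] nz by (metis SigmaE)
  define \<theta> where "\<theta> p r = Im (G (p, r)) - Im (G (p, 0))" for p r
  show thesis
  proof
    show "continuous_on (UNIV \<times> {0..1}) (\<lambda>(p, r). \<theta> p r)" 
      unfolding \<theta>_def split_beta
      by (intro continuous_intros continuous_on_compose2[OF G(1)]) auto
    show "\<theta> p 0 = 0" for p by (simp add: \<theta>_def)
    fix p and r :: real assume r: "r \<in> {0..1}"
    have 0: "Z (p, 0) = of_real (exp (Re (G (p, 0)))) * cis (Im (G (p, 0)))"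
      using G(2)[of "(p, 0)"] by (simp add: exp_eq_polar)
    have "Im (Z (p, 0)) = exp (Re (G (p, 0))) * sin (Im (G (p, 0)))"
      "Re (Z (p, 0)) = exp (Re (G (p, 0))) * cos (Im (G (p, 0)))" by (simp_all add: 0)
    then have s: "sin (Im (G (p, 0))) = 0" "cos (Im (G (p, 0))) > 0" 
      using Z0[of p] by (auto simp: zero_less_mult_iff)
    then have "cis (Im (G (p, 0))) = 1"
      using sin_cos_squared_add[of "Im (G (p, 0))"] by (simp add: complex_eq_iff power2_eq_1_iff)
    then have "cis (Im (G (p, r))) = cis (\<theta> p r)" by (simp add: \<theta>_def flip: cis_divide)
    moreover have "Z (p, r) = of_real (cmod (Z (p, r))) * cis (Im (G (p, r)))"
      using G(2)[of "(p, r)"] r by (simp add: exp_eq_polar norm_mult)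
    ultimately show "Z (p, r) = of_real (cmod (Z (p, r))) * cis (\<theta> p r)" by simp
  qed
qed

text \<open>Continuity of the angle is enough: near r it equals \<open>\<theta> r\<close> plus the
  arctan of a quotient of differentiable functions, since that quotient is the tangent of the
  increment.\<close>

lemma angle_has_derivative:
  fixes x w \<theta> \<rho> :: "real \<Rightarrow> real"
  assumes r: "r \<in> S" and d: "(x has_real_derivative x') (at r within S)" "(w has_real_derivative w') (at r within S)"
    and c: "continuous (at r within S) \<theta>"
    and polar: "\<And>s. s \<in> S \<Longrightarrow> x s = \<rho> s * cos (\<theta> s)" "\<And>s. s \<in> S \<Longrightarrow> w s = \<rho> s * sin (\<theta> s)"
    and pos: "\<And>s. s \<in> S \<Longrightarrow> \<rho> s > 0"
  shows "(\<theta> has_real_derivative (w' * x r - x' * w r) / (\<rho> r)\<^sup>2) (at r within S)"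
proof -
  let ?N = "\<lambda>s. w s * x r - x s * w r" and ?D = "\<lambda>s. x s * x r + w s * w r"
  let ?g = "\<lambda>s. \<theta> r + arctan (?N s / ?D s)"
  have Dr: "?D r = (\<rho> r)\<^sup>2" 
    unfolding polar[OF r] using sin_cos_squared_add2[of "\<theta> r"] by algebra
  have g: "\<theta> s = ?g s" if "s \<in> S" "\<bar>\<theta> s - \<theta> r\<bar> < pi / 2" for s
  proof -
    have "?N s = \<rho> s * \<rho> r * sin (\<theta> s - \<theta> r)" "?D s = \<rho> s * \<rho> r * cos (\<theta> s - \<theta> r)"
      unfolding sin_diff cos_diff polar[OF r] polar[OF that(1)] by (auto simp: algebra_simps)
    then have "?N s / ?D s = tan (\<theta> s - \<theta> r)"
      using pos[OF r] pos[OF that(1)] by (simp add: tan_def)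
    moreover have "arctan (tan (\<theta> s - \<theta> r)) = \<theta> s - \<theta> r"
      by (intro arctan_tan) (use that(2) in linarith)+
    ultimately show ?thesis by simp
  qed
  have "eventually (\<lambda>s. dist (\<theta> s) (\<theta> r) < pi / 2) (at r within S)"
    using c unfolding continuous_within by (rule tendstoD) simp
  then have ev: "eventually (\<lambda>s. \<theta> s = ?g s) (at r within S)"
    unfolding eventually_at_filter dist_real_def by (rule eventually_mono) (blast intro: g)
  have "?D r \<noteq> 0" using pos[OF r] Dr by simp
  have "(?g has_real_derivative (w' * x r - x' * w r) / (\<rho> r)\<^sup>2) (at r within S)"
    by (rule derivative_eq_intros refl d | fact \<open>?D r \<noteq> 0\<close>)+ (use \<open>?D r \<noteq> 0\<close> in \<open>simp add: Dr power2_eq_square\<close>)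
  then show ?thesis
    using has_field_derivative_cong_eventually[OF ev g[OF r]] by simp
qed

lemma angle_less:
  fixes \<delta> :: "real \<Rightarrow> real"
  assumes "continuous_on {a..b} \<delta>" "\<delta> a < c" "\<And>r. r \<in> {a..b} \<Longrightarrow> \<delta> r \<noteq> c" "r \<in> {a..b}"
  shows "\<delta> r < c"
proof (rule ccontr)
  assume "\<not> \<delta> r < c"
  then have "\<exists>s\<ge>a. s \<le> r \<and> \<delta> s = c"
    using assms by (intro IVT') (auto intro: continuous_on_subset)
  then obtain s where "a \<le> s" "s \<le> r" "\<delta> s = c" by blast
  then have "s \<in> {a..b}" using assms(4) by auto
  with \<open>\<delta> s = c\<close> show False using assms(3) by blast
qed

lemma angle_abs_less_pi_half:
  fixes \<delta> :: "real \<Rightarrow> real"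
  assumes "continuous_on {a..b} \<delta>" "\<delta> a = 0" "\<And>r. r \<in> {a..b} \<Longrightarrow> cos (\<delta> r) > 0" "r \<in> {a..b}"
  shows "\<bar>\<delta> r\<bar> < pi / 2"
proof -
  have "\<delta> s \<noteq> pi / 2" "- \<delta> s \<noteq> pi / 2" if "s \<in> {a..b}" for s
    using assms(3)[OF that] by (metis cos_pi_half less_irrefl, metis cos_minus cos_pi_half less_irrefl)
  then have "\<delta> r < pi / 2" "- \<delta> r < pi / 2"
    using angle_less[OF assms(1) _ _ assms(4), of "pi / 2"]
      angle_less[OF continuous_on_minus[OF assms(1)] _ _ assms(4), of "pi / 2"] assms(2) by auto
  then show ?thesis by linarith
qed

text \<open>The plane curve is y paired with \<open>- (r ^ n * y')\<close>. The minus sign makes it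
  turn counterclockwise at each r > 0 with \<open>h p (y p r) * y p r > 0\<close>.\<close>

locale radial_family =
  fixes n :: nat and h :: "real \<Rightarrow> real \<Rightarrow> real" and y P \<theta> :: "real \<Rightarrow> real \<Rightarrow> real"
  assumes y_cont: "continuous_on UNIV (\<lambda>(p, r). y p r)"
    and y0: "y p 0 = 1"
    and sol: "radial_solution n (h p) (y p) (P p)"
    and \<theta>_cont: "continuous_on (UNIV \<times> {0..1}) (\<lambda>(p, r). \<theta> p r)"
    and \<theta>0: "\<theta> p 0 = 0"
    and nonzero: "r \<in> {0..1} \<Longrightarrow> y p r \<noteq> 0 \<or> P p r \<noteq> 0"
    and polar: "r \<in> {0..1} \<Longrightarrow> 
      Complex (y p r) (- (r ^ Suc n * P p r)) = of_real (cmod (Complex (y p r) (- (r ^ Suc n * P p r)))) * cis (\<theta> p r)"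
begin

definition \<rho> where "\<rho> p r = cmod (Complex (y p r) (- (r ^ Suc n * P p r)))"

lemma y_polar: "r \<in> {0..1} \<Longrightarrow> y p r = \<rho> p r * cos (\<theta> p r)"
  and v_polar: "r \<in> {0..1} \<Longrightarrow> r ^ Suc n * P p r = - (\<rho> p r * sin (\<theta> p r))"
  using polar[of r p, folded \<rho>_def] by (auto simp: complex_eq_iff)

lemma \<rho>_pos: "r \<in> {0..1} \<Longrightarrow> \<rho> p r > 0"
  using nonzero[of r p] y0[of p] by (auto simp: \<rho>_def complex_eq_iff)

lemma \<theta>_cont_snd: "continuous_on {0..1} (\<theta> p)"
  using continuous_on_section(1)[OF \<theta>_cont] by simp

lemma \<theta>_cont_fst: "continuous_on UNIV (\<lambda>p. \<theta> p 1)"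
  using continuous_on_section(2)[OF \<theta>_cont, of 1] by simp

lemma neumann_iff: "P p 1 = 0 \<longleftrightarrow> sin (\<theta> p 1) = 0"
  using v_polar[of 1 p] \<rho>_pos[of 1 p] by auto

lemma \<theta>_deriv:
  assumes "r \<in> {0..1}"
  shows "(\<theta> p has_real_derivative (r ^ n * h p (y p r) * y p r + r * P p r * (r ^ Suc n * P p r)) / (\<rho> p r)\<^sup>2) (at r within {0..1})"
proof -
  have "(\<theta> p has_real_derivative (r ^ n * h p (y p r) * y p r - r * P p r * (\<lambda>r. - (r ^ Suc n * P p r)) r) / (\<rho> p r)\<^sup>2) (at r within {0..1})"
  proof (rule angle_has_derivative)
    show "((\<lambda>r. - (r ^ Suc n * P p r)) has_real_derivative r ^ n * h p (y p r)) (at r within {0..1})"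
      using DERIV_minus[OF radial_solutionD(4)[OF sol]] by simp
    show "continuous (at r within {0..1}) (\<theta> p)" 
      using \<theta>_cont_snd assms by (simp add: continuous_on_eq_continuous_within)
  qed (use assms in \<open>auto simp: v_polar y_polar \<rho>_pos simp del: power_Suc intro: radial_solutionD[OF sol]\<close>)
  then show ?thesis by simp
qed

end

lemma radial_family_angle_exists:
  fixes h :: "real \<Rightarrow> real \<Rightarrow> real" and L :: "real \<Rightarrow> real"
  assumes h: "continuous_on UNIV (\<lambda>(p, y). h p y)" and L: "continuous_on UNIV L" "\<And>p. L p > 0"
    and lip: "\<And>p y z. \<bar>h p y - h p z\<bar> \<le> L p * \<bar>y - z\<bar>" and h0: "\<And>p. h p 0 = 0"
  obtains y P \<theta> where "radial_family n h y P \<theta>"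
proof -
  obtain y P where yP: "continuous_on UNIV (\<lambda>(p, r). y p r)" "continuous_on UNIV (\<lambda>(p, r). P p r)"
    "\<And>p. y p 0 = 1" "\<And>p. radial_solution n (h p) (y p) (P p)"
    using radial_family_exists[OF assms] by blast
  have "\<bar>h p s\<bar> \<le> L p * \<bar>s\<bar>" for p s using lip[of p s 0] h0 by simp
  then have nz: "y p r \<noteq> 0 \<or> P p r \<noteq> 0" if "r \<in> {0..1}" for p r
    using radial_solution_nonzero[OF yP(4), of p "L p" r] yP(3)[of p] that by auto
  have "continuous_on (UNIV \<times> {0..1}) (\<lambda>(p, r). Complex (y p r) (- (r ^ Suc n * P p r)))"
    using yP(1,2) unfolding split_beta 
    by (intro continuous_on_Complex continuous_intros) (auto intro: continuous_on_subset)
  then obtain \<theta> where "continuous_on (UNIV \<times> {0..1}) (\<lambda>(p, r). \<theta> p r)" "\<And>p. \<theta> p 0 = 0"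
    "\<And>p r. r \<in> {0..1} \<Longrightarrow> Complex (y p r) (- (r ^ Suc n * P p r)) 
        = of_real (cmod (Complex (y p r) (- (r ^ Suc n * P p r)))) * cis (\<theta> p r)"
  proof (rule angle_function_exists, goal_cases)
    case (1 p r)
    then show ?case using nz[of r p] yP(3)[of p] by (auto simp: complex_eq_iff)
  qed (use yP(3) in auto)
  then have "radial_family n h y P \<theta>" using yP nz by unfold_locales auto
  then show thesis by (rule that)
qed

section \<open>The linear equation\<close>

text \<open>A maximum point on [a, b] can only be b, since immediately to the right of any other
  point f takes larger values; applied to a itself, this also makes the inequality strict.\<close>

lemma locally_increasing_imp_strict_mono:
  fixes f :: "real \<Rightarrow> real"
  assumes c: "continuous_on UNIV f"
    and loc: "\<And>x. \<exists>\<delta>>0. \<forall>z. \<bar>z - x\<bar> < \<delta> \<longrightarrow> z \<noteq> x \<longrightarrow> (f z - f x) * (z - x) > 0"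
  shows "strict_mono f"
proof (rule strict_monoI)
  fix a b :: real assume ab: "a < b"
  obtain m where m: "m \<in> {a..b}" "\<And>x. x \<in> {a..b} \<Longrightarrow> f x \<le> f m"
    using continuous_attains_sup[of "{a..b}" f] ab continuous_on_subset[OF c] by auto
  have right: "\<exists>z\<in>{x..b}. f z > f x" if x: "x \<in> {a..<b}" for x
  proof -
    obtain d where d: "d > 0" "\<And>z. \<bar>z - x\<bar> < d \<Longrightarrow> z \<noteq> x \<Longrightarrow> (f z - f x) * (z - x) > 0"
      using loc by metis
    define z where "z = min b (x + d / 2)"
    have z: "x < z" "z \<le> b" "\<bar>z - x\<bar> < d" using x d(1) by (auto simp: z_def min_def)
    then have "f z > f x" using d(2)[of z] by (auto simp: zero_less_mult_iff)
    then show ?thesis using z by (intro bexI[of _ z]) auto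
  qed
  have "m = b"
  proof (rule ccontr)
    assume "m \<noteq> b"
    then obtain z where "z \<in> {m..b}" "f z > f m" using right[of m] m(1) by auto
    then show False using m(2)[of z] m(1) by auto
  qed
  moreover obtain z where "z \<in> {a..b}" "f a < f z" using right[of a] ab by auto
  ultimately show "f a < f b" using m(2) by fastforce
qed

lemma integral_weighted_square_pos:
  fixes u :: "real \<Rightarrow> real"
  assumes "continuous_on {0..1} u" "\<exists>r\<in>{0<..1}. u r \<noteq> 0"
  shows "integral {0..1} (\<lambda>r. r ^ n * (u r * u r)) > 0"
proof -
  obtain s where s: "s \<in> {0<..1}" "u s \<noteq> 0" using assms by blast
  have c: "continuous_on {0..1} (\<lambda>r. r ^ n * (u r * u r))" by (intro continuous_intros assms)
  have nn: "r ^ n * (u r * u r) \<ge> 0" if "r \<in> {0..1}" for r using that by simp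
  have "integral {0..1} (\<lambda>r. r ^ n * (u r * u r)) \<noteq> 0"
  proof
    assume "integral {0..1} (\<lambda>r. r ^ n * (u r * u r)) = 0"
    then have "((\<lambda>r. r ^ n * (u r * u r)) has_integral 0) (cbox 0 1)"
      using integrable_integral[OF integrable_continuous_real[OF c]] by simp
    then have "s ^ n * (u s * u s) = 0"
      using has_integral_0_cbox_imp_0[of 0 1 "\<lambda>r. r ^ n * (u r * u r)" s] c nn s by auto
    then show False using s by simp
  qed
  moreover have "integral {0..1} (\<lambda>r. r ^ n * (u r * u r)) \<ge> 0"
    by (rule integral_nonneg) (use nn c in \<open>auto intro: integrable_continuous_real\<close>)
  ultimately show ?thesis by simp
qed

locale linear_family = radial_family n "\<lambda>\<mu> y. (\<mu> - 1) * y" y P \<theta> for n y P \<theta>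
begin

text \<open>This is Lagrange's identity: differentiating the Wronskian cancels the products of first
  derivatives, and the weight \<open>r ^ Suc n\<close> removes the boundary term at 0.\<close>

lemma wronskian:
  "y \<mu> 1 * P \<nu> 1 - y \<nu> 1 * P \<mu> 1 = (\<mu> - \<nu>) * integral {0..1} (\<lambda>r. r ^ n * (y \<mu> r * y \<nu> r))"
proof -
  let ?W = "\<lambda>r. y \<mu> r * (r ^ Suc n * P \<nu> r) - y \<nu> r * (r ^ Suc n * P \<mu> r)"
  have "((\<lambda>r. (\<mu> - \<nu>) * (r ^ n * (y \<mu> r * y \<nu> r))) has_integral ?W 1 - ?W 0) {0..1}"
  proof (rule fundamental_theorem_of_calculus)
    fix r :: real
    have "(?W has_real_derivative
        ((r * P \<mu> r) * (r ^ Suc n * P \<nu> r) + - (r ^ n * ((\<nu> - 1) * y \<nu> r)) * y \<mu> r)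
        - ((r * P \<nu> r) * (r ^ Suc n * P \<mu> r) + - (r ^ n * ((\<mu> - 1) * y \<mu> r)) * y \<nu> r)) (at r within {0..1})"
      by (intro DERIV_diff DERIV_mult radial_solutionD(3,4)[OF sol])
    moreover have "((r * P \<mu> r) * (r ^ Suc n * P \<nu> r) + - (r ^ n * ((\<nu> - 1) * y \<nu> r)) * y \<mu> r)
        - ((r * P \<nu> r) * (r ^ Suc n * P \<mu> r) + - (r ^ n * ((\<mu> - 1) * y \<mu> r)) * y \<nu> r)
       = (\<mu> - \<nu>) * (r ^ n * (y \<mu> r * y \<nu> r))"
      by (simp add: algebra_simps)
    ultimately show "(?W has_vector_derivative (\<mu> - \<nu>) * (r ^ n * (y \<mu> r * y \<nu> r))) (at r within {0..1})"
      by (simp add: has_real_derivative_iff_has_vector_derivative)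
  qed simp
  from integral_unique[OF this] show ?thesis by simp
qed

text \<open>The Wronskian at \<open>r = 1\<close> is \<open>(\<mu> - \<nu>)\<close> times an integral that is positive for \<open>\<nu>\<close> near \<open>\<mu>\<close>, and it has
  the sign of \<open>sin (\<theta> \<mu> 1 - \<theta> \<nu> 1)\<close>.\<close>

lemma \<Theta>_locally_increasing:
  "\<exists>\<delta>>0. \<forall>\<nu>. \<bar>\<nu> - \<mu>\<bar> < \<delta> \<longrightarrow> \<nu> \<noteq> \<mu> \<longrightarrow> (\<theta> \<nu> 1 - \<theta> \<mu> 1) * (\<nu> - \<mu>) > 0"
proof -
  define I where "I \<nu> = integral {0..1} (\<lambda>r. r ^ n * (y \<mu> r * y \<nu> r))" for \<nu>
  have cy: "continuous_on S (y \<mu>)" for \<mu> S by (rule radial_solutionD(2)[OF sol])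
  have "continuous_on UNIV I" unfolding I_def
  proof (intro continuous_integral_param, unfold split_beta, intro continuous_intros)
    show "continuous_on UNIV (\<lambda>x. y (fst x) (snd x))" using y_cont by (simp add: split_beta)
    show "continuous_on UNIV (\<lambda>x::real \<times> real. y \<mu> (snd x))"
      by (intro continuous_on_compose2[OF cy[of UNIV]] continuous_intros) auto
  qed
  then have Ic: "isCont I \<mu>" by (simp add: continuous_on_eq_continuous_at)
  have "\<exists>r\<in>{0<..1}. y \<mu> r \<noteq> 0"
  proof -
    have "(y \<mu> \<longlongrightarrow> y \<mu> 0) (at 0 within UNIV)"
      using cy[of UNIV \<mu>] unfolding continuous_on_def by blast
    then have "(y \<mu> \<longlongrightarrow> 1) (at_right 0)" unfolding y0 by (rule tendsto_within_subset) simp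
    then have "eventually (\<lambda>r. y \<mu> r > 0) (at_right 0)" by (rule order_tendstoD) simp
    moreover have "eventually (\<lambda>r::real. r \<in> {0<..<1}) (at_right 0)"
      by (rule eventually_at_right_real) simp
    ultimately have "eventually (\<lambda>r. y \<mu> r > 0 \<and> r \<in> {0<..<1}) (at_right 0)" by (rule eventually_conj)
    from eventually_happens[OF this] show ?thesis by force
  qed
  then have "I \<mu> > 0" unfolding I_def by (intro integral_weighted_square_pos cy)
  then have "eventually (\<lambda>\<nu>. I \<nu> > 0) (at \<mu>)" using Ic by (intro order_tendstoD[of I "I \<mu>"]) (simp_all add: isCont_def)
  moreover have "eventually (\<lambda>\<nu>. dist (\<theta> \<nu> 1) (\<theta> \<mu> 1) < pi) (at \<mu>)"
    using \<theta>_cont_fst by (intro tendstoD) (auto simp: continuous_on_def)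
  ultimately have "eventually (\<lambda>\<nu>. I \<nu> > 0 \<and> dist (\<theta> \<nu> 1) (\<theta> \<mu> 1) < pi) (at \<mu>)" by (rule eventually_conj)
  then obtain \<delta> where \<delta>: "\<delta> > 0" "\<And>\<nu>. \<nu> \<noteq> \<mu> \<Longrightarrow> dist \<nu> \<mu> < \<delta> \<Longrightarrow> I \<nu> > 0 \<and> dist (\<theta> \<nu> 1) (\<theta> \<mu> 1) < pi"
    by (auto simp: eventually_at)
  show ?thesis
  proof (intro exI conjI allI impI)
    fix \<nu> assume \<nu>: "\<bar>\<nu> - \<mu>\<bar> < \<delta>" "\<nu> \<noteq> \<mu>"
    then have *: "I \<nu> > 0" "\<bar>\<theta> \<nu> 1 - \<theta> \<mu> 1\<bar> < pi" using \<delta>(2)[of \<nu>] by (auto simp: dist_real_def)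
    have "\<rho> \<mu> 1 * \<rho> \<nu> 1 * sin (\<theta> \<nu> 1 - \<theta> \<mu> 1) = y \<nu> 1 * P \<mu> 1 - y \<mu> 1 * P \<nu> 1"
      using y_polar[of 1 \<mu>] y_polar[of 1 \<nu>] v_polar[of 1 \<mu>] v_polar[of 1 \<nu>] by (simp add: sin_diff algebra_simps)
    also have "\<dots> = (\<nu> - \<mu>) * I \<nu>" using wronskian[of \<mu> \<nu>] by (simp add: I_def algebra_simps)
    finally have eq: "\<rho> \<mu> 1 * \<rho> \<nu> 1 * sin (\<theta> \<nu> 1 - \<theta> \<mu> 1) = (\<nu> - \<mu>) * I \<nu>" .
    have pos: "\<rho> \<mu> 1 * \<rho> \<nu> 1 > 0" by (simp add: \<rho>_pos)
    show "(\<theta> \<nu> 1 - \<theta> \<mu> 1) * (\<nu> - \<mu>) > 0"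
    proof (cases "\<nu> > \<mu>")
      case True
      then have "sin (\<theta> \<nu> 1 - \<theta> \<mu> 1) > 0" 
        using eq pos * by (metis diff_gt_0_iff_gt mult_pos_pos zero_less_mult_pos)
      then have "\<theta> \<nu> 1 - \<theta> \<mu> 1 > 0" using sin_ge_zero[of "- (\<theta> \<nu> 1 - \<theta> \<mu> 1)"] *
        unfolding sin_minus by linarith
      then show ?thesis using True by simp
    next
      case False
      then have "\<rho> \<mu> 1 * \<rho> \<nu> 1 * sin (\<theta> \<nu> 1 - \<theta> \<mu> 1) < 0"
        using eq * \<nu> by (simp add: mult_neg_pos)
      then have "sin (\<theta> \<nu> 1 - \<theta> \<mu> 1) < 0" using pos by (meson less_asym mult_less_0_iff)
      then have "\<theta> \<nu> 1 - \<theta> \<mu> 1 < 0" using sin_ge_zero[of "\<theta> \<nu> 1 - \<theta> \<mu> 1"] * by linarith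
      then show ?thesis using False \<nu> by (simp add: mult_neg_neg)
    qed
  qed (rule \<delta>)
qed

lemma \<Theta>_strict_mono: "strict_mono (\<lambda>\<mu>. \<theta> \<mu> 1)"
  by (rule locally_increasing_imp_strict_mono[OF \<theta>_cont_fst \<Theta>_locally_increasing])

lemma constant_solution: assumes "r \<in> {0..1}" shows "y 1 r = 1" "r ^ Suc n * P 1 r = 0"
proof -
  have v: "s ^ Suc n * P 1 s = 0" for s
  proof -
    have "\<exists>c. \<forall>x\<in>UNIV. x ^ Suc n * P 1 x = c"
      by (rule has_field_derivative_zero_constant) (use radial_solutionD(4)[OF sol[of 1], of _ UNIV] in auto)
    then obtain c where "\<And>x. x ^ Suc n * P 1 x = c" by blast
    from this[of s] this[of 0] show ?thesis by simp
  qed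
  then have "s * P 1 s = 0" for s by (metis mult_eq_0_iff power_eq_0_iff)
  then have "(y 1 has_real_derivative 0) (at s)" for s
    using radial_solutionD(3)[OF sol[of 1], of s UNIV] by metis
  then have "\<exists>c. \<forall>x\<in>UNIV. y 1 x = c"
    by (intro has_field_derivative_zero_constant) auto
  then show "y 1 r = 1" using y0[of 1] by (metis UNIV_I)
  show "r ^ Suc n * P 1 r = 0" by (rule v)
qed

lemma \<Theta>_one: "\<theta> 1 1 = 0"
proof -
  have "sin (\<theta> 1 r) = 0 \<and> cos (\<theta> 1 r) > 0" if "r \<in> {0..1}" for r
    using constant_solution[OF that] y_polar[OF that, of 1] v_polar[OF that, of 1] \<rho>_pos[OF that, of 1]
    by (metis mult_eq_0_iff neg_equal_0_iff_equal not_less_iff_gr_or_eq zero_less_mult_pos zero_less_one)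
  then have "\<bar>\<theta> 1 1\<bar> < pi / 2" "sin (\<theta> 1 1) = 0"
    using angle_abs_less_pi_half[OF \<theta>_cont_snd, of 1 1] \<theta>0[of 1] by auto
  then show ?thesis by (smt (verit) pi_gt_zero sin_eq_0_pi field_sum_of_halves)
qed

text \<open>For \<open>\<mu> > 1\<close> the angle of \<open>\<surd>(\<mu> - 1) y - i r\<^sup>n y'\<close> stays within \<open>\<pi>/2\<close> of \<open>\<theta>\<close> and
  turns with speed at least \<open>\<surd>(\<mu> - 1) r\<^sup>n\<close>.\<close>

lemma \<Theta>_lower_bound:
  assumes "\<mu> > 1"
  shows "\<theta> \<mu> 1 > sqrt (\<mu> - 1) / Suc n - pi / 2"
proof -
  define c where "c = sqrt (\<mu> - 1)"
  have c: "c > 0" "c * c = \<mu> - 1" using assms by (auto simp: c_def)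
  define v where "v r = r ^ Suc n * P \<mu> r" for r
  \<comment> \<open>The parameter q is a dummy that gives Z the shape expected by
    \<open>angle_function_exists\<close>.\<close>
  define Z where "Z = (\<lambda>(q::real, r). Complex (c * y \<mu> r) (- v r))"
  have "continuous_on (UNIV \<times> {0..1}) Z"
    unfolding Z_def v_def split_beta
    by (intro continuous_on_Complex continuous_intros continuous_on_compose2[OF radial_solutionD(1)[OF sol]]
          continuous_on_compose2[OF radial_solutionD(2)[OF sol]]) auto
  moreover have nz: "Z (q, r) \<noteq> 0" if "r \<in> {0..1}" for q r
    using nonzero[OF that, of \<mu>] c y0[of \<mu>] by (auto simp: Z_def v_def complex_eq_iff)
  ultimately obtain \<phi>' where \<phi>': "continuous_on (UNIV \<times> {0..1}) (\<lambda>(q, r). \<phi>' q r)" "\<And>q. \<phi>' q 0 = 0"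
    "\<And>q r. r \<in> {0..1} \<Longrightarrow> Z (q, r) = of_real (cmod (Z (q, r))) * cis (\<phi>' q r)"
    by (rule angle_function_exists) (use c y0 in \<open>auto simp: Z_def v_def\<close>)
  define \<phi> where "\<phi> = \<phi>' 0"
  define R where "R r = cmod (Z (0, r))" for r
  have \<phi>c: "continuous_on {0..1} \<phi>" unfolding \<phi>_def using continuous_on_section(1)[OF \<phi>'(1)] by simp
  have Rpos: "R r > 0" if "r \<in> {0..1}" for r using nz[OF that] by (simp add: R_def)
  have R2: "(R r)\<^sup>2 = (c * y \<mu> r)\<^sup>2 + (v r)\<^sup>2" for r by (simp add: R_def Z_def cmod_def)
  have pol: "c * y \<mu> r = R r * cos (\<phi> r)" "- v r = R r * sin (\<phi> r)" if "r \<in> {0..1}" for r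
    using \<phi>'(3)[OF that, of 0, folded R_def \<phi>_def] by (auto simp: Z_def complex_eq_iff)
  have d: "(\<phi> has_real_derivative (r ^ n * ((\<mu> - 1) * y \<mu> r) * (c * y \<mu> r) - c * (r * P \<mu> r) * (- v r)) / (R r)\<^sup>2) (at r within {0..1})"
    if "r \<in> {0..1}" for r
  proof (rule angle_has_derivative)
    show "((\<lambda>r. c * y \<mu> r) has_real_derivative c * (r * P \<mu> r)) (at r within {0..1})"
      by (intro DERIV_cmult radial_solutionD[OF sol])
    show "((\<lambda>r. - v r) has_real_derivative r ^ n * ((\<mu> - 1) * y \<mu> r)) (at r within {0..1})"
      using DERIV_minus[OF radial_solutionD(4)[OF sol]] by (simp add: v_def)
    show "continuous (at r within {0..1}) \<phi>" 
      using \<phi>c that by (simp add: continuous_on_eq_continuous_within)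
  qed (use that pol Rpos in auto)
  \<comment> \<open>The product of y' and v is \<open>r ^ n * y'\<^sup>2\<close>, which dominates
    \<open>r ^ n * v\<^sup>2\<close> because r is at most 1; hence the numerator is at least
    \<open>c * r ^ n * (R r)\<^sup>2\<close>.\<close>
  have lower: "(r ^ n * ((\<mu> - 1) * y \<mu> r) * (c * y \<mu> r) - c * (r * P \<mu> r) * (- v r)) / (R r)\<^sup>2 \<ge> c * r ^ n"
    if "r \<in> {0..1}" for r
  proof -
    have "r * P \<mu> r * v r = r ^ n * (r * P \<mu> r)\<^sup>2" by (simp add: v_def power2_eq_square)
    then have "r * P \<mu> r * v r \<ge> 0" using that by simp
    have "r ^ n * (v r)\<^sup>2 = (r * P \<mu> r * v r) * (r ^ n) ^ 2" by (simp add: v_def power2_eq_square)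
    also have "\<dots> \<le> (r * P \<mu> r * v r) * 1"
      using that \<open>r * P \<mu> r * v r \<ge> 0\<close> by (intro mult_left_mono) (auto simp: power_le_one)
    finally have "c * (r ^ n * (v r)\<^sup>2) \<le> c * (r * P \<mu> r * v r)" using c by (intro mult_left_mono) auto
    then have "c * r ^ n * (R r)\<^sup>2 \<le> r ^ n * ((\<mu> - 1) * y \<mu> r) * (c * y \<mu> r) - c * (r * P \<mu> r) * (- v r)"
      unfolding R2 by (simp add: power2_eq_square algebra_simps flip: c(2))
    then show ?thesis using Rpos[OF that] by (simp add: pos_le_divide_eq)
  qed
  have "\<phi> 0 - c / Suc n * 0 ^ Suc n \<le> \<phi> 1 - c / Suc n * 1 ^ Suc n"
  proof (rule DERIV_nonneg_imp_increasing_open[where f = "\<lambda>r. \<phi> r - c / Suc n * r ^ Suc n" and a = 0 and b = 1])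
    show "continuous_on {0..1} (\<lambda>r. \<phi> r - c / Suc n * r ^ Suc n)" by (intro continuous_intros \<phi>c)
    fix r :: real assume r: "0 < r" "r < 1"
    then have "(\<phi> has_real_derivative (r ^ n * ((\<mu> - 1) * y \<mu> r) * (c * y \<mu> r) - c * (r * P \<mu> r) * (- v r)) / (R r)\<^sup>2) (at r)"
      using d[of r] at_within_interior[of r "{0..1}"] by simp
    moreover have "((\<lambda>r. c / Suc n * r ^ Suc n) has_real_derivative c * r ^ n) (at r)"
      by (auto intro!: derivative_eq_intros simp del: power_Suc)
    ultimately have "((\<lambda>r. \<phi> r - c / Suc n * r ^ Suc n) has_real_derivative
        (r ^ n * ((\<mu> - 1) * y \<mu> r) * (c * y \<mu> r) - c * (r * P \<mu> r) * (- v r)) / (R r)\<^sup>2 - c * r ^ n) (at r)"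
      by (rule DERIV_diff)
    then show "\<exists>z. ((\<lambda>r. \<phi> r - c / Suc n * r ^ Suc n) has_real_derivative z) (at r) \<and> 0 \<le> z"
      using lower[of r] r by (intro exI conjI) auto
  qed simp
  then have 1: "\<phi> 1 \<ge> c / Suc n" using \<phi>'(2) by (simp add: \<phi>_def)
  \<comment> \<open>The vectors with coordinates y, -v and c y, -v have a positive inner product at
    every radius, so their angles never differ by pi / 2.\<close>
  have "\<bar>\<phi> 1 - \<theta> \<mu> 1\<bar> < pi / 2"
  proof (rule angle_abs_less_pi_half[where \<delta> = "\<lambda>r. \<phi> r - \<theta> \<mu> r" and a = 0 and b = 1])
    show "continuous_on {0..1} (\<lambda>r. \<phi> r - \<theta> \<mu> r)" by (intro continuous_intros \<phi>c \<theta>_cont_snd)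
    fix r :: real assume r: "r \<in> {0..1}"
    have "R r * \<rho> \<mu> r * cos (\<phi> r - \<theta> \<mu> r) = (R r * cos (\<phi> r)) * (\<rho> \<mu> r * cos (\<theta> \<mu> r)) + (R r * sin (\<phi> r)) * (\<rho> \<mu> r * sin (\<theta> \<mu> r))"
      by (simp add: cos_diff algebra_simps)
    also have "\<dots> = c * (y \<mu> r)\<^sup>2 + (v r)\<^sup>2"
      using pol[OF r] y_polar[OF r, of \<mu>] v_polar[OF r, of \<mu>] unfolding v_def by (metis minus_mult_minus mult.assoc power2_eq_square minus_equation_iff)
    also have "\<dots> > 0" using nonzero[OF r, of \<mu>] c y0[of \<mu>]
      by (cases "r = 0"; cases "y \<mu> r = 0") (auto simp: v_def intro!: add_pos_nonneg)
    finally show "cos (\<phi> r - \<theta> \<mu> r) > 0"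
      using Rpos[OF r] \<rho>_pos[OF r, of \<mu>] by (meson mult_pos_pos zero_less_mult_pos)
  qed (use \<phi>'(2) \<theta>0 in \<open>auto simp: \<phi>_def\<close>)
  then show ?thesis using 1 unfolding c_def by linarith
qed

text \<open>Multiply the equation by y: for \<mu> < 1 the function \<open>y * r ^ n * y'\<close> has
  a positive derivative, so it cannot vanish at both ends.\<close>

lemma neumann_imp_ge_1:
  assumes "P \<mu> 1 = 0" shows "\<mu> \<ge> 1"
proof (rule ccontr)
  assume \<mu>: "\<not> \<mu> \<ge> 1"
  have "y \<mu> 0 * (0 ^ Suc n * P \<mu> 0) < y \<mu> 1 * (1 ^ Suc n * P \<mu> 1)"
  proof (rule DERIV_pos_imp_increasing_open[where f = "\<lambda>r. y \<mu> r * (r ^ Suc n * P \<mu> r)" and a = 0 and b = 1])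
    show "continuous_on {0..1} (\<lambda>r. y \<mu> r * (r ^ Suc n * P \<mu> r))"
      by (intro continuous_intros radial_solutionD[OF sol])
    fix r :: real assume r: "0 < r" "r < 1"
    have "((\<lambda>r. y \<mu> r * (r ^ Suc n * P \<mu> r)) has_real_derivative 
        r * P \<mu> r * (r ^ Suc n * P \<mu> r) + - (r ^ n * ((\<mu> - 1) * y \<mu> r)) * y \<mu> r) (at r)"
      by (rule DERIV_mult[OF radial_solutionD(3)[OF sol] radial_solutionD(4)[OF sol]])
    moreover have "r * P \<mu> r * (r ^ Suc n * P \<mu> r) + - (r ^ n * ((\<mu> - 1) * y \<mu> r)) * y \<mu> r 
       = r ^ n * ((r * P \<mu> r)\<^sup>2 + (1 - \<mu>) * (y \<mu> r)\<^sup>2)"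
      by (simp add: algebra_simps power2_eq_square)
    moreover have "(r * P \<mu> r)\<^sup>2 + (1 - \<mu>) * (y \<mu> r)\<^sup>2 > 0"
      using nonzero[of r \<mu>] r \<mu> by (cases "y \<mu> r = 0") (auto intro: add_nonneg_pos)
    ultimately show "\<exists>z. ((\<lambda>r. y \<mu> r * (r ^ Suc n * P \<mu> r)) has_real_derivative z) (at r) \<and> 0 < z"
      using r by (metis mult_pos_pos zero_less_power)
  qed simp
  then show False using assms by simp
qed

lemma \<Theta>_surj: assumes "c \<ge> 0" obtains \<mu> where "\<mu> \<ge> 1" "\<theta> \<mu> 1 = c"
proof -
  \<comment> \<open>The value is chosen so that \<open>\<Theta>_lower_bound\<close> gives an angle
    above c + pi / 2 at b.\<close>
  define b where "b = 1 + (Suc n * (c + pi))\<^sup>2"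
  have "c + pi > 0" using assms pi_gt_zero by linarith
  then have "c + pi > 0" "Suc n * (c + pi) > 0" by simp_all
  then have b: "b > 1" "sqrt (b - 1) = Suc n * (c + pi)" by (simp_all add: b_def del: of_nat_Suc)
  have "sqrt (b - 1) / Suc n = c + pi" unfolding b(2) by simp
  then have "\<theta> b 1 \<ge> c" using \<Theta>_lower_bound[OF b(1)] pi_gt_zero by linarith
  then have "\<exists>x\<ge>1. x \<le> b \<and> \<theta> x 1 = c"
    using b(1) \<Theta>_one assms by (intro IVT') (auto intro: continuous_on_subset[OF \<theta>_cont_fst])
  then show thesis using that by blast
qed

lemma neumann_angle: "P \<mu> 1 = 0 \<longleftrightarrow> (\<exists>m::nat. \<theta> \<mu> 1 = m * pi)"
proof
  assume P: "P \<mu> 1 = 0"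
  then obtain i :: int where i: "\<theta> \<mu> 1 = i * pi" using neumann_iff sin_zero_iff_int2 by metis
  have "\<theta> 1 1 \<le> \<theta> \<mu> 1" using neumann_imp_ge_1[OF P] strict_mono_less_eq[OF \<Theta>_strict_mono] by blast
  then have "i \<ge> 0" using i pi_gt_zero by (simp add: \<Theta>_one zero_le_mult_iff)
  then show "\<exists>m::nat. \<theta> \<mu> 1 = m * pi" using i by (metis of_int_of_nat_eq zero_le_imp_eq_int)
qed (auto simp: neumann_iff)

text \<open>The angle at r = 1 maps the Neumann values in increasing order onto 0, pi, 2 pi and so
  on. Counting from 1, the k-th one has angle (k - 1) pi; finding it explicitly also shows that the
  definite description denotes.\<close>

lemma less_nth_neumann_value:
  fixes E k
  defines "E \<equiv> {\<mu>. P \<mu> 1 = 0}"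
  assumes k: "k \<ge> 1" 
    and less: "(THE \<mu>. \<mu> \<in> E \<and> finite {\<nu> \<in> E. \<nu> < \<mu>} \<and> Suc (card {\<nu> \<in> E. \<nu> < \<mu>}) = k) < \<kappa>"
  shows "\<theta> \<kappa> 1 > (k - 1) * pi"
proof -
  obtain \<mu> where \<mu>: "\<theta> \<mu> 1 = real (k - 1) * pi" using \<Theta>_surj[of "real (k - 1) * pi"] pi_gt_zero by auto
  have mono: "\<theta> a 1 < \<theta> b 1 \<longleftrightarrow> a < b" for a b using \<Theta>_strict_mono by (rule strict_mono_less)
  have img: "(\<lambda>\<nu>. \<theta> \<nu> 1) ` {\<nu> \<in> E. \<nu> < \<mu>} = (\<lambda>m::nat. m * pi) ` {..<k - 1}"
  proof (intro set_eqI iffI)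
    fix c assume "c \<in> (\<lambda>m::nat. m * pi) ` {..<k - 1}"
    then obtain m where m: "m < k - 1" "c = m * pi" by auto
    obtain \<nu> where \<nu>: "\<theta> \<nu> 1 = c" using \<Theta>_surj[of c] m pi_gt_zero by auto
    have "\<theta> \<nu> 1 < \<theta> \<mu> 1" unfolding \<nu> \<mu> using m pi_gt_zero by simp
    then have "\<nu> < \<mu>" unfolding mono .
    then show "c \<in> (\<lambda>\<nu>. \<theta> \<nu> 1) ` {\<nu> \<in> E. \<nu> < \<mu>}" using \<nu> m by (intro image_eqI[of _ _ \<nu>]) (auto simp: E_def neumann_angle)
  next
    fix c assume "c \<in> (\<lambda>\<nu>. \<theta> \<nu> 1) ` {\<nu> \<in> E. \<nu> < \<mu>}"
    then obtain \<nu> where \<nu>: "c = \<theta> \<nu> 1" "\<nu> < \<mu>" "\<nu> \<in> E" by blast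
    then obtain m where m: "\<theta> \<nu> 1 = real m * pi" by (auto simp: E_def neumann_angle)
    have "real m * pi < real (k - 1) * pi" using \<nu>(2) mono[of \<nu> \<mu>] m \<mu> by simp
    then show "c \<in> (\<lambda>m::nat. m * pi) ` {..<k - 1}" unfolding \<nu>(1) m using pi_gt_zero by auto
  qed
  have inj: "inj_on (\<lambda>\<nu>. \<theta> \<nu> 1) S" for S using \<Theta>_strict_mono by (meson strict_mono_imp_inj_on inj_on_subset subset_UNIV)
  have fin: "finite {\<nu> \<in> E. \<nu> < \<mu>}"
    using finite_imageD[OF _ inj, of "{\<nu> \<in> E. \<nu> < \<mu>}"] unfolding img by blast
  have "card {\<nu> \<in> E. \<nu> < \<mu>} = card ((\<lambda>m::nat. m * pi) ` {..<k - 1})"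
    unfolding img[symmetric] by (rule card_image[OF inj, symmetric])
  also have "\<dots> = k - 1" by (subst card_image) (auto simp: inj_on_def)
  finally have card: "Suc (card {\<nu> \<in> E. \<nu> < \<mu>}) = k" using k by simp
  have \<mu>E: "\<mu> \<in> E" using \<mu> by (auto simp: E_def neumann_angle)
  have smaller: "card {\<nu> \<in> E. \<nu> < a} < card {\<nu> \<in> E. \<nu> < b}" if "a < b" "a \<in> E" "finite {\<nu> \<in> E. \<nu> < b}" for a b
    using that by (intro psubset_card_mono) auto
  have "(THE \<mu>. \<mu> \<in> E \<and> finite {\<nu> \<in> E. \<nu> < \<mu>} \<and> Suc (card {\<nu> \<in> E. \<nu> < \<mu>}) = k) = \<mu>"
  proof (rule the_equality)
    fix \<nu> assume \<nu>: "\<nu> \<in> E \<and> finite {\<nu>' \<in> E. \<nu>' < \<nu>} \<and> Suc (card {\<nu>' \<in> E. \<nu>' < \<nu>}) = k"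
    show "\<nu> = \<mu>" using smaller[of \<nu> \<mu>] smaller[of \<mu> \<nu>] \<nu> \<mu>E fin card by (cases \<nu> \<mu> rule: linorder_cases) auto
  qed (use \<mu>E fin card in auto)
  with less have "\<theta> \<mu> 1 < \<theta> \<kappa> 1" by (simp add: mono)
  then show ?thesis using k by (simp add: \<mu> of_nat_diff)
qed

end

lemma linear_family_exists: obtains y P \<theta> where "linear_family n y P \<theta>"
proof -
  obtain y P \<theta> where "radial_family n (\<lambda>\<mu> y. (\<mu> - 1) * y) y P \<theta>"
  \<comment> \<open>The summand 1 keeps the Lipschitz constant positive at \<mu> = 1.\<close>
  proof (rule radial_family_angle_exists[where h = "\<lambda>\<mu> y. (\<mu> - 1) * y" and L = "\<lambda>\<mu>. \<bar>\<mu> - 1\<bar> + 1"])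
    show "continuous_on UNIV (\<lambda>(p, y). (p - 1) * y :: real)"
      unfolding split_beta by (intro continuous_intros)
    show "continuous_on UNIV (\<lambda>p::real. \<bar>p - 1\<bar> + 1)" by (intro continuous_intros)
    show "\<bar>(p - 1) * y - (p - 1) * z\<bar> \<le> (\<bar>p - 1\<bar> + 1) * \<bar>y - z\<bar>" for p y z :: real
      by (simp add: algebra_simps flip: right_diff_distrib abs_mult)
  qed auto
  then show thesis using that by (simp add: linear_family_def)
qed

section \<open>Radial solutions of the Neumann problem\<close>

text \<open>L'Hopital's rule for \<open>r ^ Suc n * P r\<close> over \<open>r ^ Suc n\<close>. The
  value makes \<open>- g (u r) - Suc n * P r\<close>, which is r P'(r) for r > 0, vanish at 0, as
  continuity of the second derivatives at the origin requires.\<close>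

lemma radial_solution_center:
  assumes sol: "radial_solution n g u P" and g: "continuous_on UNIV g"
  shows "P 0 = - g (u 0) / Suc n"
proof -
  have lim: "(F \<longlongrightarrow> F 0) (at_right 0)" if "continuous_on UNIV F" for F :: "real \<Rightarrow> real"
    using that unfolding continuous_on_def by (metis UNIV_I subset_UNIV tendsto_within_subset)
  have pos: "eventually (\<lambda>r::real. r > 0) (at_right 0)" by (simp add: eventually_at_right_less)
  have "((\<lambda>r. (r ^ Suc n * P r) / r ^ Suc n) \<longlongrightarrow> - g (u 0) / Suc n) (at_right 0)"
  proof (rule lhopital_right_0)
    have "continuous_on UNIV (\<lambda>r. r ^ Suc n * P r)" "continuous_on UNIV (\<lambda>r::real. r ^ Suc n)"
      by (intro continuous_intros radial_solutionD[OF sol])+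
    from this[THEN lim] show "((\<lambda>r. r ^ Suc n * P r) \<longlongrightarrow> 0) (at_right 0)" "((\<lambda>r::real. r ^ Suc n) \<longlongrightarrow> 0) (at_right 0)"
      by simp_all
    show "eventually (\<lambda>r. ((\<lambda>r. r ^ Suc n * P r) has_real_derivative - (r ^ n * g (u r))) (at r)) (at_right 0)"
      using radial_solutionD(4)[OF sol] by (intro always_eventually) simp
    show "eventually (\<lambda>r::real. ((\<lambda>r. r ^ Suc n) has_real_derivative real (Suc n) * r ^ n) (at r)) (at_right 0)"
      by (intro always_eventually allI) (auto intro!: derivative_eq_intros simp del: power_Suc)
    have "continuous_on UNIV (\<lambda>r. - g (u r) / Suc n)"
      by (intro continuous_intros continuous_on_compose2[OF g] radial_solutionD[OF sol]) auto
    from lim[OF this] show "((\<lambda>r. - (r ^ n * g (u r)) / (real (Suc n) * r ^ n)) \<longlongrightarrow> - g (u 0) / real (Suc n)) (at_right 0)"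
    proof (rule Lim_transform_eventually)
      show "eventually (\<lambda>r. - g (u r) / Suc n = - (r ^ n * g (u r)) / (real (Suc n) * r ^ n)) (at_right 0)"
        using pos by eventually_elim simp
    qed
  qed (rule eventually_mono[OF pos], simp)+
  moreover have "eventually (\<lambda>r. (r ^ Suc n * P r) / r ^ Suc n = P r) (at_right 0)"
    using pos by eventually_elim simp
  ultimately have "(P \<longlongrightarrow> - g (u 0) / Suc n) (at_right 0)" by (rule Lim_transform_eventually)
  then show ?thesis using lim[OF radial_solutionD(1)[OF sol]]
    by (metis tendsto_unique trivial_limit_at_right_real)
qed

lemma radial_solution_P_derivative:
  fixes g u P :: "real \<Rightarrow> real"
  assumes sol: "radial_solution n g u P" and r: "r > 0"
  shows "(P has_real_derivative (- g (u r) - Suc n * P r) / r) (at r)"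
proof -
  have "((\<lambda>r. (r ^ Suc n * P r) / r ^ Suc n) has_real_derivative 
     ((- (r ^ n * g (u r))) * r ^ Suc n - (r ^ Suc n * P r) * (Suc n * r ^ n)) / (r ^ Suc n * r ^ Suc n)) (at r)"
    using r by (intro DERIV_divide radial_solutionD(4)[OF sol])
               (auto intro!: derivative_eq_intros simp del: power_Suc)
  moreover have "((- (r ^ n * g (u r))) * r ^ Suc n - (r ^ Suc n * P r) * (Suc n * r ^ n)) / (r ^ Suc n * r ^ Suc n)
     = (- g (u r) - Suc n * P r) / r"
    using r by (simp add: divide_simps) (simp add: algebra_simps)
  ultimately show ?thesis
    using r by (auto intro: has_field_derivative_transform_within_open[where S = "{0<..}"])
qed

section \<open>Calculus of radial functions on Euclidean space\<close>

lemma has_derivative_norm_compose: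
  fixes x :: "'a::real_inner"
  assumes "x \<noteq> 0" "(U has_real_derivative d) (at (norm x))"
  shows "((\<lambda>x. U (norm x)) has_derivative (\<lambda>h. d * (sgn x \<bullet> h))) (at x)"
  using has_derivative_compose[OF has_derivative_norm[OF assms(1)], of U "(*) d"] assms(2)
  by (simp add: has_field_derivative_def inner_commute)

lemma filterlim_norm_at_0: "filterlim norm (at 0) (at (0::'a::real_normed_vector))"
  unfolding filterlim_at by (auto simp: eventually_at_filter intro!: tendsto_eq_intros)

lemma radial_solution_gradient:
  fixes x :: "'a::euclidean_space"
  assumes sol: "radial_solution n g u P"
  shows "((\<lambda>x. u (norm x)) has_derivative (\<lambda>h. (P (norm x) *\<^sub>R x) \<bullet> h)) (at x)"
proof (cases "x = 0")
  case False
  have "((\<lambda>x. u (norm x)) has_derivative (\<lambda>h. (norm x * P (norm x)) * (sgn x \<bullet> h))) (at x)"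
    by (rule has_derivative_norm_compose[OF False radial_solutionD(3)[OF sol]])
  moreover have "(norm x * P (norm x)) * (sgn x \<bullet> h) = (P (norm x) *\<^sub>R x) \<bullet> h" for h
    using False by (simp add: sgn_div_norm field_simps)
  then have "(\<lambda>h. (norm x * P (norm x)) * (sgn x \<bullet> h)) = (\<lambda>h. (P (norm x) *\<^sub>R x) \<bullet> h)"
    by (rule ext)
  ultimately show ?thesis by simp
next
  case True
  have "((\<lambda>h. (u (0 + h) - u 0) / h) \<longlongrightarrow> 0) (at 0)"
    using radial_solutionD(3)[OF sol, of 0 UNIV] by (simp add: has_field_derivative_iff)
  from filterlim_compose[OF tendsto_rabs_zero[OF this] filterlim_norm_at_0[where 'a = 'a]]
  have "((\<lambda>h::'a. norm (u (norm h) - u 0) / norm h) \<longlongrightarrow> 0) (at 0)" by simp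
  then show ?thesis unfolding True has_derivative_at by (simp add: bounded_linear_inner_right)
qed

text \<open>Column b of the Hessian of u(|x|), for P = u' / r and Q = r P' = u'' - u' / r. The
  convention \<open>sgn 0 = 0\<close> leaves \<open>P 0 *\<^sub>R b\<close> at the origin.\<close>

definition radial_hessian :: "(real \<Rightarrow> real) \<Rightarrow> (real \<Rightarrow> real) \<Rightarrow> 'a::euclidean_space \<Rightarrow> 'a \<Rightarrow> 'a" where
  "radial_hessian P Q b x = P (norm x) *\<^sub>R b + (Q (norm x) * (sgn x \<bullet> b)) *\<^sub>R sgn x"

text \<open>The discontinuity of \<open>sgn\<close> at the origin is harmless: it is bounded and its
  coefficient Q tends to 0 there.\<close>

lemma continuous_on_radial_hessian:
  assumes P: "continuous_on UNIV P" and Q: "continuous_on UNIV Q" and Q0: "Q 0 = 0"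
  shows "continuous_on UNIV (radial_hessian P Q b)"
proof -
  have "isCont (\<lambda>x. (Q (norm x) * (sgn x \<bullet> b)) *\<^sub>R sgn x) x" for x
  proof (cases "x = 0")
    case False
    then show ?thesis
      unfolding sgn_div_norm
      by (intro continuous_intros isCont_o2[OF _ continuous_on_interior[OF Q]]) auto
  next
    case True
    have "isCont (\<lambda>x::'a. \<bar>Q (norm x)\<bar> * norm b) 0"
      by (intro continuous_intros isCont_o2[OF _ continuous_on_interior[OF Q]]) auto
    then have *: "((\<lambda>x. \<bar>Q (norm x)\<bar> * norm b) \<longlongrightarrow> 0) (at (0::'a))" by (simp add: isCont_def Q0)
    have "((\<lambda>x. (Q (norm x) * (sgn x \<bullet> b)) *\<^sub>R sgn x) \<longlongrightarrow> 0) (at 0)"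
    proof (rule Lim_null_comparison[OF always_eventually *], rule allI)
      fix x
      have "\<bar>sgn x \<bullet> b\<bar> * norm (sgn x) \<le> norm b * 1"
        using Cauchy_Schwarz_ineq2[of "sgn x" b] by (intro mult_mono) (auto simp: norm_sgn split: if_splits)
      then show "norm ((Q (norm x) * (sgn x \<bullet> b)) *\<^sub>R sgn x) \<le> \<bar>Q (norm x)\<bar> * norm b"
        by (simp add: abs_mult mult.assoc mult_left_mono)
    qed
    then show ?thesis by (simp add: True isCont_def Q0)
  qed
  moreover have "continuous_on UNIV (\<lambda>x. P (norm x) *\<^sub>R b)"
    by (intro continuous_intros continuous_on_compose2[OF P]) auto
  ultimately show ?thesis unfolding radial_hessian_def
    by (intro continuous_on_add) (auto simp: continuous_on_eq_continuous_at)
qed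

lemma radial_gradient_has_derivative:
  fixes x b :: "'a::euclidean_space"
  assumes P: "continuous_on UNIV P" and P': "\<And>r. r > 0 \<Longrightarrow> (P has_real_derivative Q r / r) (at r)" and Q0: "Q 0 = 0"
  shows "((\<lambda>x. (P (norm x) *\<^sub>R x) \<bullet> b) has_derivative (\<lambda>h. radial_hessian P Q b x \<bullet> h)) (at x)"
proof (cases "x = 0")
  case False
  have "((\<lambda>x. P (norm x) * (x \<bullet> b)) has_derivative
      (\<lambda>h. P (norm x) * (h \<bullet> b) + (Q (norm x) / norm x * (sgn x \<bullet> h)) * (x \<bullet> b))) (at x)"
    by (rule has_derivative_mult[OF has_derivative_norm_compose[OF False P']])
       (use False in \<open>auto intro!: derivative_eq_intros\<close>)
  moreover have "x \<bullet> b = norm x * (sgn x \<bullet> b)" using False by (simp add: sgn_div_norm)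
  then have "P (norm x) * (h \<bullet> b) + (Q (norm x) / norm x * (sgn x \<bullet> h)) * (x \<bullet> b) = radial_hessian P Q b x \<bullet> h" for h
    using False by (simp add: radial_hessian_def inner_add_left inner_commute[of h b])
  ultimately show ?thesis by simp
next
  case True
  have "((\<lambda>r. P r - P 0) \<longlongrightarrow> 0) (at 0)"
    using P by (intro tendsto_eq_intros) (auto simp: continuous_on_def)
  then have "((\<lambda>h::'a. (P (norm h) - P 0) * norm b) \<longlongrightarrow> 0) (at 0)"
    by (intro tendsto_mult_left_zero filterlim_compose[OF _ filterlim_norm_at_0])
  then have "((\<lambda>h::'a. \<bar>(P (norm h) - P 0) * norm b\<bar>) \<longlongrightarrow> 0) (at 0)" by (rule tendsto_rabs_zero)
  then have "((\<lambda>h. norm ((P (norm h) *\<^sub>R h) \<bullet> b - (P 0 *\<^sub>R b) \<bullet> h) / norm h) \<longlongrightarrow> 0) (at 0)"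
  proof (rule Lim_null_comparison[OF always_eventually, rotated], intro allI)
    fix h
    have "(P (norm h) *\<^sub>R h) \<bullet> b - (P 0 *\<^sub>R b) \<bullet> h = (P (norm h) - P 0) * (h \<bullet> b)"
      by (simp add: inner_commute algebra_simps)
    moreover have "\<bar>h \<bullet> b\<bar> / norm h \<le> norm b"
      using Cauchy_Schwarz_ineq2[of h b] by (cases "h = 0") (auto simp: divide_simps mult.commute)
    ultimately show "norm (norm ((P (norm h) *\<^sub>R h) \<bullet> b - (P 0 *\<^sub>R b) \<bullet> h) / norm h) \<le> \<bar>(P (norm h) - P 0) * norm b\<bar>"
      by (simp add: abs_mult mult_left_mono flip: times_divide_eq_right)
  qed
  then show ?thesis unfolding True has_derivative_at
    by (simp add: radial_hessian_def Q0 bounded_linear_mult_const bounded_linear_inner_right_comp bounded_linear_const_mult bounded_linear_inner_right)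
qed

lemma directional_derivative:
  fixes u :: "'a::euclidean_space \<Rightarrow> real"
  assumes "(u has_derivative (\<lambda>h. G \<bullet> h)) (at (x + t *\<^sub>R b))"
  shows "((\<lambda>t. u (x + t *\<^sub>R b)) has_real_derivative G \<bullet> b) (at t within S)"
proof -
  have "((\<lambda>t. x + t *\<^sub>R b) has_derivative (\<lambda>h. h *\<^sub>R b)) (at t within S)"
    by (auto intro!: derivative_eq_intros)
  from has_derivative_compose[OF this assms] show ?thesis
    by (simp add: has_field_derivative_def mult.commute[of _ "G \<bullet> b"])
qed

text \<open>The functions f and g are related only along the values that u takes in the open ball;
  this lets a solution of the truncated problem solve the original one.\<close>

lemma radial_solution_imp_neumann_solution:
  fixes f g u P :: "real \<Rightarrow> real" and n :: nat
  assumes sol: "radial_solution n g u P" and g: "continuous_on UNIV g" and dim: "DIM('a::euclidean_space) = Suc n"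
    and P1: "P 1 = 0" and f: "\<And>r. 0 \<le> r \<Longrightarrow> r < 1 \<Longrightarrow> f (u r) = g (u r) + u r"
  shows "neumann_solution f (\<lambda>x::'a. u (norm x))"
proof -
  define Q where "Q r = - g (u r) - Suc n * P r" for r
  have Q0: "Q 0 = 0" using radial_solution_center[OF sol g] by (simp add: Q_def)
  have Qc: "continuous_on UNIV Q" unfolding Q_def
    by (intro continuous_intros continuous_on_compose2[OF g] radial_solutionD[OF sol]) auto
  note Pc = radial_solutionD(1)[OF sol]
  have P': "(P has_real_derivative Q r / r) (at r)" if "r > 0" for r
    unfolding Q_def by (rule radial_solution_P_derivative[OF sol that])
  note grad = radial_solution_gradient[OF sol]
  note hess = radial_gradient_has_derivative[of P Q, OF Pc P' Q0]
  have Gc: "continuous_on S (\<lambda>x::'a. P (norm x) *\<^sub>R x)" for S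
    by (intro continuous_intros continuous_on_compose2[OF Pc[of UNIV]]) auto
  have lap: "laplacian (\<lambda>x. u (norm x)) x = - g (u (norm x))" for x :: 'a
  proof -
    have 1: "deriv (\<lambda>t. u (norm (x + t *\<^sub>R b))) = (\<lambda>t. (P (norm (x + t *\<^sub>R b)) *\<^sub>R (x + t *\<^sub>R b)) \<bullet> b)" for b
      by (rule ext) (rule DERIV_imp_deriv[OF directional_derivative[OF grad, where S = UNIV]])
    have 2: "deriv (deriv (\<lambda>t. u (norm (x + t *\<^sub>R b)))) 0 = radial_hessian P Q b x \<bullet> b" for b
      unfolding 1 by (rule DERIV_imp_deriv, rule directional_derivative) (use hess[where b = b and x = x] in simp)
    have "laplacian (\<lambda>x. u (norm x)) x = (\<Sum>b\<in>Basis. P (norm x) + Q (norm x) * ((sgn x \<bullet> b) * (sgn x \<bullet> b)))"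
      unfolding laplacian_def 2 radial_hessian_def by (intro sum.cong) (auto simp: inner_add_left mult.assoc)
    also have "\<dots> = Suc n * P (norm x) + Q (norm x) * (sgn x \<bullet> sgn x)"
      unfolding sum.distrib euclidean_inner[of "sgn x" "sgn x"] by (simp add: dim sum_distrib_left)
    \<comment> \<open>Away from the origin \<open>sgn x\<close> is a unit vector; at the origin both
      sides vanish by \<open>Q0\<close>.\<close>
    also have "Q (norm x) * (sgn x \<bullet> sgn x) = Q (norm x)"
      by (cases "x = 0") (auto simp: Q0 norm_sgn simp flip: power2_norm_eq_inner)
    finally show ?thesis by (simp add: Q_def)
  qed
  show ?thesis unfolding neumann_solution_def C2_on_def C1_on_def
  proof (intro conjI ballI exI)
    show "continuous_on (ball 0 1) (radial_hessian P Q b)" for b :: 'a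
      using continuous_on_radial_hessian[OF Pc Qc Q0] continuous_on_subset by blast
    show "((\<lambda>x. (P (norm x) *\<^sub>R x) \<bullet> b) has_derivative (\<bullet>) (radial_hessian P Q b x)) (at x within ball 0 1)" for b x :: 'a
      using hess by (rule has_derivative_at_withinI)
    show "((\<lambda>x. u (norm x)) has_derivative (\<bullet>) (P (norm x) *\<^sub>R x)) (at x within S)" for x :: 'a and S
      using grad by (rule has_derivative_at_withinI)
    show "continuous_on (cball 0 1) (\<lambda>x::'a. P (norm x) *\<^sub>R x)" by (rule Gc)
    show "- laplacian (\<lambda>x. u (norm x)) x + u (norm x) = f (u (norm x))" if "x \<in> ball 0 1" for x :: 'a
      using that f[of "norm x"] by (simp add: lap)
    show "((\<lambda>t. u (norm (x + t *\<^sub>R x))) has_real_derivative 0) (at_left 0)" if "x \<in> sphere 0 1" for x :: 'a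
      using directional_derivative[OF grad, where x = x and t = 0 and b = x] that P1 by simp
  qed (rule has_derivative_at_withinI[OF grad])
qed

text \<open>Restrict u to the ray through a basis vector e. The second derivative along e is U'',
  and in each of the n orthogonal directions it is U' / r because the gradient is radial. The
  equation is claimed only for positive r, so nothing about second derivatives at the centre is
  needed.\<close>

lemma radial_neumann_solution_profile:
  fixes U :: "real \<Rightarrow> real" and n :: nat
  assumes sol: "neumann_solution f (\<lambda>x::'a::euclidean_space. U (norm x))" and dim: "DIM('a) = Suc n"
  obtains U1 where "continuous_on {0..1} U" "continuous_on {0..1} U1" "U1 1 = 0"
    "\<And>r. 0 < r \<Longrightarrow> r < 1 \<Longrightarrow> (U has_real_derivative U1 r) (at r)"
    "\<And>r. 0 < r \<Longrightarrow> r < 1 \<Longrightarrow> ((\<lambda>r. r ^ n * U1 r) has_real_derivative r ^ n * (U r - f (U r))) (at r)"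
proof -
  let ?u = "\<lambda>x::'a. U (norm x)"
  obtain G1 where G1c: "continuous_on (cball 0 1) G1" 
    and G1: "\<And>x. x \<in> cball 0 1 \<Longrightarrow> (?u has_derivative (\<lambda>h. G1 x \<bullet> h)) (at x within cball 0 1)"
    using sol unfolding neumann_solution_def C1_on_def by blast
  obtain G2 H where 
    G2w: "\<And>x. x \<in> ball 0 1 \<Longrightarrow> (?u has_derivative (\<lambda>h. G2 x \<bullet> h)) (at x within ball 0 1)"
    and Hw: "\<And>b x. b \<in> Basis \<Longrightarrow> x \<in> ball 0 1 \<Longrightarrow> ((\<lambda>x. G2 x \<bullet> b) has_derivative (\<lambda>h. H b x \<bullet> h)) (at x within ball 0 1)"
    using sol unfolding neumann_solution_def C2_on_def C1_on_def by metis
  have G2: "(?u has_derivative (\<lambda>h. G2 x \<bullet> h)) (at x)" if "x \<in> ball 0 1" for x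
    using G2w[OF that] at_within_open[OF that open_ball] by simp
  have H: "((\<lambda>x. G2 x \<bullet> b) has_derivative (\<lambda>h. H b x \<bullet> h)) (at x)" if "b \<in> Basis" "x \<in> ball 0 1" for b x
    using Hw[OF that] at_within_open[OF that(2) open_ball] by simp
  have "G1 x = G2 x" if "x \<in> ball 0 1" for x
  proof -
    have "x \<in> interior (cball 0 1)" using that by simp
    then have "(?u has_derivative (\<lambda>h. G1 x \<bullet> h)) (at x)"
      using G1[of x] that at_within_interior[of x "cball 0 1"] by simp
    from has_derivative_unique[OF this G2[OF that]] have "\<And>h. G1 x \<bullet> h = G2 x \<bullet> h" by meson
    then show ?thesis by (metis inner_commute vector_eq_rdot)
  qed
  note G12 = this
  obtain e :: 'a where e: "e \<in> Basis" using nonempty_Basis by blast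
  have ne: "norm e = 1" using e by simp
  \<comment> \<open>Taken from the gradient on the closed ball, U1 is continuous up to r = 1;
    inside, \<open>G12\<close> identifies that gradient with the differentiable one.\<close>
  define U1 where "U1 r = G1 (r *\<^sub>R e) \<bullet> e" for r
  have in_ball: "r *\<^sub>R e \<in> ball 0 1" if "0 < r" "r < 1" for r using that ne by simp
  have U1: "(U has_real_derivative U1 r) (at r)" if r: "0 < r" "r < 1" for r
  proof -
    have "((\<lambda>t. ?u (0 + t *\<^sub>R e)) has_real_derivative U1 r) (at r)"
      unfolding U1_def by (rule directional_derivative) (use G2[OF in_ball[OF r]] G12[OF in_ball[OF r]] in simp)
    then show ?thesis
      by (rule has_field_derivative_transform_within_open[where S = "{0<..}"]) (use r ne in auto)
  qed
  have U2: "(U1 has_real_derivative H e (r *\<^sub>R e) \<bullet> e) (at r)" if r: "0 < r" "r < 1" for r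
  proof -
    have "((\<lambda>t. G2 (0 + t *\<^sub>R e) \<bullet> e) has_real_derivative H e (r *\<^sub>R e) \<bullet> e) (at r)"
      by (rule directional_derivative[where u = "\<lambda>x. G2 x \<bullet> e"]) (use H[OF e in_ball[OF r]] in simp)
    then show ?thesis
      by (rule has_field_derivative_transform_within_open[where S = "{0<..<1}"]) (use r G12 in_ball in \<open>auto simp: U1_def\<close>)
  qed
  have G2r: "G2 x = U1 (norm x) *\<^sub>R sgn x" if "x \<in> ball 0 1" "x \<noteq> 0" for x
  proof -
    have "(?u has_derivative (\<lambda>h. U1 (norm x) * (sgn x \<bullet> h))) (at x)"
      by (rule has_derivative_norm_compose[OF that(2) U1]) (use that in auto)
    from has_derivative_unique[OF G2[OF that(1)] this] have "\<And>h. G2 x \<bullet> h = (U1 (norm x) *\<^sub>R sgn x) \<bullet> h" 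
      by (simp add: fun_eq_iff)
    then show ?thesis by (metis inner_commute vector_eq_rdot)
  qed
  have He: "H b (r *\<^sub>R e) \<bullet> b = U1 r / r" if r: "0 < r" "r < 1" and b: "b \<in> Basis" "b \<noteq> e" for r b
  proof -
    let ?x = "\<lambda>t. r *\<^sub>R e + t *\<^sub>R b"
    have orth: "e \<bullet> b = 0" using b e by (simp add: inner_Basis)
    have b1: "b \<bullet> b = 1" using b by (simp add: inner_same_Basis)
    have "((\<lambda>t. G2 (?x t) \<bullet> b) has_real_derivative H b (r *\<^sub>R e) \<bullet> b) (at 0)"
      by (rule directional_derivative[where u = "\<lambda>x. G2 x \<bullet> b"]) (use H[OF b(1) in_ball[OF r]] in simp)
    moreover have G0: "G2 (r *\<^sub>R e) \<bullet> b = 0"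
    proof -
      have "r *\<^sub>R e \<noteq> 0" using r ne by auto
      from G2r[OF in_ball[OF r] this] show ?thesis using orth by (simp add: sgn_div_norm)
    qed
    ultimately have 1: "((\<lambda>t. G2 (?x t) \<bullet> b / t) \<longlongrightarrow> H b (r *\<^sub>R e) \<bullet> b) (at 0)"
      by (simp add: has_field_derivative_iff G0)
    have xr: "norm (?x 0) = r" using r ne by simp
    have "isCont U1 (norm (?x 0))" unfolding xr using U2[OF r] by (rule DERIV_isCont)
    then have "isCont (\<lambda>t. U1 (norm (?x t)) / norm (?x t)) 0"
      using xr r by (intro continuous_intros isCont_o2[of 0 "\<lambda>t. norm (?x t)" U1]) auto
    then have 2: "((\<lambda>t. U1 (norm (?x t)) / norm (?x t)) \<longlongrightarrow> U1 r / r) (at 0)"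
      using xr by (simp add: isCont_def)
    have "(?x \<longlongrightarrow> ?x 0) (at 0)" by (intro tendsto_intros)
    then have "eventually (\<lambda>t. ?x t \<in> ball 0 1 - {0}) (at 0)"
      by (rule topological_tendstoD) (use in_ball[OF r] r ne in auto)
    \<comment> \<open>The b-component of a radial vector at \<open>?x t\<close> is proportional to
      t, so the difference quotient is explicit and its limit is found by continuity.\<close>
    then have "eventually (\<lambda>t. U1 (norm (?x t)) / norm (?x t) = G2 (?x t) \<bullet> b / t) (at 0)"
      using eventually_neq_at_within[of 0 0 UNIV]
    proof eventually_elim
      case (elim t)
      then have "G2 (?x t) = U1 (norm (?x t)) *\<^sub>R sgn (?x t)" using G2r[of "?x t"] by auto
      moreover have "?x t \<bullet> b = t" using orth b1 by (simp add: inner_add_left)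
      ultimately have "G2 (?x t) \<bullet> b = U1 (norm (?x t)) / norm (?x t) * t"
        by (simp add: sgn_div_norm divide_inverse)
      then show ?case using elim by simp
    qed
    from Lim_transform_eventually[OF 2 this] show ?thesis by (rule tendsto_unique[OF _ 1, rotated]) simp
  qed
  have lap: "laplacian ?u (r *\<^sub>R e) = H e (r *\<^sub>R e) \<bullet> e + n * (U1 r / r)" if r: "0 < r" "r < 1" for r
  proof -
    have "deriv (deriv (\<lambda>t. ?u (r *\<^sub>R e + t *\<^sub>R b))) 0 = H b (r *\<^sub>R e) \<bullet> b" if b: "b \<in> Basis" for b
    proof (rule DERIV_imp_deriv)
      let ?x = "\<lambda>t. r *\<^sub>R e + t *\<^sub>R b"
      have "((\<lambda>t. G2 (?x t) \<bullet> b) has_real_derivative H b (r *\<^sub>R e) \<bullet> b) (at 0)"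
        by (rule directional_derivative[where u = "\<lambda>x. G2 x \<bullet> b"]) (use H[OF b in_ball[OF r]] in simp)
      moreover have "open (?x -` ball 0 1)" by (intro open_vimage continuous_intros) auto
      moreover have "0 \<in> ?x -` ball 0 1" using in_ball[OF r] by auto
      moreover have "G2 (?x t) \<bullet> b = deriv (\<lambda>t. ?u (?x t)) t" if "t \<in> ?x -` ball 0 1" for t
        by (rule sym, rule DERIV_imp_deriv, rule directional_derivative) (use G2 that in simp)
      ultimately show "(deriv (\<lambda>t. ?u (?x t)) has_real_derivative H b (r *\<^sub>R e) \<bullet> b) (at 0)"
        by (rule has_field_derivative_transform_within_open)
    qed
    then have "laplacian ?u (r *\<^sub>R e) = (\<Sum>b\<in>Basis. H b (r *\<^sub>R e) \<bullet> b)" by (simp add: laplacian_def)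
    also have "\<dots> = H e (r *\<^sub>R e) \<bullet> e + (\<Sum>b\<in>Basis - {e}. H b (r *\<^sub>R e) \<bullet> b)"
      by (rule sum.remove[OF finite_Basis e])
    also have "(\<Sum>b\<in>Basis - {e}. H b (r *\<^sub>R e) \<bullet> b) = (\<Sum>b\<in>Basis - {e}. U1 r / r)"
      by (intro sum.cong) (use He[OF r] in auto)
    finally show ?thesis using dim e by (simp add: card_Diff_singleton)
  qed
  have pde: "- laplacian ?u x + ?u x = f (?u x)" if "x \<in> ball 0 1" for x
    using sol that unfolding neumann_solution_def by blast
  show thesis
  proof
    have uc: "continuous_on (cball 0 1) ?u"
      using G1 by (rule has_derivative_continuous_on)
    have "continuous_on {0..1} (\<lambda>r. ?u (r *\<^sub>R e))"
      by (intro continuous_on_compose2[OF uc] continuous_intros) (auto simp: ne)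
    then show "continuous_on {0..1} U"
      by (rule continuous_on_eq) (auto simp: ne)
    show "continuous_on {0..1} U1" unfolding U1_def
      by (intro continuous_intros continuous_on_compose2[OF G1c]) (auto simp: ne)
    show "(U has_real_derivative U1 r) (at r)" if "0 < r" "r < 1" for r using U1 that .
    show "U1 1 = 0"
    proof -
      have 0: "((\<lambda>t. ?u (e + t *\<^sub>R e)) has_real_derivative 0) (at_left 0)"
        using sol e unfolding neumann_solution_def by simp
      \<comment> \<open>The segment from 0 to e lies in the closed ball, so the gradient there
        yields the same one-sided derivative as the Neumann condition, and the two limits
        agree.\<close>
      have "((\<lambda>t. ?u (e + t *\<^sub>R e)) has_derivative (\<lambda>h. G1 e \<bullet> (h *\<^sub>R e))) (at 0 within {-1..0})"
      proof -
        have "(\<lambda>t. e + t *\<^sub>R e) ` {-1..0} \<subseteq> cball 0 1"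
        proof safe
          fix t :: real assume "t \<in> {-1..0}"
          then have "norm ((1 + t) *\<^sub>R e) \<le> 1" using ne by simp
          then show "e + t *\<^sub>R e \<in> cball 0 1" by (simp add: scaleR_left_distrib)
        qed
        moreover have "((\<lambda>t. e + t *\<^sub>R e) has_derivative (\<lambda>h. h *\<^sub>R e)) (at 0 within {-1..0})"
          by (auto intro!: derivative_eq_intros)
        ultimately have "((\<lambda>t. ?u (e + t *\<^sub>R e)) has_derivative (\<lambda>h. G1 (e + 0 *\<^sub>R e) \<bullet> (h *\<^sub>R e))) (at 0 within {-1..0})"
          by (intro has_derivative_in_compose2[where t = "cball 0 1" and g = ?u and g' = "\<lambda>x h. G1 x \<bullet> h", OF G1]) auto
        then show ?thesis by simp
      qed
      moreover have "(\<lambda>h. G1 e \<bullet> (h *\<^sub>R e)) = (*) (U1 1)" by (rule ext) (simp add: U1_def)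
      ultimately have "((\<lambda>t. ?u (e + t *\<^sub>R e)) has_real_derivative U1 1) (at_left 0)"
        unfolding has_field_derivative_def using at_within_Icc_at_left[of "-1" "0::real"] by simp
      then have "((\<lambda>h. (?u (e + (0 + h) *\<^sub>R e) - ?u (e + 0 *\<^sub>R e)) / h) \<longlongrightarrow> U1 1) (at_left 0)"
        unfolding DERIV_def has_field_derivative_iff by (simp only: diff_0_right add_0_left)
      moreover have "((\<lambda>h. (?u (e + (0 + h) *\<^sub>R e) - ?u (e + 0 *\<^sub>R e)) / h) \<longlongrightarrow> 0) (at_left 0)"
        using 0 unfolding DERIV_def has_field_derivative_iff by (simp only: diff_0_right add_0_left)
      ultimately show ?thesis by (rule tendsto_unique[OF trivial_limit_at_left_real])
    qed
    show "((\<lambda>r. r ^ n * U1 r) has_real_derivative r ^ n * (U r - f (U r))) (at r)" if r: "0 < r" "r < 1" for r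
    proof -
      have "U r - f (U r) = laplacian ?u (r *\<^sub>R e)" using pde[OF in_ball[OF r]] r ne by simp
      then have "r ^ n * (U r - f (U r)) = r ^ n * (H e (r *\<^sub>R e) \<bullet> e) + r ^ n * (n * (U1 r / r))"
        by (simp only: lap[OF r] distrib_left)
      also have "r ^ n * (n * (U1 r / r)) = n * r ^ (n - 1) * U1 r"
        using r by (cases n) auto
      finally have eq: "r ^ n * (U r - f (U r)) = n * r ^ (n - 1) * U1 r + (H e (r *\<^sub>R e) \<bullet> e) * r ^ n" by simp
      show ?thesis unfolding eq by (intro DERIV_mult U2 r) (auto intro!: derivative_eq_intros)
    qed
  qed
qed

section \<open>Radial eigenvalues as Neumann values of the linear family\<close>

context linear_family begin

text \<open>The Wronskian of an eigenfunction \<open>U\<close> and \<open>y \<mu>\<close> vanishes identically; if \<open>P \<mu> 1 \<noteq> 0\<close>, this forces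
  \<open>U = U' = 0\<close> at \<open>r = 1\<close>.\<close>

lemma neumann_solution_imp_zero_derivative:
  assumes dim: "DIM('a::euclidean_space) = Suc n" and n: "n \<ge> 1"
    and U: "neumann_solution (\<lambda>s. \<mu> * s) (\<lambda>x::'a. U (norm x))" and x: "x \<in> cball (0::'a) 1" "U (norm x) \<noteq> 0"
  shows "P \<mu> 1 = 0"
proof (rule ccontr)
  assume P1: "P \<mu> 1 \<noteq> 0"
  obtain U1 where U1: "continuous_on {0..1} U" "continuous_on {0..1} U1" "U1 1 = 0"
    "\<And>r. 0 < r \<Longrightarrow> r < 1 \<Longrightarrow> (U has_real_derivative U1 r) (at r)"
    "\<And>r. 0 < r \<Longrightarrow> r < 1 \<Longrightarrow> ((\<lambda>r. r ^ n * U1 r) has_real_derivative r ^ n * (U r - \<mu> * U r)) (at r)"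
    using radial_neumann_solution_profile[OF U dim] by metis
  define W where "W r = y \<mu> r * (r ^ n * U1 r) - U r * (r ^ Suc n * P \<mu> r)" for r
  have "W 1 = W 0"
  proof (rule DERIV_isconst_end[of 0 1 W])
    show "continuous_on {0..1} W" unfolding W_def
      by (intro continuous_intros U1 radial_solutionD[OF sol])
    fix r :: real assume r: "0 < r" "r < 1"
    have "(W has_real_derivative (r * P \<mu> r * (r ^ n * U1 r) + r ^ n * (U r - \<mu> * U r) * y \<mu> r)
        - (U1 r * (r ^ Suc n * P \<mu> r) + - (r ^ n * ((\<mu> - 1) * y \<mu> r)) * U r)) (at r)"
      unfolding W_def[abs_def] by (intro DERIV_diff DERIV_mult U1 r radial_solutionD(3,4)[OF sol])
    also have "(r * P \<mu> r * (r ^ n * U1 r) + r ^ n * (U r - \<mu> * U r) * y \<mu> r)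
        - (U1 r * (r ^ Suc n * P \<mu> r) + - (r ^ n * ((\<mu> - 1) * y \<mu> r)) * U r) = 0"
      by (simp add: algebra_simps)
    finally show "(W has_real_derivative 0) (at r)" .
  qed simp
  \<comment> \<open>Here \<open>n \<ge> 1\<close> matters: \<open>0 ^ n = 0\<close> gives W 0 = 0
    whatever \<open>U1 0\<close> is, and \<open>U1 1 = 0\<close> reduces W 1 to
    \<open>- (U 1 * P \<mu> 1)\<close>.\<close>
  then have U_1: "U 1 = 0" using U1(3) P1 n by (simp add: W_def power_0_left)
  have zero: "U a = 0" if a: "0 < a" "a \<le> 1" for a
  proof -
    define C where "C = 1 / a ^ n + \<bar>1 - \<mu>\<bar>"
    have "U a = 0 \<and> a ^ n * U1 a = 0"
    proof (rule backward_uniqueness[where C = C and u = U and v = "\<lambda>r. r ^ n * U1 r" and b = 1])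
      show "continuous_on {a..1} U" using U1(1) by (rule continuous_on_subset) (use a in auto)
      have "continuous_on {a..1} U1" using U1(2) by (rule continuous_on_subset) (use a in auto)
      then show "continuous_on {a..1} (\<lambda>r. r ^ n * U1 r)" by (intro continuous_intros)
      fix r assume r: "a < r" "r < 1"
      show "(U has_real_derivative U1 r) (at r)" "((\<lambda>r. r ^ n * U1 r) has_real_derivative r ^ n * (U r - \<mu> * U r)) (at r)"
        using U1(4,5)[of r] r a by auto
      have "a ^ n * \<bar>U1 r\<bar> \<le> r ^ n * \<bar>U1 r\<bar>"
        using r a by (intro mult_right_mono power_mono) auto
      then have "\<bar>U1 r\<bar> \<le> 1 / a ^ n * \<bar>r ^ n * U1 r\<bar>" using r a
        by (simp add: field_simps abs_mult)
      also have "\<dots> \<le> C * \<bar>r ^ n * U1 r\<bar>" by (intro mult_right_mono) (auto simp: C_def)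
      finally show "\<bar>U1 r\<bar> \<le> C * \<bar>r ^ n * U1 r\<bar>" .
      have "U r - \<mu> * U r = (1 - \<mu>) * U r" by (simp add: algebra_simps)
      then have "\<bar>r ^ n * (U r - \<mu> * U r)\<bar> = r ^ n * (\<bar>1 - \<mu>\<bar> * \<bar>U r\<bar>)"
        using r a by (simp add: abs_mult)
      also have "\<dots> \<le> 1 * (\<bar>1 - \<mu>\<bar> * \<bar>U r\<bar>)" using r a by (intro mult_right_mono) (auto intro!: power_le_one)
      also have "\<dots> \<le> C * \<bar>U r\<bar>" unfolding mult_1 using a by (intro mult_right_mono) (auto simp: C_def)
      finally show "\<bar>r ^ n * (U r - \<mu> * U r)\<bar> \<le> C * \<bar>U r\<bar>" .
    qed (use a U_1 U1(3) in auto)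
    then show ?thesis by simp
  qed
  have "(U \<longlongrightarrow> U 0) (at 0 within {0..1})" using U1(1) by (simp add: continuous_on_def)
  then have "(U \<longlongrightarrow> U 0) (at_right 0)" using at_within_Icc_at_right[of 0 "1::real"] by simp
  moreover have "eventually (\<lambda>r::real. r \<in> {0<..<1}) (at_right 0)" by (rule eventually_at_right_real) simp
  then have "eventually (\<lambda>r. U r = 0) (at_right 0)" by eventually_elim (use zero in auto)
  ultimately have "U 0 = 0" by (metis tendsto_eventually tendsto_unique trivial_limit_at_right_real)
  then show False using zero[of "norm x"] x by (cases "x = 0") auto
qed

lemma radial_eigenvalues_eq:
  assumes dim: "DIM('a::euclidean_space) = Suc n" and n: "n \<ge> 1"
  shows "radial_eigenvalues TYPE('a) = {\<mu>. P \<mu> 1 = 0}"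
proof (intro set_eqI iffI)
  fix \<mu> assume "\<mu> \<in> radial_eigenvalues TYPE('a)"
  then show "\<mu> \<in> {\<mu>. P \<mu> 1 = 0}"
    using neumann_solution_imp_zero_derivative[OF dim n] by (auto simp: radial_eigenvalues_def)
next
  fix \<mu> assume "\<mu> \<in> {\<mu>. P \<mu> 1 = 0}"
  then have "neumann_solution (\<lambda>s. \<mu> * s) (\<lambda>x::'a. y \<mu> (norm x))"
    by (intro radial_solution_imp_neumann_solution[OF sol[of \<mu>] _ dim])
       (auto intro!: continuous_intros simp: algebra_simps)
  moreover have "(0::'a) \<in> cball 0 1" "y \<mu> (norm (0::'a)) \<noteq> 0" by (simp_all add: y0)
  ultimately show "\<mu> \<in> radial_eigenvalues TYPE('a)" unfolding radial_eigenvalues_def by blast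
qed

lemma radial_eigenvalue_less_imp_angle:
  assumes "DIM('a::euclidean_space) = Suc n" "n \<ge> 1" "k \<ge> 1" "radial_eigenvalue TYPE('a) k < \<mu>"
  shows "\<theta> \<mu> 1 > (k - 1) * pi"
  by (rule less_nth_neumann_value)
     (use assms in \<open>simp_all add: radial_eigenvalue_def flip: radial_eigenvalues_eq[OF assms(1,2)]\<close>)

end

section \<open>Growth bounds\<close>

lemma abs_diff_le_of_deriv_bound:
  fixes V B :: "real \<Rightarrow> real"
  assumes "0 \<le> b" and c: "continuous_on {0..b} V" "continuous_on {0..b} B"
    and d: "\<And>r. 0 < r \<Longrightarrow> r < b \<Longrightarrow> (V has_real_derivative V' r) (at r)"
      "\<And>r. 0 < r \<Longrightarrow> r < b \<Longrightarrow> (B has_real_derivative B' r) (at r)"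
    and le: "\<And>r. 0 < r \<Longrightarrow> r < b \<Longrightarrow> \<bar>V' r\<bar> \<le> B' r"
  shows "\<bar>V b - V 0\<bar> \<le> B b - B 0"
proof -
  have "B 0 - V 0 \<le> B b - V b"
    using assms by (intro DERIV_nonneg_imp_increasing_open[where f = "\<lambda>r. B r - V r"] continuous_intros)
       (fastforce intro!: derivative_intros exI conjI simp: abs_le_iff)+
  moreover have "B 0 + V 0 \<le> B b + V b"
    using assms by (intro DERIV_nonneg_imp_increasing_open[where f = "\<lambda>r. B r + V r"] continuous_intros)
       (fastforce intro!: derivative_intros exI conjI simp: abs_le_iff)+
  ultimately show ?thesis by linarith
qed

text \<open>Let A be the maximum of \<open>exp (- l * t) * \<bar>u t\<bar>\<close>. Two integrations
  bound the increment of u from 0 to s by half of \<open>A * exp (l * s)\<close>; at a maximum point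
  s that quantity is \<open>\<bar>u s\<bar>\<close>, so it is absorbed. Only linear growth
  enters.\<close>

lemma radial_solution_bound:
  assumes sol: "radial_solution n g u P" and g: "\<And>s. \<bar>g s\<bar> \<le> C * \<bar>s\<bar>" and C: "C > 0" and r: "r \<in> {0..1}"
  shows "\<bar>u r\<bar> \<le> 2 * exp (sqrt (2 * C)) * \<bar>u 0\<bar>"
proof -
  define l where "l = sqrt (2 * C)"
  have l: "l > 0" "l * l = 2 * C" using C by (auto simp: l_def)
  obtain s where s: "s \<in> {0..1}" and max: "\<And>t. t \<in> {0..1} \<Longrightarrow> exp (- l * t) * \<bar>u t\<bar> \<le> exp (- l * s) * \<bar>u s\<bar>"
  proof -
    have "continuous_on {0..1} (\<lambda>t. exp (- l * t) * \<bar>u t\<bar>)"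
      by (intro continuous_intros radial_solutionD(2)[OF sol])
    from continuous_attains_sup[OF compact_Icc _ this] show thesis
      using that by (auto simp del: mult_minus_left)
  qed
  define A where "A = exp (- l * s) * \<bar>u s\<bar>"
  have A0: "A \<ge> 0" by (simp add: A_def)
  have uA: "\<bar>u t\<bar> \<le> A * exp (l * t)" if "t \<in> {0..1}" for t
    using mult_right_mono[OF max[OF that, folded A_def], of "exp (l * t)"] by (simp add: exp_minus field_simps)
  have v: "\<bar>t ^ Suc n * P t\<bar> \<le> t ^ n * (C * A / l * exp (l * t))" if t: "t \<in> {0..1}" for t
  proof -
    have "\<bar>t ^ Suc n * P t - 0 ^ Suc n * P 0\<bar> \<le> t ^ n * (C * A / l * exp (l * t)) - 0 ^ n * (C * A / l * exp (l * 0))"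
    proof (rule abs_diff_le_of_deriv_bound[where V = "\<lambda>t. t ^ Suc n * P t" and B = "\<lambda>t. t ^ n * (C * A / l * exp (l * t))"])
      fix r assume r: "0 < r" "r < t"
      show "((\<lambda>t. t ^ Suc n * P t) has_real_derivative - (r ^ n * g (u r))) (at r)"
        by (rule radial_solutionD(4)[OF sol])
      show "((\<lambda>t. t ^ n * (C * A / l * exp (l * t))) has_real_derivative
          n * r ^ (n - 1) * (C * A / l * exp (l * r)) + r ^ n * (C * A * exp (l * r))) (at r)"
      proof -
        have "((\<lambda>t. C * A / l * exp (l * t)) has_real_derivative C * A * exp (l * r)) (at r)"
          using l(1) by (auto intro!: derivative_eq_intros)
        from DERIV_mult[OF DERIV_pow this, of n] show ?thesis by (simp add: mult_ac)
      qed
      have "\<bar>- (r ^ n * g (u r))\<bar> \<le> r ^ n * (C * (A * exp (l * r)))"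
        unfolding abs_minus_cancel abs_mult using r t uA[of r] C
        by (intro mult_mono order_trans[OF g]) (auto simp: abs_mult)
      \<comment> \<open>This is the term produced by differentiating the factor \<open>r ^ n\<close>
        of the comparison function; it has the favourable sign.\<close>
      moreover have "n * r ^ (n - 1) * (C * A / l * exp (l * r)) \<ge> 0" using r C l A0 by simp
      ultimately show "\<bar>- (r ^ n * g (u r))\<bar> \<le> n * r ^ (n - 1) * (C * A / l * exp (l * r)) + r ^ n * (C * A * exp (l * r))"
        by (simp add: mult.assoc)
    qed (use t l in \<open>auto intro!: continuous_intros radial_solutionD[OF sol] simp del: power_Suc\<close>)
    moreover have "0 ^ n * (C * A / l * exp (l * 0)) \<ge> 0" using C l A0 by simp
    ultimately show ?thesis by simp
  qed
  have incr: "\<bar>u s - u 0\<bar> \<le> C * A / l / l * exp (l * s) - C * A / l / l * exp (l * 0)"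
  proof (rule abs_diff_le_of_deriv_bound[where V = u and B = "\<lambda>t. C * A / l / l * exp (l * t)"])
    fix r assume r: "0 < r" "r < s"
    show "(u has_real_derivative r * P r) (at r)" by (rule radial_solutionD(3)[OF sol])
    show "((\<lambda>t. C * A / l / l * exp (l * t)) has_real_derivative C * A / l * exp (l * r)) (at r)"
      using l(1) by (auto intro!: derivative_eq_intros)
    have "r ^ n * \<bar>r * P r\<bar> \<le> r ^ n * (C * A / l * exp (l * r))"
      using v[of r] r s by (simp add: abs_mult mult_ac)
    then show "\<bar>r * P r\<bar> \<le> C * A / l * exp (l * r)" using r by (simp only: mult_le_cancel_left_pos zero_less_power)
  qed (use s l in \<open>auto intro!: continuous_intros radial_solutionD[OF sol]\<close>)
  have half: "C * A / l / l = A / 2" using l C by (simp add: field_simps)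
  have "\<bar>u s - u 0\<bar> \<le> A / 2 * exp (l * s)" using incr A0 unfolding half by simp
  moreover have "\<bar>u s\<bar> = A * exp (l * s)" by (simp add: A_def exp_minus)
  ultimately have "A * exp (l * s) \<le> 2 * \<bar>u 0\<bar>" by (simp add: abs_if split: if_splits)
  moreover have "A * 1 \<le> A * exp (l * s)" using A0 l s by (intro mult_left_mono) auto
  ultimately have "A \<le> 2 * \<bar>u 0\<bar>" by simp
  then have "A * exp (l * r) \<le> 2 * \<bar>u 0\<bar> * exp l" using r l A0 by (intro mult_mono) auto
  then show ?thesis using uA[OF r] by (simp add: l_def mult_ac)
qed

lemma radial_solution_P_bound:
  assumes sol: "radial_solution n g u P" and g: "\<And>t. t \<in> {0..1} \<Longrightarrow> \<bar>g (u t)\<bar> \<le> B" and r: "r \<in> {0<..1}"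
  shows "\<bar>P r\<bar> \<le> B"
proof -
  have B0: "B \<ge> 0" using g[of 0] by simp
  have "\<bar>r ^ Suc n * P r - 0 ^ Suc n * P 0\<bar> \<le> B * r ^ Suc n - B * 0 ^ Suc n"
  proof (rule abs_diff_le_of_deriv_bound[where V = "\<lambda>t. t ^ Suc n * P t" and B = "\<lambda>t. B * t ^ Suc n"])
    fix s assume s: "0 < s" "s < r"
    show "((\<lambda>t. t ^ Suc n * P t) has_real_derivative - (s ^ n * g (u s))) (at s)"
      by (rule radial_solutionD(4)[OF sol])
    show "((\<lambda>t. B * t ^ Suc n) has_real_derivative B * (Suc n * s ^ n)) (at s)"
      by (auto intro!: derivative_eq_intros simp del: power_Suc)
    have "\<bar>- (s ^ n * g (u s))\<bar> \<le> s ^ n * B" using s r g[of s] by (simp add: abs_mult mult_left_mono)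
    also have "\<dots> \<le> Suc n * (s ^ n * B)" using mult_right_mono[of 1 "real (Suc n)" "s ^ n * B"] B0 s by simp
    finally show "\<bar>- (s ^ n * g (u s))\<bar> \<le> B * (Suc n * s ^ n)" by (simp only: mult_ac)
  qed (use r in \<open>auto intro!: continuous_intros radial_solutionD[OF sol] simp del: power_Suc\<close>)
  then have "r ^ Suc n * \<bar>P r\<bar> \<le> r ^ Suc n * B" using r by (simp add: abs_mult mult_ac)
  then show ?thesis using r by (simp only: mult_le_cancel_left_pos greaterThanAtMost_iff zero_less_power)
qed

lemma first_zero:
  fixes f :: "real \<Rightarrow> real"
  assumes cont: "continuous_on {a..b} f" and f: "f a < 0" "f b \<ge> 0" and ab: "a \<le> b"
  obtains c where "a < c" "c \<le> b" "f c = 0" "\<And>s. a \<le> s \<Longrightarrow> s < c \<Longrightarrow> f s < 0"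
proof -
  have "compact ({a..b} \<inter> f -` {0..})"
    using continuous_closed_preimage[OF cont] by (simp add: compact_eq_bounded_closed bounded_Int)
  moreover have "{a..b} \<inter> f -` {0..} \<noteq> {}" using f ab by force
  ultimately obtain c where c: "c \<in> {a..b} \<inter> f -` {0..}" "\<forall>s\<in>{a..b} \<inter> f -` {0..}. c \<le> s"
    using compact_attains_inf by meson
  then have c': "c \<in> {a..b}" "f c \<ge> 0" "\<And>s. s \<in> {a..b} \<Longrightarrow> f s \<ge> 0 \<Longrightarrow> c \<le> s" by auto
  have "\<exists>x\<ge>a. x \<le> c \<and> f x = 0"
    by (rule IVT') (use c'(1,2) f in \<open>auto intro: continuous_on_subset[OF cont]\<close>)
  then obtain x where x: "a \<le> x" "x \<le> c" "f x = 0" by blast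
  with c'(1) c'(3)[of x] have "x = c" by auto
  show thesis
  proof (rule that)
    show "a < c" using c'(1,2) f(1) by (cases "a = c") auto
    show "c \<le> b" "f c = 0" using c'(1) x \<open>x = c\<close> by auto
    show "f s < 0" if "a \<le> s" "s < c" for s using c'(1) c'(3)[of s] that by (cases "f s \<ge> 0") auto
  qed
qed

section \<open>Uniqueness for the linear equation and for the angle\<close>

lemma radial_solution_diff:
  assumes "radial_solution n (\<lambda>s. c * s) u1 P1" "radial_solution n (\<lambda>s. c * s) u2 P2"
  shows "radial_solution n (\<lambda>s. c * s) (\<lambda>r. u1 r - u2 r) (\<lambda>r. P1 r - P2 r)"
  unfolding radial_solution_def
proof (intro conjI allI)
  show "continuous_on UNIV (\<lambda>r. P1 r - P2 r)"
    by (intro continuous_intros radial_solutionD[OF assms(1)] radial_solutionD[OF assms(2)])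
  fix r
  show "((\<lambda>r. u1 r - u2 r) has_real_derivative r * (P1 r - P2 r)) (at r)"
    using DERIV_diff[OF radial_solutionD(3)[OF assms(1)] radial_solutionD(3)[OF assms(2)]] by (simp add: algebra_simps)
  show "((\<lambda>r. r ^ Suc n * (P1 r - P2 r)) has_real_derivative - (r ^ n * (c * (u1 r - u2 r)))) (at r)"
    using DERIV_diff[OF radial_solutionD(4)[OF assms(1)] radial_solutionD(4)[OF assms(2)]] 
    by (simp add: algebra_simps)
qed

lemma linear_radial_solution_unique:
  assumes sol: "radial_solution n (\<lambda>s. c * s) u1 P1" "radial_solution n (\<lambda>s. c * s) u2 P2"
    and u0: "u1 0 = u2 0" and r: "r \<in> {0..1}"
  shows "u1 r = u2 r" "r ^ Suc n * P1 r = r ^ Suc n * P2 r"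
proof -
  note d = radial_solution_diff[OF sol]
  have *: "u1 t = u2 t" if "t \<in> {0..1}" for t
    using radial_solution_bound[OF d _ _ that, of "\<bar>c\<bar> + 1"] u0 by (simp add: abs_mult algebra_simps)
  then show "u1 r = u2 r" using r .
  show "r ^ Suc n * P1 r = r ^ Suc n * P2 r"
    using radial_solution_P_bound[OF d, of 0 r] * r by (cases "r = 0") auto
qed

text \<open>This carries the spectral information over to \<epsilon> = 0. For equal curves the
  difference of the angles starts at 0 and has cosine 1 throughout, hence stays 0.\<close>

lemma radial_family_angle_unique:
  assumes "radial_family n h1 y1 P1 \<theta>1" "radial_family n h2 y2 P2 \<theta>2"
    and eq: "\<And>r. r \<in> {0..1} \<Longrightarrow> y1 p r = y2 q r" "\<And>r. r \<in> {0..1} \<Longrightarrow> r ^ Suc n * P1 p r = r ^ Suc n * P2 q r"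
  shows "\<theta>1 p 1 = \<theta>2 q 1"
proof -
  interpret A: radial_family n h1 y1 P1 \<theta>1 by fact
  interpret B: radial_family n h2 y2 P2 \<theta>2 by fact
  let ?d = "\<lambda>r. \<theta>1 p r - \<theta>2 q r"
  have d: "cos (?d r) = 1" if r: "r \<in> {0..1}" for r
  proof -
    have \<rho>: "A.\<rho> p r = B.\<rho> q r" unfolding A.\<rho>_def B.\<rho>_def eq[OF r] ..
    have "A.\<rho> p r * cos (\<theta>1 p r) = A.\<rho> p r * cos (\<theta>2 q r)" "A.\<rho> p r * sin (\<theta>1 p r) = A.\<rho> p r * sin (\<theta>2 q r)"
      using eq[OF r] A.y_polar[OF r, of p] B.y_polar[OF r, of q] A.v_polar[OF r, of p] B.v_polar[OF r, of q]
      unfolding \<rho> by linarith+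
    then have "cos (\<theta>1 p r) = cos (\<theta>2 q r)" "sin (\<theta>1 p r) = sin (\<theta>2 q r)"
      using A.\<rho>_pos[OF r, of p] by auto
    then show ?thesis by (simp add: cos_diff flip: power2_eq_square)
  qed
  have "\<bar>?d 1\<bar> < pi / 2"
    by (rule angle_abs_less_pi_half[where \<delta> = ?d and a = 0 and b = 1])
       (use d A.\<theta>0 B.\<theta>0 in \<open>auto intro!: continuous_intros A.\<theta>_cont_snd B.\<theta>_cont_snd\<close>)
  moreover have "cos \<bar>?d 1\<bar> = cos 0" using d[of 1] by simp
  then have "\<bar>?d 1\<bar> = 0" by (rule cos_inj_pi[rotated 4]) (use \<open>\<bar>?d 1\<bar> < pi / 2\<close> pi_gt_zero in linarith)+
  then show ?thesis by simp
qed

section \<open>Shooting from the centre\<close>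

text \<open>With \<open>a = 1 / (4 * C * exp (sqrt (2 * C)))\<close> this is
  \<open>2 * (\<beta> + (C * \<beta> + 1) / a ^ n)\<close>. A solution starting at this value d
  stays above d / 2 up to radius a, and \<open>a ^ n * (d / 2 - \<beta>) = C * \<beta> + 1\<close>
  exceeds what \<open>r ^ n * u'\<close> can regain below \<beta>.\<close>

definition large_value :: "nat \<Rightarrow> real \<Rightarrow> real \<Rightarrow> real" where
  "large_value n C \<beta> = 2 * (\<beta> + (C * \<beta> + 1) * (4 * C * exp (sqrt (2 * C))) ^ n)"

text \<open>Here g stands for the truncated f(s) - s. The constants L and C are separate because the
  Lipschitz constant depends on the truncation level while the growth constant does not.\<close>

locale shooting =
  fixes n :: nat and g :: "real \<Rightarrow> real" and \<beta> m L C :: real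
  assumes \<beta>: "\<beta> > 0"
    and lip: "\<bar>g s - g t\<bar> \<le> L * \<bar>s - t\<bar>"
    and C: "C \<ge> 1" and lin: "\<bar>g s\<bar> \<le> C * \<bar>s\<bar>"
    and g_\<beta>: "g \<beta> = 0" "(g has_real_derivative m) (at \<beta>)"
    and g_above: "s > \<beta> \<Longrightarrow> g s > 0"
    and g_below: "0 < s \<Longrightarrow> s < \<beta> \<Longrightarrow> g s < 0"
    and g_neg: "s < 0 \<Longrightarrow> g s = - s"
begin

text \<open>Thus \<open>h \<epsilon> y = g (\<beta> + \<epsilon> y) / \<epsilon>\<close> for \<open>\<epsilon> \<noteq> 0\<close>, and \<open>h 0\<close> is the linearisation at \<open>\<beta>\<close>.\<close>

definition quot :: "real \<Rightarrow> real" where "quot s = (if s = 0 then m else g (\<beta> + s) / s)"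

definition h :: "real \<Rightarrow> real \<Rightarrow> real" where "h \<epsilon> y = y * quot (\<epsilon> * y)"

lemma g_cont: "continuous_on S g"
proof (rule continuous_onI)
  fix x e assume "e > (0::real)"
  have "dist (g y) (g x) \<le> e" if "dist y x < e / (\<bar>L\<bar> + 1)" for y
  proof -
    have "\<bar>g y - g x\<bar> \<le> L * \<bar>y - x\<bar>" by (rule lip)
    also have "\<dots> \<le> (\<bar>L\<bar> + 1) * \<bar>y - x\<bar>" by (intro mult_right_mono) auto
    also have "\<dots> \<le> e" using that by (simp add: dist_real_def field_simps)
    finally show ?thesis by (simp add: dist_real_def)
  qed
  then show "\<exists>d>0. \<forall>x'\<in>S. dist x' x < d \<longrightarrow> dist (g x') (g x) \<le> e"
    using \<open>e > 0\<close> by (intro exI[of _ "e / (\<bar>L\<bar> + 1)"]) auto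
qed

lemma quot_cont: "continuous_on UNIV quot"
proof -
  have "isCont quot s" for s
  proof (cases "s = 0")
    case True
    have "((\<lambda>s. g (\<beta> + s) / s) \<longlongrightarrow> m) (at 0)" using g_\<beta> by (simp add: DERIV_def)
    then have "(quot \<longlongrightarrow> m) (at 0)"
      by (rule Lim_transform_eventually) (auto simp: quot_def eventually_at_filter)
    then show ?thesis by (simp add: isCont_def True quot_def)
  next
    case False
    have "isCont (\<lambda>s. g (\<beta> + s) / s) s"
      using False by (intro continuous_intros isCont_o2[OF _ continuous_on_interior[OF g_cont[of UNIV]]]) auto
    moreover have "eventually (\<lambda>s. s \<in> - {0}) (nhds s)"
      using False by (intro eventually_nhds_in_open) auto
    then have "eventually (\<lambda>s. g (\<beta> + s) / s = quot s) (nhds s)"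
      by eventually_elim (simp add: quot_def)
    ultimately show ?thesis by (simp add: isCont_cong)
  qed
  then show ?thesis by (simp add: continuous_on_eq_continuous_at)
qed

lemma h_mult: "\<epsilon> * h \<epsilon> y = g (\<beta> + \<epsilon> * y)"
  using g_\<beta> by (simp add: h_def quot_def)

lemma h_zero: "h 0 y = m * y" by (simp add: h_def quot_def)

lemma family_exists: obtains y P \<theta> where "radial_family n h y P \<theta>"
proof (rule radial_family_angle_exists[where h = h and L = "\<lambda>_. \<bar>L\<bar> + \<bar>m\<bar> + 1"])
  show "continuous_on UNIV (\<lambda>(p, y). h p y)"
    unfolding h_def split_beta by (intro continuous_intros continuous_on_compose2[OF quot_cont]) auto
  \<comment> \<open>One constant serves all parameters: for p nonzero the division by p cancels the
    scaling of the argument, and \<open>\<bar>m\<bar>\<close> covers p = 0.\<close>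
  show "\<bar>h p y - h p z\<bar> \<le> (\<bar>L\<bar> + \<bar>m\<bar> + 1) * \<bar>y - z\<bar>" for p y z
  proof (cases "p = 0")
    case True
    have "h p y - h p z = m * (y - z)" by (simp add: True h_zero right_diff_distrib)
    then have "\<bar>h p y - h p z\<bar> = \<bar>m\<bar> * \<bar>y - z\<bar>" by (simp add: abs_mult)
    also have "\<dots> \<le> (\<bar>L\<bar> + \<bar>m\<bar> + 1) * \<bar>y - z\<bar>" by (intro mult_right_mono) auto
    finally show ?thesis .
  next
    case False
    have "\<bar>p\<bar> * \<bar>h p y - h p z\<bar> = \<bar>g (\<beta> + p * y) - g (\<beta> + p * z)\<bar>"
      unfolding abs_mult[symmetric] right_diff_distrib h_mult ..
    also have "\<dots> \<le> L * \<bar>(\<beta> + p * y) - (\<beta> + p * z)\<bar>" by (rule lip)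
    also have "(\<beta> + p * y) - (\<beta> + p * z) = p * (y - z)" by (simp add: algebra_simps)
    also have "L * \<bar>p * (y - z)\<bar> = \<bar>p\<bar> * (L * \<bar>y - z\<bar>)" by (simp add: abs_mult)
    finally have "\<bar>h p y - h p z\<bar> \<le> L * \<bar>y - z\<bar>" using False by simp
    also have "\<dots> \<le> (\<bar>L\<bar> + \<bar>m\<bar> + 1) * \<bar>y - z\<bar>" by (intro mult_right_mono) auto
    finally show ?thesis .
  qed
qed (auto simp: h_def intro: that)

end

locale shooting_family = shooting n g \<beta> m L C + radial_family n "shooting.h g \<beta> m" y P \<theta>
  for n g \<beta> m L C y P \<theta>
begin

definition u where "u \<epsilon> r = \<beta> + \<epsilon> * y \<epsilon> r"

lemma u_sol: "radial_solution n g (u \<epsilon>) (\<lambda>r. \<epsilon> * P \<epsilon> r)"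
  unfolding radial_solution_def
proof (intro conjI allI)
  show "continuous_on UNIV (\<lambda>r. \<epsilon> * P \<epsilon> r)" by (intro continuous_intros radial_solutionD[OF sol])
  fix r
  show "(u \<epsilon> has_real_derivative r * (\<epsilon> * P \<epsilon> r)) (at r)"
  proof -
    have "(u \<epsilon> has_real_derivative 0 + \<epsilon> * (r * P \<epsilon> r)) (at r)"
      unfolding u_def[abs_def] by (intro DERIV_add DERIV_const DERIV_cmult radial_solutionD(3)[OF sol])
    then show ?thesis by (simp only: add_0_left mult.left_commute)
  qed
  have "(\<lambda>r. r ^ Suc n * (\<epsilon> * P \<epsilon> r)) = (\<lambda>r. \<epsilon> * (r ^ Suc n * P \<epsilon> r))" by (simp add: mult_ac)
  moreover have "- (r ^ n * g (u \<epsilon> r)) = \<epsilon> * - (r ^ n * h \<epsilon> (y \<epsilon> r))"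
    by (simp add: u_def flip: h_mult)
  ultimately show "((\<lambda>r. r ^ Suc n * (\<epsilon> * P \<epsilon> r)) has_real_derivative - (r ^ n * g (u \<epsilon> r))) (at r)"
    using DERIV_cmult[OF radial_solutionD(4)[OF sol]] by presburger
qed

lemma u_0: "u \<epsilon> 0 = \<beta> + \<epsilon>" by (simp add: u_def y0)

lemma u_bound: "r \<in> {0..1} \<Longrightarrow> \<bar>u \<epsilon> r\<bar> \<le> 2 * exp (sqrt (2 * C)) * \<bar>\<beta> + \<epsilon>\<bar>"
  using radial_solution_bound[OF u_sol lin, of r \<epsilon>] C by (simp add: u_0)

lemma u_cont: "continuous_on S (u \<epsilon>)" by (rule radial_solutionD(2)[OF u_sol])

lemma small_angle:
  assumes "0 < \<beta> + \<epsilon>" "2 * exp (sqrt (2 * C)) * (\<beta> + \<epsilon>) < \<beta>"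
  shows "\<theta> \<epsilon> 1 < pi"
proof -
  have "1 * (\<beta> + \<epsilon>) \<le> 2 * exp (sqrt (2 * C)) * (\<beta> + \<epsilon>)"
    using assms C by (intro mult_right_mono) (auto intro: order_trans[OF _ mult_mono[of 1 2 1]])
  then have "1 * (\<beta> + \<epsilon>) < \<beta>" using assms(2) by (rule order.strict_trans1)
  then have \<epsilon>: "\<epsilon> < 0" by simp
  have "cos (\<theta> \<epsilon> r) > 0" if r: "r \<in> {0..1}" for r
  proof -
    have "u \<epsilon> r < \<beta>" using u_bound[OF r, of \<epsilon>] assms by simp
    then have "y \<epsilon> r > 0" using \<epsilon> by (simp add: u_def mult_less_0_iff)
    then show ?thesis using y_polar[OF r, of \<epsilon>] \<rho>_pos[OF r, of \<epsilon>] by (simp add: zero_less_mult_iff)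
  qed
  then have "\<bar>\<theta> \<epsilon> 1\<bar> < pi / 2"
    using angle_abs_less_pi_half[OF \<theta>_cont_snd \<theta>0, of \<epsilon> 1] by simp
  then show ?thesis using pi_gt_zero by linarith
qed

text \<open>A large initial value drops below \<open>\<beta>\<close>, if at all, so steeply that \<open>r\<^sup>n u'\<close>, whose derivative
  is at most \<open>C \<beta>\<close>, stays negative afterwards.\<close>

lemma large_angle:
  assumes \<epsilon>: "\<beta> + \<epsilon> = large_value n C \<beta>"
  shows "\<epsilon> > 0" "\<theta> \<epsilon> 1 < pi"
proof -
  define d where "d = \<beta> + \<epsilon>"
  define K where "K = 2 * exp (sqrt (2 * C))"
  \<comment> \<open>By \<open>Pb\<close>, u' is at most C K d in absolute value, so over the length
    a the solution falls by at most d / 2.\<close>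
  define a where "a = 1 / (2 * C * K)"
  have K: "K \<ge> 2" using C by (simp add: K_def)
  have a: "0 < a" "a \<le> 1"
  proof -
    have "1 * 1 \<le> (2 * C) * K" using C K by (intro mult_mono) auto
    then show "0 < a" "a \<le> 1" using C K by (auto simp: a_def)
  qed
  have "1 / a ^ n = (4 * C * exp (sqrt (2 * C))) ^ n" by (simp add: a_def K_def power_divide power_mult_distrib mult_ac)
  then have d: "d = 2 * (\<beta> + (C * \<beta> + 1) / a ^ n)"
  proof -
    have "(C * \<beta> + 1) / a ^ n = (C * \<beta> + 1) * (1 / a ^ n)" by simp
    then show ?thesis using \<epsilon> unfolding d_def large_value_def \<open>1 / a ^ n = _\<close> by simp
  qed
  have pos: "(C * \<beta> + 1) / a ^ n > 0" using C \<beta> a by (intro divide_pos_pos add_nonneg_pos) auto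
  have "d / 2 - \<beta> = (C * \<beta> + 1) / a ^ n"
    unfolding d by (metis add_diff_cancel_left' nonzero_mult_div_cancel_left zero_neq_numeral)
  then have d2: "d / 2 > \<beta>" "a ^ n * (d / 2 - \<beta>) = C * \<beta> + 1" using pos a by auto
  show \<epsilon>0: "\<epsilon> > 0" using d2 \<beta> by (simp add: d_def)
  have d0: "d > 0" using d2 \<beta> by simp
  define V where "V r = r ^ Suc n * (\<epsilon> * P \<epsilon> r)" for r
  have V': "(V has_real_derivative - (r ^ n * g (u \<epsilon> r))) (at r)" for r
    unfolding V_def[abs_def] by (rule radial_solutionD(4)[OF u_sol])
  have u': "(u \<epsilon> has_real_derivative r * (\<epsilon> * P \<epsilon> r)) (at r within S)" for r S
    by (rule radial_solutionD(3)[OF u_sol])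
  have Vc: "continuous_on S V" for S by (rule DERIV_continuous_on[OF has_field_derivative_at_within[OF V']])
  have Pb: "\<bar>\<epsilon> * P \<epsilon> r\<bar> \<le> C * (K * d)" if "r \<in> {0<..1}" for r
  proof (rule radial_solution_P_bound[OF u_sol _ that])
    fix t :: real assume "t \<in> {0..1}"
    then have "\<bar>u \<epsilon> t\<bar> \<le> K * d" using u_bound[of t \<epsilon>] d0 by (simp add: K_def d_def)
    then have "C * \<bar>u \<epsilon> t\<bar> \<le> C * (K * d)" using C by (intro mult_left_mono) auto
    then show "\<bar>g (u \<epsilon> t)\<bar> \<le> C * (K * d)" using lin[of "u \<epsilon> t"] by (rule order_trans[rotated])
  qed
  have early: "u \<epsilon> r \<ge> d / 2" if r: "r \<in> {0..a}" for r
  proof -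
    have "\<bar>u \<epsilon> r - u \<epsilon> 0\<bar> \<le> C * (K * d) * r - C * (K * d) * 0"
    proof (rule abs_diff_le_of_deriv_bound[where V = "u \<epsilon>" and B = "\<lambda>r. C * (K * d) * r"])
      fix s assume s: "0 < s" "s < r"
      show "(u \<epsilon> has_real_derivative s * (\<epsilon> * P \<epsilon> s)) (at s)" by (rule u')
      show "((\<lambda>r. C * (K * d) * r) has_real_derivative C * (K * d)) (at s)" by (auto intro!: derivative_eq_intros)
      have "s * \<bar>\<epsilon> * P \<epsilon> s\<bar> \<le> 1 * (C * (K * d))" using s r a Pb[of s] by (intro mult_mono) auto
      then show "\<bar>s * (\<epsilon> * P \<epsilon> s)\<bar> \<le> C * (K * d)" using s by (simp add: abs_mult)
    qed (use r in \<open>auto intro!: continuous_intros u_cont\<close>)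
    also have "\<dots> \<le> C * (K * d) * a" using r C K d0 by (simp add: mult_left_mono)
    also have "\<dots> = d / 2" using C K by (simp add: a_def)
    finally have "\<bar>u \<epsilon> r - d\<bar> \<le> d / 2" unfolding u_0 d_def .
    then have "d - u \<epsilon> r \<le> d / 2" using abs_ge_minus_self[of "u \<epsilon> r - d"] by linarith
    then show ?thesis by simp
  qed
  \<comment> \<open>Let b be the first radius with u = \<beta>. As b - a is at most 1, the mean
    value theorem on [a, b] gives a slope of at most - (d / 2 - \<beta>) at some \<xi>, so V is at
    most - (C \<beta> + 1) there. V decreases up to b and then rises by at most C \<beta>.\<close>
  have V_neg: "V r < 0" if r: "r \<in> {0..1}" and ur: "u \<epsilon> r < \<beta>" for r
  proof -
    obtain b where b: "0 < b" "b \<le> r" "\<beta> - u \<epsilon> b = 0" "\<And>s. 0 \<le> s \<Longrightarrow> s < b \<Longrightarrow> \<beta> - u \<epsilon> s < 0"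
    proof -
      have "continuous_on {0..r} (\<lambda>s. \<beta> - u \<epsilon> s)" by (intro continuous_intros u_cont)
      moreover have "\<beta> - u \<epsilon> 0 < 0" "\<beta> - u \<epsilon> r \<ge> 0" "0 \<le> r" using r ur \<epsilon>0 by (auto simp: u_0)
      ultimately show thesis by (rule first_zero) (rule that)
    qed
    have ab: "a < b" using early[of b] b(1,3) d2(1) by (cases "a < b") auto
    have "\<exists>\<xi>. a < \<xi> \<and> \<xi> < b \<and> u \<epsilon> b - u \<epsilon> a = (b - a) * (\<xi> * (\<epsilon> * P \<epsilon> \<xi>))"
      by (rule MVT2[OF ab]) (rule u')
    then obtain \<xi> where \<xi>: "a < \<xi>" "\<xi> < b" "u \<epsilon> b - u \<epsilon> a = (b - a) * (\<xi> * (\<epsilon> * P \<epsilon> \<xi>))"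
      by blast
    define w where "w = \<xi> * (\<epsilon> * P \<epsilon> \<xi>)"
    have drop: "(b - a) * w \<le> - (d / 2 - \<beta>)"
      using early[of a] a b(3) \<xi>(3) by (simp add: w_def)
    have "w \<le> 0"
    proof (rule ccontr)
      assume "\<not> w \<le> 0"
      then have "(b - a) * w \<ge> 0" using ab by simp
      then show False using drop d2(1) by linarith
    qed
    moreover have "b - a \<le> 1" using a b r by simp
    ultimately have "1 * w \<le> (b - a) * w" by (intro mult_right_mono_neg)
    then have "\<xi> * (\<epsilon> * P \<epsilon> \<xi>) \<le> - (d / 2 - \<beta>)" using drop by (simp add: w_def)
    then have "\<xi> ^ n * (d / 2 - \<beta>) \<le> \<xi> ^ n * (- (\<xi> * (\<epsilon> * P \<epsilon> \<xi>)))"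
      using \<xi> a by (intro mult_left_mono) auto
    moreover have "a ^ n * (d / 2 - \<beta>) \<le> \<xi> ^ n * (d / 2 - \<beta>)"
      using \<xi> a d2 by (intro mult_right_mono power_mono) auto
    ultimately have "V \<xi> \<le> - (C * \<beta> + 1)" using d2 by (simp add: V_def mult_ac)
    moreover have "- V \<xi> \<le> - V b"
    proof (rule DERIV_nonneg_imp_increasing_open[where f = "\<lambda>r. - V r"])
      fix s assume s: "\<xi> < s" "s < b"
      then have "g (u \<epsilon> s) > 0" using b(4)[of s] g_above[of "u \<epsilon> s"] a \<xi> by simp
      moreover have "((\<lambda>r. - V r) has_real_derivative s ^ n * g (u \<epsilon> s)) (at s)"
        using DERIV_minus[OF V'[of s]] by simp
      ultimately show "\<exists>z. ((\<lambda>r. - V r) has_real_derivative z) (at s) \<and> 0 \<le> z"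
        using s \<xi> a by (intro exI conjI) auto
    qed (use \<xi> in \<open>auto intro!: continuous_intros Vc\<close>)
    moreover have "C * \<beta> * b - V b \<le> C * \<beta> * r - V r"
    proof (rule DERIV_nonneg_imp_increasing_open[where f = "\<lambda>r. C * \<beta> * r - V r"])
      fix s assume s: "b < s" "s < r"
      have "- g (u \<epsilon> s) \<le> C * \<beta>"
      proof -
        have C\<beta>: "C * \<beta> \<ge> 0" using C \<beta> by simp
        consider "u \<epsilon> s < 0" | "0 \<le> u \<epsilon> s" "u \<epsilon> s \<le> \<beta>" | "u \<epsilon> s > \<beta>" by linarith
        then show ?thesis
        proof cases
          case 1
          then show ?thesis using g_neg[OF 1] C\<beta> by linarith
        next
          case 2
          then have "C * \<bar>u \<epsilon> s\<bar> \<le> C * \<beta>" using C by (intro mult_left_mono) auto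
          then show ?thesis using lin[of "u \<epsilon> s"] by linarith
        next
          case 3
          then show ?thesis using g_above[OF 3] C\<beta> by linarith
        qed
      qed
      then have "s ^ n * (- g (u \<epsilon> s)) \<le> 1 * (C * \<beta>)" if "- g (u \<epsilon> s) \<ge> 0"
        using that s b r by (intro mult_mono) (auto intro!: power_le_one)
      moreover have "s ^ n * (- g (u \<epsilon> s)) \<le> 0" if "- g (u \<epsilon> s) \<le> 0"
        using that s b by (intro mult_nonneg_nonpos) auto
      moreover have "C * \<beta> \<ge> 0" using C \<beta> by simp
      ultimately have "s ^ n * (- g (u \<epsilon> s)) \<le> C * \<beta>" by linarith
      moreover have "((\<lambda>r. C * \<beta> * r - V r) has_real_derivative C * \<beta> - - (s ^ n * g (u \<epsilon> s))) (at s)"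
        by (rule DERIV_diff[OF _ V']) (auto intro!: derivative_eq_intros)
      ultimately show "\<exists>z. ((\<lambda>r. C * \<beta> * r - V r) has_real_derivative z) (at s) \<and> 0 \<le> z"
        by (intro exI conjI) auto
    qed (use b in \<open>auto intro!: continuous_intros Vc\<close>)
    moreover have "C * \<beta> * (r - b) \<le> C * \<beta> * 1" using C \<beta> r b by (intro mult_left_mono) auto
    then have "C * \<beta> * r - C * \<beta> * b \<le> C * \<beta>" by (simp only: right_diff_distrib mult_1_right)
    ultimately show ?thesis by linarith
  qed
  \<comment> \<open>An angle of pi would mean u < \<beta> and V = 0 at once.\<close>
  have "\<theta> \<epsilon> r \<noteq> pi" if r: "r \<in> {0..1}" for r
  proof
    assume *: "\<theta> \<epsilon> r = pi"
    have "y \<epsilon> r = - \<rho> \<epsilon> r" using y_polar[OF r, of \<epsilon>] unfolding * by simp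
    then have "\<epsilon> * y \<epsilon> r < 0" using \<rho>_pos[OF r, of \<epsilon>] \<epsilon>0 by simp
    moreover have "V r = 0" using v_polar[OF r, of \<epsilon>] unfolding * V_def mult.left_commute[of _ \<epsilon>] by simp
    ultimately have "u \<epsilon> r < \<beta>" "V r = 0" by (simp_all add: u_def)
    then show False using V_neg[OF r] by simp
  qed
  then show "\<theta> \<epsilon> 1 < pi"
    using angle_less[OF \<theta>_cont_snd, of \<epsilon> pi 1] by (simp add: \<theta>0)
qed

end

section \<open>Positivity, increasing angle and sign changes of Neumann solutions\<close>

context shooting_family begin

text \<open>At a first zero, \<open>u' < 0\<close>. As \<open>g(s) = - s > 0\<close> for \<open>s < 0\<close>, \<open>r\<^sup>n u'\<close> would decrease from there on and
  could not vanish at \<open>r = 1\<close>.\<close>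

lemma u_pos:
  assumes P1: "P \<epsilon> 1 = 0" and \<epsilon>: "\<beta> + \<epsilon> > 0" and r: "r \<in> {0..1}"
  shows "u \<epsilon> r > 0"
proof (rule ccontr)
  assume neg: "\<not> u \<epsilon> r > 0"
  define V where "V r = r ^ Suc n * (\<epsilon> * P \<epsilon> r)" for r
  have V': "(V has_real_derivative - (r ^ n * g (u \<epsilon> r))) (at r)" for r
    unfolding V_def[abs_def] by (rule radial_solutionD(4)[OF u_sol])
  have Vc: "continuous_on S V" for S by (rule DERIV_continuous_on[OF has_field_derivative_at_within[OF V']])
  have u': "(u \<epsilon> has_real_derivative r * (\<epsilon> * P \<epsilon> r)) (at r)" for r
    by (rule radial_solutionD(3)[OF u_sol])
  obtain b where b: "0 < b" "b \<le> r" "- u \<epsilon> b = 0" "\<And>s. 0 \<le> s \<Longrightarrow> s < b \<Longrightarrow> - u \<epsilon> s < 0"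
  proof -
    have "continuous_on {0..r} (\<lambda>s. - u \<epsilon> s)" by (intro continuous_intros u_cont)
    moreover have "- u \<epsilon> 0 < 0" "- u \<epsilon> r \<ge> 0" "0 \<le> r" using r neg \<epsilon> by (auto simp: u_0)
    ultimately show thesis by (rule first_zero) (rule that)
  qed
  \<comment> \<open>The constant 0 is also an equilibrium of g, so by uniqueness u cannot touch 0
    with zero slope.\<close>
  have "\<epsilon> * P \<epsilon> b \<noteq> 0"
    using radial_solution_nonzero[OF u_sol lin, of b \<epsilon>] b r \<epsilon> by (auto simp: u_0)
  moreover have "\<not> b * (\<epsilon> * P \<epsilon> b) > 0"
  proof
    assume "b * (\<epsilon> * P \<epsilon> b) > 0"
    from DERIV_pos_inc_left[OF u' this] obtain d where d: "d > 0" "\<And>h. 0 < h \<Longrightarrow> h < d \<Longrightarrow> u \<epsilon> (b - h) < u \<epsilon> b" by blast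
    define h where "h = min (d / 2) b"
    have "0 < h" "h < d" "h \<le> b" using d(1) b(1) by (auto simp: h_def)
    then show False using d(2)[of h] b(3) b(4)[of "b - h"] by simp
  qed
  ultimately have "\<epsilon> * P \<epsilon> b < 0" using b(1) by (meson linorder_neqE_linordered_idom mult_pos_pos)
  then have Vb: "V b < 0" unfolding V_def by (rule mult_pos_neg[OF zero_less_power[OF b(1)]])
  have V1: "V 1 = 0" by (simp add: V_def P1)
  \<comment> \<open>The Neumann condition makes V return to 0; c is the first such radius, and u
    stays negative on the way there.\<close>
  obtain c where c: "b < c" "c \<le> 1" "V c = 0" "\<And>s. b \<le> s \<Longrightarrow> s < c \<Longrightarrow> V s < 0"
  proof -
    have "V 1 \<ge> 0" "b \<le> 1" using V1 b r by auto
    with Vc[of "{b..1}"] Vb show thesis by (rule first_zero) (rule that)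
  qed
  have u_neg: "u \<epsilon> s < 0" if s: "b < s" "s \<le> c" for s
  proof -
    have "- u \<epsilon> b < - u \<epsilon> s"
    proof (rule DERIV_pos_imp_increasing_open[where f = "\<lambda>r. - u \<epsilon> r"])
      fix t assume t: "b < t" "t < s"
      have "V t < 0" using c(4)[of t] t s by simp
      then have "t ^ n * (t * (\<epsilon> * P \<epsilon> t)) < 0" by (simp add: V_def mult_ac)
      then have "- (t * (\<epsilon> * P \<epsilon> t)) > 0" using b(1) t by (simp add: mult_less_0_iff zero_less_mult_iff)
      moreover have "((\<lambda>r. - u \<epsilon> r) has_real_derivative - (t * (\<epsilon> * P \<epsilon> t))) (at t)" by (rule DERIV_minus[OF u'])
      ultimately show "\<exists>z. ((\<lambda>r. - u \<epsilon> r) has_real_derivative z) (at t) \<and> 0 < z" by blast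
    qed (use s in \<open>auto intro!: continuous_intros u_cont\<close>)
    then show ?thesis using b(3) by simp
  qed
  have "- V b \<le> - V c"
  proof (rule DERIV_nonneg_imp_increasing_open[where f = "\<lambda>r. - V r"])
    fix t assume t: "b < t" "t < c"
    have "g (u \<epsilon> t) > 0" using u_neg[of t] g_neg[of "u \<epsilon> t"] t by simp
    then have "t ^ n * g (u \<epsilon> t) \<ge> 0" using b(1) t by simp
    moreover have "((\<lambda>r. - V r) has_real_derivative t ^ n * g (u \<epsilon> t)) (at t)"
      using DERIV_minus[OF V'[of t]] by simp
    ultimately show "\<exists>z. ((\<lambda>r. - V r) has_real_derivative z) (at t) \<and> 0 \<le> z" by blast
  qed (use c in \<open>auto intro!: continuous_intros Vc\<close>)
  then show False using Vb c(3) by simp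
qed

lemma quot_pos: "s \<noteq> 0 \<Longrightarrow> \<beta> + s > 0 \<Longrightarrow> quot s > 0"
  using g_above[of "\<beta> + s"] g_below[of "\<beta> + s"] 
  by (cases "s > 0") (auto simp: quot_def intro: divide_pos_pos divide_neg_neg)

text \<open>The numerator of \<theta>' is \<open>r ^ n\<close> times the sum of
  \<open>y\<^sup>2 * quot\<close> and the square of y'. Positivity of u, hence the Neumann
  condition, is what makes \<open>quot\<close> positive: at negative values of u it is negative and
  the angle could turn back.\<close>

lemma \<theta>_less:
  assumes P1: "P \<epsilon> 1 = 0" and \<epsilon>: "\<beta> + \<epsilon> > 0" "\<epsilon> \<noteq> 0" and ab: "0 \<le> a" "a < b" "b \<le> 1"
  shows "\<theta> \<epsilon> a < \<theta> \<epsilon> b"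
proof (rule DERIV_pos_imp_increasing_open[where f = "\<theta> \<epsilon>", OF ab(2)])
  show "continuous_on {a..b} (\<theta> \<epsilon>)" using \<theta>_cont_snd by (rule continuous_on_subset) (use ab in auto)
  fix r assume r: "a < r" "r < b"
  have r01: "r \<in> {0..1}" "r > 0" using r ab by auto
  have "(\<theta> \<epsilon> has_real_derivative (r ^ n * h \<epsilon> (y \<epsilon> r) * y \<epsilon> r + r * P \<epsilon> r * (r ^ Suc n * P \<epsilon> r)) / (\<rho> \<epsilon> r)\<^sup>2) (at r)"
    using \<theta>_deriv[OF r01(1), of \<epsilon>] at_within_interior[of r "{0..1}"] r ab by simp
  moreover have "r ^ n * h \<epsilon> (y \<epsilon> r) * y \<epsilon> r + r * P \<epsilon> r * (r ^ Suc n * P \<epsilon> r)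
      = r ^ n * ((y \<epsilon> r)\<^sup>2 * quot (\<epsilon> * y \<epsilon> r) + (r * P \<epsilon> r)\<^sup>2)"
    by (simp add: h_def power2_eq_square algebra_simps)
  moreover have "(y \<epsilon> r)\<^sup>2 * quot (\<epsilon> * y \<epsilon> r) + (r * P \<epsilon> r)\<^sup>2 > 0"
  proof (cases "y \<epsilon> r = 0")
    case True
    then show ?thesis using nonzero[OF r01(1), of \<epsilon>] r01 by simp
  next
    case False
    then have "quot (\<epsilon> * y \<epsilon> r) > 0" using u_pos[OF P1 \<epsilon>(1) r01(1)] \<epsilon> by (intro quot_pos) (auto simp: u_def)
    then show ?thesis using False by (intro add_pos_nonneg) auto
  qed
  ultimately have "(\<theta> \<epsilon> has_real_derivative (r ^ n * ((y \<epsilon> r)\<^sup>2 * quot (\<epsilon> * y \<epsilon> r) + (r * P \<epsilon> r)\<^sup>2)) / (\<rho> \<epsilon> r)\<^sup>2) (at r)"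
    "(r ^ n * ((y \<epsilon> r)\<^sup>2 * quot (\<epsilon> * y \<epsilon> r) + (r * P \<epsilon> r)\<^sup>2)) / (\<rho> \<epsilon> r)\<^sup>2 > 0"
    using \<rho>_pos[OF r01(1), of \<epsilon>] r01(2) by simp_all
  then show "\<exists>z. (\<theta> \<epsilon> has_real_derivative z) (at r) \<and> 0 < z" by blast
qed

lemma u_diff_polar: "r \<in> {0..1} \<Longrightarrow> u \<epsilon> r - \<beta> = \<epsilon> * \<rho> \<epsilon> r * cos (\<theta> \<epsilon> r)"
  using y_polar[of r \<epsilon>] by (simp add: u_def)

text \<open>The sample points are those with \<open>\<theta> = i \<pi> + \<delta>\<close>, \<open>0 \<le> i \<le> j\<close>, with \<open>\<delta>\<close> running from \<open>\<pi>/4\<close> to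
  \<open>- \<pi>/4\<close>, so that they avoid the end points \<open>r = 0\<close> and \<open>r = 1\<close>.\<close>

lemma alternates_angle:
  assumes j: "j \<ge> 1" and \<theta>1: "\<theta> \<epsilon> 1 = real j * pi" and \<epsilon>: "\<beta> + \<epsilon> > 0" "\<epsilon> \<noteq> 0"
  shows "alternates (\<lambda>r. u \<epsilon> r - \<beta>) {0<..<1} j"
proof -
  have P1: "P \<epsilon> 1 = 0" using \<theta>1 by (simp add: neumann_iff)
  define x where "x i = real i / real j" for i
  define lev where "lev i = (x i * (real j - 1 / 2) + 1 / 4) * pi" for i
  have x: "0 \<le> x i" "x i \<le> 1" if "i \<le> j" for i using that j by (auto simp: x_def)
  have lev: "0 < lev i" "lev i < real j * pi" if "i \<le> j" for i
  proof -
    have "0 \<le> x i * (real j - 1 / 2)" "x i * (real j - 1 / 2) \<le> 1 * (real j - 1 / 2)"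
      using x[OF that] j by (auto intro: mult_right_mono)
    then show "0 < lev i" "lev i < real j * pi"
      unfolding lev_def using pi_gt_zero by (auto intro!: mult_pos_pos mult_strict_right_mono)
  qed
  have "\<exists>t. 0 < t \<and> t < 1 \<and> \<theta> \<epsilon> t = lev i" if "i \<le> j" for i
  proof -
    have "\<exists>t\<ge>0. t \<le> 1 \<and> \<theta> \<epsilon> t = lev i"
      using lev[OF that] \<theta>1 \<theta>0[of \<epsilon>] \<theta>_cont_snd by (intro IVT') auto
    then obtain t where t: "0 \<le> t" "t \<le> 1" "\<theta> \<epsilon> t = lev i" by blast
    moreover have "t \<noteq> 0" "t \<noteq> 1" using t(3) lev[OF that] \<theta>1 \<theta>0[of \<epsilon>] by auto
    ultimately show ?thesis by (intro exI[of _ t]) auto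
  qed
  then obtain t where t: "\<And>i. i \<le> j \<Longrightarrow> 0 < t i \<and> t i < 1 \<and> \<theta> \<epsilon> (t i) = lev i" by metis
  have sign: "\<exists>c>0. cos (\<theta> \<epsilon> (t i)) = (-1) ^ i * c" if i: "i \<le> j" for i
  proof (intro exI conjI)
    have "lev i = real i * pi + (1 / 4 - x i / 2) * pi" using j by (simp add: lev_def x_def field_simps)
    then show "cos (\<theta> \<epsilon> (t i)) = (-1) ^ i * cos ((1 / 4 - x i / 2) * pi)"
      using t[OF i] by (simp add: cos_add)
    have "- (1 / 2) < 1 / 4 - x i / 2" "1 / 4 - x i / 2 < 1 / 2" using x[OF i] by auto
    then have "- (1 / 2) * pi < (1 / 4 - x i / 2) * pi" "(1 / 4 - x i / 2) * pi < 1 / 2 * pi"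
      using pi_gt_zero by (intro mult_strict_right_mono; simp)+
    then show "0 < cos ((1 / 4 - x i / 2) * pi)" by (intro cos_gt_zero_pi) auto
  qed
  show ?thesis unfolding alternates_def
  proof (intro exI conjI allI impI)
    show "t i \<in> {0<..<1}" if "i \<le> j" for i using t[OF that] by simp
    show "strict_mono_on {..j} t"
    proof (rule strict_mono_onI)
      fix a b assume ab: "a \<in> {..j}" "b \<in> {..j}" "a < b"
      have "x a < x b" using ab j by (simp add: x_def divide_strict_right_mono)
      then have "lev a < lev b" unfolding lev_def using j pi_gt_zero
        by (auto intro!: mult_strict_right_mono)
      moreover have "\<theta> \<epsilon> (t b) \<le> \<theta> \<epsilon> (t a)" if "t b \<le> t a"
        using \<theta>_less[OF P1 \<epsilon>, of "t b" "t a"] t[of a] t[of b] ab that by (cases "t b = t a") auto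
      ultimately show "t a < t b" using t[of a] t[of b] ab by force
    qed
    fix i assume i: "i < j"
    obtain c c' where c: "c > 0" "cos (\<theta> \<epsilon> (t i)) = (-1) ^ i * c" "c' > 0" "cos (\<theta> \<epsilon> (t (Suc i))) = (-1) ^ Suc i * c'"
      using sign[of i] sign[of "Suc i"] i by auto
    have r: "t i \<in> {0..1}" "t (Suc i) \<in> {0..1}" using t[of i] t[of "Suc i"] i by auto
    have "(u \<epsilon> (t i) - \<beta>) * (u \<epsilon> (t (Suc i)) - \<beta>) = - (\<epsilon>\<^sup>2 * (\<rho> \<epsilon> (t i) * \<rho> \<epsilon> (t (Suc i))) * (c * c') * ((-1) ^ i * (-1) ^ i))"
      unfolding u_diff_polar[OF r(1)] u_diff_polar[OF r(2)] c(2,4) by (simp add: power2_eq_square)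
    also have "(-1::real) ^ i * (-1) ^ i = 1" by (simp flip: power_mult_distrib)
    finally show "(u \<epsilon> (t i) - \<beta>) * (u \<epsilon> (t (Suc i)) - \<beta>) < 0"
      using c \<epsilon> \<rho>_pos[OF r(1), of \<epsilon>] \<rho>_pos[OF r(2), of \<epsilon>] by simp
  qed
qed

text \<open>The integer \<open>N i\<close> is the index of the interval of length pi, centred at a
  multiple of pi, that contains the angle. The cosine keeps its sign on each such interval, so every
  sign change raises N by at least 1; yet an angle below j pi has N at most j.\<close>

lemma not_alternates_angle:
  assumes j: "j \<ge> 1" and \<theta>1: "\<theta> \<epsilon> 1 = real j * pi" and \<epsilon>: "\<beta> + \<epsilon> > 0" "\<epsilon> \<noteq> 0"
  shows "\<not> alternates (\<lambda>r. u \<epsilon> r - \<beta>) {0<..<1} (Suc j)"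
proof
  have P1: "P \<epsilon> 1 = 0" using \<theta>1 by (simp add: neumann_iff)
  assume "alternates (\<lambda>r. u \<epsilon> r - \<beta>) {0<..<1} (Suc j)"
  then obtain t where t: "\<And>i. i \<le> Suc j \<Longrightarrow> t i \<in> {0<..<1}" "strict_mono_on {..Suc j} t"
    "\<And>i. i < Suc j \<Longrightarrow> (u \<epsilon> (t i) - \<beta>) * (u \<epsilon> (t (Suc i)) - \<beta>) < 0"
    unfolding alternates_def by blast
  define N where "N i = \<lfloor>\<theta> \<epsilon> (t i) / pi + 1 / 2\<rfloor>" for i
  have "N i \<ge> int i" if "i \<le> Suc j" for i using that
  proof (induction i)
    case 0
    have "\<theta> \<epsilon> 0 < \<theta> \<epsilon> (t 0)" using \<theta>_less[OF P1 \<epsilon>, of 0 "t 0"] t(1)[of 0] by auto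
    then show ?case using \<theta>0[of \<epsilon>] pi_gt_zero by (simp add: N_def)
  next
    case (Suc i)
    have r: "t i \<in> {0<..<1}" "t (Suc i) \<in> {0<..<1}" using t(1) Suc.prems by auto
    have "t i < t (Suc i)" using t(2) Suc.prems by (auto simp: strict_mono_on_def)
    then have "\<theta> \<epsilon> (t i) < \<theta> \<epsilon> (t (Suc i))" using r by (intro \<theta>_less[OF P1 \<epsilon>]) auto
    then have "N i \<le> N (Suc i)" unfolding N_def using pi_gt_zero
      by (intro floor_mono add_right_mono divide_right_mono) auto
    moreover have "N i \<noteq> N (Suc i)"
    proof
      assume eq: "N i = N (Suc i)"
      have cos: "\<exists>c\<ge>0. cos (\<theta> \<epsilon> (t k)) = (-1) ^ nat (N i) * c" if k: "N k = N i" for k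
      proof (intro exI conjI)
        have N0: "N i \<ge> 0" using Suc by simp
        have "real_of_int (N k) \<le> \<theta> \<epsilon> (t k) / pi + 1 / 2" "\<theta> \<epsilon> (t k) / pi + 1 / 2 < real_of_int (N k) + 1"
          unfolding N_def by linarith+
        then have "(real_of_int (N i) - 1 / 2) * pi \<le> \<theta> \<epsilon> (t k)" "\<theta> \<epsilon> (t k) \<le> (real_of_int (N i) + 1 / 2) * pi"
          unfolding k using pi_gt_zero by (simp_all add: field_simps)
        then show "0 \<le> cos (\<theta> \<epsilon> (t k) - real (nat (N i)) * pi)"
          using N0 by (intro cos_ge_zero) (simp_all add: algebra_simps)
        have "cos (\<theta> \<epsilon> (t k)) = cos (real (nat (N i)) * pi + (\<theta> \<epsilon> (t k) - real (nat (N i)) * pi))" by simp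
        also have "\<dots> = (-1) ^ nat (N i) * cos (\<theta> \<epsilon> (t k) - real (nat (N i)) * pi)"
          unfolding cos_add by simp
        finally show "cos (\<theta> \<epsilon> (t k)) = (-1) ^ nat (N i) * cos (\<theta> \<epsilon> (t k) - real (nat (N i)) * pi)" .
      qed
      obtain c c' where c: "c \<ge> 0" "cos (\<theta> \<epsilon> (t i)) = (-1) ^ nat (N i) * c" "c' \<ge> 0" "cos (\<theta> \<epsilon> (t (Suc i))) = (-1) ^ nat (N i) * c'"
        using cos[of i] cos[of "Suc i"] eq by auto
      have r': "t i \<in> {0..1}" "t (Suc i) \<in> {0..1}" using r by auto
      have "(u \<epsilon> (t i) - \<beta>) * (u \<epsilon> (t (Suc i)) - \<beta>) = \<epsilon>\<^sup>2 * (\<rho> \<epsilon> (t i) * \<rho> \<epsilon> (t (Suc i))) * (c * c') * ((-1) ^ nat (N i))\<^sup>2"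
        unfolding u_diff_polar[OF r'(1)] u_diff_polar[OF r'(2)] c(2,4) by (simp add: power2_eq_square)
      also have "\<dots> \<ge> 0" using c \<rho>_pos[OF r'(1), of \<epsilon>] \<rho>_pos[OF r'(2), of \<epsilon>] by (intro mult_nonneg_nonneg) auto
      finally show False using t(3)[of i] Suc.prems by simp
    qed
    ultimately show ?case using Suc by simp
  qed
  from this[of "Suc j"] have "int (Suc j) \<le> N (Suc j)" by simp
  moreover have "\<theta> \<epsilon> (t (Suc j)) < \<theta> \<epsilon> 1" using t(1)[of "Suc j"] by (intro \<theta>_less[OF P1 \<epsilon>]) auto
  then have "\<theta> \<epsilon> (t (Suc j)) / pi < real j" unfolding \<theta>1 using pi_gt_zero by (simp add: pos_divide_less_eq)
  then have "N (Suc j) < int j + 1" unfolding N_def by linarith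
  ultimately show False by simp
qed

lemma u_sign_near_0:
  assumes "\<epsilon> \<noteq> 0"
  shows "\<exists>\<delta>>0. \<forall>r\<in>{0..<\<delta>}. (u \<epsilon> r - \<beta>) * \<epsilon> > 0"
proof -
  have "isCont (y \<epsilon>) 0" using radial_solutionD(2)[OF sol, of UNIV] by (simp add: continuous_on_eq_continuous_at)
  then obtain \<delta> where \<delta>: "\<delta> > 0" "\<And>r. dist r 0 < \<delta> \<Longrightarrow> dist (y \<epsilon> r) (y \<epsilon> 0) < 1"
    unfolding continuous_at_eps_delta by (metis zero_less_one)
  have "(u \<epsilon> r - \<beta>) * \<epsilon> > 0" if "r \<in> {0..<\<delta>}" for r
  proof -
    have "y \<epsilon> r > 0" using \<delta>(2)[of r] that y0[of \<epsilon>] by (auto simp: dist_real_def)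
    then have "\<epsilon>\<^sup>2 * y \<epsilon> r > 0" using assms by simp
    then show ?thesis by (simp add: u_def power2_eq_square mult_ac)
  qed
  then show ?thesis using \<delta>(1) by blast
qed

text \<open>The increasing angle stays strictly between 0 and pi inside (0, 1), so its sine is
  positive and y' < 0; multiplication by \<epsilon> then decides the direction.\<close>

lemma u_monotone:
  assumes \<theta>1: "\<theta> \<epsilon> 1 = pi" and \<epsilon>: "\<beta> + \<epsilon> > 0" "\<epsilon> \<noteq> 0" and ab: "0 \<le> a" "a < b" "b \<le> 1"
  shows "(u \<epsilon> b - u \<epsilon> a) * \<epsilon> < 0"
proof -
  have P1: "P \<epsilon> 1 = 0" using \<theta>1 by (simp add: neumann_iff)
  have "- y \<epsilon> a < - y \<epsilon> b"
  proof (rule DERIV_pos_imp_increasing_open[where f = "\<lambda>r. - y \<epsilon> r"])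
    fix r assume r: "a < r" "r < b"
    have r01: "r \<in> {0..1}" "r > 0" "r < 1" using r ab by auto
    have "0 < \<theta> \<epsilon> r" "\<theta> \<epsilon> r < pi"
      using \<theta>_less[OF P1 \<epsilon>, of 0 r] \<theta>_less[OF P1 \<epsilon>, of r 1] r01 \<theta>0[of \<epsilon>] \<theta>1 by auto
    then have "r ^ Suc n * P \<epsilon> r < 0"
      using v_polar[OF r01(1), of \<epsilon>] \<rho>_pos[OF r01(1), of \<epsilon>] sin_gt_zero[of "\<theta> \<epsilon> r"] by simp
    then have "P \<epsilon> r < 0" using r01 by (simp add: mult_less_0_iff zero_less_mult_iff)
    then have "- (r * P \<epsilon> r) > 0" using r01 by (simp add: mult_less_0_iff)
    moreover have "((\<lambda>r. - y \<epsilon> r) has_real_derivative - (r * P \<epsilon> r)) (at r)"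
      by (rule DERIV_minus[OF radial_solutionD(3)[OF sol]])
    ultimately show "\<exists>z. ((\<lambda>r. - y \<epsilon> r) has_real_derivative z) (at r) \<and> 0 < z" by blast
  qed (use ab in \<open>auto intro!: continuous_intros radial_solutionD[OF sol]\<close>)
  then have "\<epsilon>\<^sup>2 * (y \<epsilon> b - y \<epsilon> a) < 0" using \<epsilon> by (intro mult_pos_neg) auto
  then show ?thesis by (simp add: u_def power2_eq_square algebra_simps)
qed

end

section \<open>Truncation of the nonlinearity\<close>

lemma C1_on_real_derivative:
  fixes f :: "real \<Rightarrow> real"
  assumes "C1_on S f"
  obtains f' where "continuous_on S f'" "\<And>x. x \<in> S \<Longrightarrow> (f has_real_derivative f' x) (at x within S)"
proof -
  obtain G where "continuous_on S G" "\<And>x. x \<in> S \<Longrightarrow> (f has_derivative (\<lambda>h. G x \<bullet> h)) (at x within S)"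
    using assms unfolding C1_on_def by blast
  then show thesis by (intro that[of G]) (simp_all add: has_field_derivative_def inner_real_def)
qed

lemma C1_on_imp_lipschitz:
  fixes f :: "real \<Rightarrow> real"
  assumes "C1_on {0..} f"
  obtains B where "B \<ge> 0" "\<And>s t. s \<in> {0..M} \<Longrightarrow> t \<in> {0..M} \<Longrightarrow> \<bar>f s - f t\<bar> \<le> B * \<bar>s - t\<bar>"
proof -
  obtain f' where f': "continuous_on {0..} f'" "\<And>x. x \<in> {0..} \<Longrightarrow> (f has_real_derivative f' x) (at x within {0..})"
    using C1_on_real_derivative[OF assms] by blast
  have "compact (f' ` {0..M})"
    by (intro compact_continuous_image continuous_on_subset[OF f'(1)]) auto
  then have "bounded (f' ` {0..M})" by (rule compact_imp_bounded)
  then obtain B where B: "B > 0" "\<And>x. x \<in> {0..M} \<Longrightarrow> norm (f' x) \<le> B" unfolding bounded_pos by auto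
  have "norm (f s - f t) \<le> B * norm (s - t)" if "s \<in> {0..M}" "t \<in> {0..M}" for s t
  proof (rule field_differentiable_bound[of "{0..M}" f f'])
    fix x assume x: "x \<in> {0..M}"
    then have "(f has_real_derivative f' x) (at x within {0..})" using f'(2) by simp
    then show "(f has_real_derivative f' x) (at x within {0..M})" by (rule DERIV_subset) auto
    show "norm (f' x) \<le> B" using B(2) x .
  qed (use that in auto)
  then show thesis using B(1) by (intro that[of B]) auto
qed

text \<open>The limit is used only as an upper bound of f(s) / s; the lower bound far out is the
  positivity of f beyond \<beta>. On the remaining compact interval, f(0) = 0 and a Lipschitz bound
  suffice.\<close>

lemma linear_growth:
  fixes f :: "real \<Rightarrow> real"
  assumes f: "C1_on {0..} f" "f 0 = 0" and lim: "((\<lambda>s. ereal (f s / s)) \<longlongrightarrow> L) at_top" "L < \<infinity>"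
    and pos: "\<And>s. s > \<beta> \<Longrightarrow> f s > 0"
  obtains C where "C \<ge> 0" "\<And>s. s \<ge> 0 \<Longrightarrow> \<bar>f s\<bar> \<le> C * s"
proof -
  obtain c where "L < ereal c" using lim(2) ereal_dense2 by blast
  then have "eventually (\<lambda>s. ereal (f s / s) < ereal c) at_top" using order_tendstoD(2)[OF lim(1)] by blast
  then obtain a where a: "\<And>s. s \<ge> a \<Longrightarrow> f s / s < c" by (auto simp: eventually_at_top_linorder)
  define M where "M = max 1 (max a (\<beta> + 1))"
  obtain B where B: "B \<ge> 0" "\<And>s t. s \<in> {0..M} \<Longrightarrow> t \<in> {0..M} \<Longrightarrow> \<bar>f s - f t\<bar> \<le> B * \<bar>s - t\<bar>"
    using C1_on_imp_lipschitz[OF f(1), where M = M] by blast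
  show thesis
  proof (rule that)
    show "B + \<bar>c\<bar> \<ge> 0" using B by simp
    fix s :: real assume s: "s \<ge> 0"
    show "\<bar>f s\<bar> \<le> (B + \<bar>c\<bar>) * s"
    proof (cases "s \<le> M")
      case True
      then have "\<bar>f s\<bar> \<le> B * s" using B(2)[of s 0] s f(2) by (simp add: M_def)
      also have "\<dots> \<le> (B + \<bar>c\<bar>) * s" using s by (intro mult_right_mono) auto
      finally show ?thesis .
    next
      case False
      then have *: "s \<ge> a" "s > \<beta>" "s > 0" by (auto simp: M_def)
      then have "\<bar>f s\<bar> \<le> c * s" using a[of s] pos[of s] by (simp add: pos_divide_less_eq)
      also have "\<dots> \<le> (B + \<bar>c\<bar>) * s" using s B by (intro mult_right_mono) auto
      finally show ?thesis .
    qed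
  qed
qed

text \<open>Beyond \<open>M\<close>, \<open>g\<close> is constant rather than \<open>f\<close>: this keeps \<open>g > 0\<close> above \<open>\<beta>\<close> and the linear
  bound \<open>C\<close> independent of \<open>M\<close>, which is chosen afterwards from the a priori bound.\<close>

lemma truncation_shooting:
  fixes f :: "real \<Rightarrow> real" and \<beta> C M :: real
  defines "g \<equiv> \<lambda>s. f (max 0 (min s M)) - max 0 (min s M) - min s 0"
  assumes f: "C1_on {0..} f" "f 0 = 0" and \<beta>: "0 < \<beta>" "\<beta> < M" "f \<beta> = \<beta>"
    and below: "\<And>s. 0 < s \<Longrightarrow> s < \<beta> \<Longrightarrow> f s < s" and above: "\<And>s. s > \<beta> \<Longrightarrow> f s > s"
    and C: "C \<ge> 1" "\<And>s. s \<ge> 0 \<Longrightarrow> \<bar>f s\<bar> \<le> (C - 1) * s"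
  shows "\<exists>L. shooting g \<beta> (deriv f \<beta> - 1) L C"
proof -
  obtain B where B: "B \<ge> 0" "\<And>s t. s \<in> {0..M} \<Longrightarrow> t \<in> {0..M} \<Longrightarrow> \<bar>f s - f t\<bar> \<le> B * \<bar>s - t\<bar>"
    using C1_on_imp_lipschitz[OF f(1)] by blast
  let ?c = "\<lambda>s. max 0 (min s M)"
  have c: "?c s \<in> {0..M}" for s using \<beta> by auto
  have "shooting g \<beta> (deriv f \<beta> - 1) (B + 2) C"
  proof
    fix s t
    have clamp: "\<bar>?c s - ?c t\<bar> \<le> \<bar>s - t\<bar>" by linarith
    have "\<bar>f (?c s) - f (?c t)\<bar> \<le> B * \<bar>?c s - ?c t\<bar>" by (rule B(2)[OF c c])
    also have "\<dots> \<le> B * \<bar>s - t\<bar>" using clamp B(1) by (rule mult_left_mono)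
    finally have f_le: "\<bar>f (?c s) - f (?c t)\<bar> \<le> B * \<bar>s - t\<bar>" .
    have min_le: "\<bar>min s 0 - min t 0\<bar> \<le> \<bar>s - t\<bar>" by linarith
    have "\<bar>(a - b - c) - (a' - b' - c')\<bar> \<le> \<bar>a - a'\<bar> + \<bar>b - b'\<bar> + \<bar>c - c'\<bar>" for a b c a' b' c' :: real
      by linarith
    then have "\<bar>g s - g t\<bar> \<le> \<bar>f (?c s) - f (?c t)\<bar> + \<bar>?c s - ?c t\<bar> + \<bar>min s 0 - min t 0\<bar>"
      unfolding g_def .
    also have "\<dots> \<le> B * \<bar>s - t\<bar> + \<bar>s - t\<bar> + \<bar>s - t\<bar>"
      by (intro add_mono f_le clamp min_le)
    finally show "\<bar>g s - g t\<bar> \<le> (B + 2) * \<bar>s - t\<bar>" by (simp only: distrib_right mult_2 add.assoc)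
  next
    fix s
    show "\<bar>g s\<bar> \<le> C * \<bar>s\<bar>"
    proof (cases "s < 0")
      case True
      then have "\<bar>g s\<bar> = 1 * \<bar>s\<bar>" using \<beta> f(2) by (simp add: g_def)
      also have "\<dots> \<le> C * \<bar>s\<bar>" using C(1) by (intro mult_right_mono) auto
      finally show ?thesis .
    next
      case False
      have "\<bar>f (?c s)\<bar> \<le> (C - 1) * ?c s" by (rule C(2)) simp
      moreover have "g s = f (?c s) - ?c s" using False by (simp add: g_def)
      moreover have "\<bar>f (?c s) - ?c s\<bar> \<le> \<bar>f (?c s)\<bar> + ?c s" by linarith
      ultimately have "\<bar>g s\<bar> \<le> C * ?c s" by (simp add: left_diff_distrib)
      also have "\<dots> \<le> C * \<bar>s\<bar>" using C(1) False by (intro mult_left_mono) auto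
      finally show ?thesis .
    qed
  next
    obtain f' where "\<And>x. x \<in> {0..} \<Longrightarrow> (f has_real_derivative f' x) (at x within {0..})"
      using C1_on_real_derivative[OF f(1)] by blast
    \<comment> \<open>The hypothesis gives a derivative within the half-line, whereas
      \<open>deriv\<close> is two-sided; they agree because \<beta> is an interior point.\<close>
    from this[of \<beta>] have f': "(f has_real_derivative f' \<beta>) (at \<beta>)"
      using \<beta>(1) at_within_interior[of \<beta> "{0..}"] by simp
    then have "(f has_real_derivative deriv f \<beta>) (at \<beta>)" by (simp add: DERIV_imp_deriv[OF f'])
    then have "((\<lambda>s. f s - s) has_real_derivative deriv f \<beta> - 1) (at \<beta>)"
      by (intro DERIV_diff DERIV_ident)
    then show "(g has_real_derivative deriv f \<beta> - 1) (at \<beta>)"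
      by (rule has_field_derivative_transform_within_open[where S = "{0<..<M}"]) (use \<beta> in \<open>auto simp: g_def\<close>)
  next
    fix s assume "s > \<beta>"
    then have "?c s = min s M" "min s M > \<beta>" "s > 0" using \<beta> by auto
    then show "g s > 0" using above[of "min s M"] by (simp add: g_def)
  next
    fix s assume "0 < s" "s < \<beta>"
    then show "g s < 0" using below[of s] \<beta> by (simp add: g_def)
  next
    fix s :: real assume "s < 0"
    then show "g s = - s" using \<beta> f(2) by (simp add: g_def)
  qed (use \<beta> C in \<open>auto simp: g_def\<close>)
  then show ?thesis ..
qed

section \<open>Choice of constants and the intermediate value argument\<close>

theorem theorem1p1:
  fixes f :: "real \<Rightarrow> real" and \<beta> :: real and k :: nat
  assumes N: "CARD('n::finite) \<ge> 2"
    and k: "k \<ge> 2"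
    and A1: "C1_on {0..} f" "f 0 = 0"
    and A2: "\<exists>L :: ereal. ((\<lambda>s. ereal (f s / s)) \<longlongrightarrow> L) at_top \<and> L < \<infinity>"
    and A3: "\<beta> > 0" "f \<beta> = \<beta>" "\<forall>s\<in>{0<..<\<beta>}. f s < s" "\<forall>s\<in>{\<beta><..}. f s > s"
            "deriv f \<beta> > radial_eigenvalue TYPE(real ^ 'n) k"
  shows "\<exists>up um :: nat \<Rightarrow> real \<Rightarrow> real.
    (\<forall>j\<in>{2..k}.
       neumann_solution f (\<lambda>x :: real ^ 'n. up j (norm x)) \<and>
       (\<forall>x\<in>ball (0 :: real ^ 'n) 1. up j (norm x) > 0) \<and>
       \<not> (\<lambda>x :: real ^ 'n. up j (norm x)) constant_on ball 0 1 \<and>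
       changes_sign_exactly (\<lambda>r. up j r - \<beta>) {0<..<1} (j - 1) \<and>
       (\<exists>\<epsilon>>0. \<forall>r\<in>{0..<\<epsilon>}. up j r - \<beta> > 0) \<and>
       neumann_solution f (\<lambda>x :: real ^ 'n. um j (norm x)) \<and>
       (\<forall>x\<in>ball (0 :: real ^ 'n) 1. um j (norm x) > 0) \<and>
       \<not> (\<lambda>x :: real ^ 'n. um j (norm x)) constant_on ball 0 1 \<and>
       changes_sign_exactly (\<lambda>r. um j r - \<beta>) {0<..<1} (j - 1) \<and>
       (\<exists>\<epsilon>>0. \<forall>r\<in>{0..<\<epsilon>}. um j r - \<beta> < 0)) \<and>
    ((\<forall>s\<in>{-\<beta><..<0} \<union> {0<..}. (f (s + \<beta>) - (s + \<beta>)) * s > 0) \<longrightarrow>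
       strict_antimono_on {0..1} (up 2) \<and> strict_mono_on {0..1} (um 2))"
proof -
  define n where "n = CARD('n) - 1"
  have dim: "DIM(real ^ 'n) = Suc n" and n: "n \<ge> 1" using N by (simp_all add: n_def)
  obtain L where "((\<lambda>s. ereal (f s / s)) \<longlongrightarrow> L) at_top" "L < \<infinity>" using A2 by blast
  moreover have "f s > 0" if "s > \<beta>" for s using A3(1,4) that by force
  ultimately obtain C0 where C0: "C0 \<ge> 0" "\<And>s. s \<ge> 0 \<Longrightarrow> \<bar>f s\<bar> \<le> C0 * s"
    using linear_growth[OF A1] by metis
  define C where "C = C0 + 1"
  define K where "K = 2 * exp (sqrt (2 * C))"
  define D where "D = large_value n C \<beta>"
  \<comment> \<open>All solutions used start at a value at most D, so
    \<open>radial_solution_bound\<close> keeps them below K D, where the upper cut-off is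
    inactive.\<close>
  define M where "M = K * D"
  define g where "g s = f (max 0 (min s M)) - max 0 (min s M) - min s 0" for s
  have C: "C \<ge> 1" using C0 by (simp add: C_def)
  have K: "K \<ge> 2" using C by (simp add: K_def)
  have D: "D > \<beta>"
  proof -
    have "2 * (\<beta> + 0) \<le> D" unfolding D_def large_value_def using C A3(1)
      by (intro mult_left_mono add_left_mono mult_nonneg_nonneg) auto
    then show ?thesis using A3(1) by simp
  qed
  have "1 * D \<le> K * D" using K D A3(1) by (intro mult_right_mono) auto
  then have M: "M > \<beta>" using D unfolding M_def mult_1 by (rule order.strict_trans2[rotated])
  obtain L' where "shooting g \<beta> (deriv f \<beta> - 1) L' C"
    using truncation_shooting[of f \<beta> M C, OF A1 A3(1) M A3(2)] A3(3,4) C C0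
    unfolding g_def[abs_def] by (auto simp: C_def)
  then interpret S: shooting n g \<beta> "deriv f \<beta> - 1" L' C .
  obtain y P \<theta> where "radial_family n S.h y P \<theta>" by (rule S.family_exists)
  then interpret F: shooting_family n g \<beta> "deriv f \<beta> - 1" L' C y P \<theta>
    by (intro shooting_family.intro S.shooting_axioms)
  \<comment> \<open>At \<epsilon> = 0 the shooting family is the member \<mu> = f'(\<beta>) of the
    linear family, with the same normalisation at 0.\<close>
  have center: "\<theta> 0 1 > (k - 1) * pi"
  proof -
    obtain yl Pl \<theta>l where "linear_family n yl Pl \<theta>l" by (rule linear_family_exists)
    then interpret Lin: linear_family n yl Pl \<theta>l .
    have "S.h 0 = (\<lambda>y. (deriv f \<beta> - 1) * y)" by (rule ext) (rule S.h_zero)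
    then have sol: "radial_solution n (\<lambda>y. (deriv f \<beta> - 1) * y) (y 0) (P 0)" using F.sol[of 0] by simp
    have "y 0 r = yl (deriv f \<beta>) r" "r ^ Suc n * P 0 r = r ^ Suc n * Pl (deriv f \<beta>) r" if "r \<in> {0..1}" for r
      using linear_radial_solution_unique[OF sol Lin.sol[of "deriv f \<beta>"] _ that] F.y0 Lin.y0 by auto
    then have "\<theta> 0 1 = \<theta>l (deriv f \<beta>) 1"
      by (intro radial_family_angle_unique[OF F.radial_family_axioms Lin.radial_family_axioms])
    then show ?thesis using Lin.radial_eigenvalue_less_imp_angle[OF dim n _ A3(5)] k by simp
  qed
  then have center': "real (k - 1) * pi < \<theta> 0 1" using k by (simp add: of_nat_diff)
  have level: "pi \<le> real (j - 1) * pi" "real (j - 1) * pi \<le> \<theta> 0 1" if "j \<in> {2..k}" for j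
  proof -
    have "1 * pi \<le> real (j - 1) * pi" "real (j - 1) * pi \<le> real (k - 1) * pi"
      using that pi_gt_zero by (auto intro!: mult_right_mono)
    then show "pi \<le> real (j - 1) * pi" "real (j - 1) * pi \<le> \<theta> 0 1" using center' by linarith+
  qed
  have "\<exists>\<epsilon>. 0 < \<epsilon> \<and> \<epsilon> \<le> D - \<beta> \<and> \<theta> \<epsilon> 1 = real (j - 1) * pi" if j: "j \<in> {2..k}" for j
  proof -
    have "\<theta> (D - \<beta>) 1 < pi" using F.large_angle(2)[of "D - \<beta>"] by (simp add: D_def)
    then have "\<theta> (D - \<beta>) 1 \<le> real (j - 1) * pi" using level(1)[OF j] by linarith
    then have "\<exists>\<epsilon>\<ge>0. \<epsilon> \<le> D - \<beta> \<and> \<theta> \<epsilon> 1 = real (j - 1) * pi"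
      using level(2)[OF j] by (rule IVT2') (use D in \<open>auto intro: continuous_on_subset[OF F.\<theta>_cont_fst]\<close>)
    then obtain \<epsilon> where \<epsilon>: "0 \<le> \<epsilon>" "\<epsilon> \<le> D - \<beta>" "\<theta> \<epsilon> 1 = real (j - 1) * pi" by blast
    have "real (j - 1) * pi \<le> real (k - 1) * pi" using j pi_gt_zero by (auto intro!: mult_right_mono)
    \<comment> \<open>The strict inequality at the centre excludes \<epsilon> = 0, that is, the
      constant solution \<beta>.\<close>
    then have "\<epsilon> \<noteq> 0" using center' \<epsilon>(3) by auto
    then show ?thesis using \<epsilon> by (intro exI[of _ \<epsilon>]) auto
  qed
  then obtain ep where ep: "\<And>j. j \<in> {2..k} \<Longrightarrow> 0 < ep j \<and> ep j \<le> D - \<beta> \<and> \<theta> (ep j) 1 = real (j - 1) * pi" by metis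
  have "\<exists>\<epsilon>. \<epsilon> < 0 \<and> 0 < \<beta> + \<epsilon> \<and> \<theta> \<epsilon> 1 = real (j - 1) * pi" if j: "j \<in> {2..k}" for j
  proof -
    \<comment> \<open>This corresponds to u(0) = \<beta> / (2 K), for which the a priori bound is
      \<beta> / 2.\<close>
    define \<epsilon>0 where "\<epsilon>0 = \<beta> / (2 * K) - \<beta>"
    have "\<beta> / (2 * K) > 0" "\<beta> / (2 * K) < \<beta>" "K * (\<beta> / (2 * K)) < \<beta>"
      using K A3(1) by (auto simp: divide_simps)
    then have e0: "\<beta> + \<epsilon>0 > 0" "\<epsilon>0 < 0" "K * (\<beta> + \<epsilon>0) < \<beta>" by (auto simp: \<epsilon>0_def)
    then have "\<theta> \<epsilon>0 1 < pi" using F.small_angle[of \<epsilon>0] by (simp add: K_def)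
    then have "\<theta> \<epsilon>0 1 \<le> real (j - 1) * pi" using level(1)[OF j] by linarith
    then have "\<exists>\<epsilon>\<ge>\<epsilon>0. \<epsilon> \<le> 0 \<and> \<theta> \<epsilon> 1 = real (j - 1) * pi"
      using level(2)[OF j] by (rule IVT') (use e0 in \<open>auto intro: continuous_on_subset[OF F.\<theta>_cont_fst]\<close>)
    then obtain \<epsilon> where \<epsilon>: "\<epsilon>0 \<le> \<epsilon>" "\<epsilon> \<le> 0" "\<theta> \<epsilon> 1 = real (j - 1) * pi" by blast
    have "real (j - 1) * pi \<le> real (k - 1) * pi" using j pi_gt_zero by (auto intro!: mult_right_mono)
    then have "\<epsilon> \<noteq> 0" using center' \<epsilon>(3) by auto
    then show ?thesis using \<epsilon> e0 by (intro exI[of _ \<epsilon>]) auto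
  qed
  then obtain em where em: "\<And>j. j \<in> {2..k} \<Longrightarrow> em j < 0 \<and> 0 < \<beta> + em j \<and> \<theta> (em j) 1 = real (j - 1) * pi" by metis
  have main: "neumann_solution f (\<lambda>x :: real ^ 'n. F.u \<epsilon> (norm x))"
      "\<forall>x\<in>ball (0 :: real ^ 'n) 1. F.u \<epsilon> (norm x) > 0"
      "\<not> (\<lambda>x :: real ^ 'n. F.u \<epsilon> (norm x)) constant_on ball 0 1"
      "changes_sign_exactly (\<lambda>r. F.u \<epsilon> r - \<beta>) {0<..<1} j"
    if j: "j \<ge> 1" and \<theta>1: "\<theta> \<epsilon> 1 = real j * pi" and \<epsilon>: "\<epsilon> \<noteq> 0" "\<beta> + \<epsilon> > 0" "\<beta> + \<epsilon> \<le> D" for \<epsilon> j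
  proof -
    have P1: "P \<epsilon> 1 = 0" using \<theta>1 by (simp add: F.neumann_iff)
    note pos = F.u_pos[OF P1 \<epsilon>(2)]
    show "neumann_solution f (\<lambda>x :: real ^ 'n. F.u \<epsilon> (norm x))"
    proof (rule radial_solution_imp_neumann_solution[OF F.u_sol S.g_cont dim])
      fix r :: real assume "0 \<le> r" "r < 1"
      then have r: "r \<in> {0..1}" by simp
      have "\<bar>F.u \<epsilon> r\<bar> \<le> K * (\<beta> + \<epsilon>)" using F.u_bound[OF r, of \<epsilon>] \<epsilon>(2) by (simp add: K_def)
      also have "\<dots> \<le> M" unfolding M_def using K \<epsilon> by (intro mult_left_mono) auto
      finally show "f (F.u \<epsilon> r) = g (F.u \<epsilon> r) + F.u \<epsilon> r" using pos[OF r] by (simp add: g_def)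
    qed (simp add: P1)
    show "\<forall>x\<in>ball (0 :: real ^ 'n) 1. F.u \<epsilon> (norm x) > 0" using pos by auto
    have alt: "alternates (\<lambda>r. F.u \<epsilon> r - \<beta>) {0<..<1} j" by (rule F.alternates_angle[OF j \<theta>1 \<epsilon>(2,1)])
    then show "changes_sign_exactly (\<lambda>r. F.u \<epsilon> r - \<beta>) {0<..<1} j"
      using F.not_alternates_angle[OF j \<theta>1 \<epsilon>(2,1)] by (simp add: changes_sign_exactly_def)
    show "\<not> (\<lambda>x :: real ^ 'n. F.u \<epsilon> (norm x)) constant_on ball 0 1"
    proof
      assume "(\<lambda>x :: real ^ 'n. F.u \<epsilon> (norm x)) constant_on ball 0 1"
      then obtain c where c: "\<And>x :: real ^ 'n. x \<in> ball 0 1 \<Longrightarrow> F.u \<epsilon> (norm x) = c"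
        unfolding constant_on_def by blast
      have uc: "F.u \<epsilon> r = c" if r: "r \<in> {0<..<1}" for r
      proof -
        have "r \<ge> 0" using r by simp
        then obtain e :: "real ^ 'n" where "norm e = r" by (rule vector_choose_size)
        then show ?thesis using c[of e] r by simp
      qed
      \<comment> \<open>A sign change has sample points inside (0, 1); for a constant function the
        product of the two values would be a square.\<close>
      obtain t where "t 0 \<in> {0<..<1}" "t (Suc 0) \<in> {0<..<1}" "(F.u \<epsilon> (t 0) - \<beta>) * (F.u \<epsilon> (t (Suc 0)) - \<beta>) < 0"
        using alt j unfolding alternates_def by (metis One_nat_def less_eq_Suc_le zero_le)
      then have "(c - \<beta>) * (c - \<beta>) < 0" using uc by simp
      then show False using zero_le_square[of "c - \<beta>"] by linarith
    qed
  qed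
  show ?thesis
  proof (rule exI[of _ "\<lambda>j. F.u (ep j)"], rule exI[of _ "\<lambda>j. F.u (em j)"], intro conjI ballI impI)
    fix j assume j: "j \<in> {2..k}"
    have "j - 1 \<ge> 1" using j by force
    note plus = main[OF this, of "ep j"] and minus = main[OF this, of "em j"]
    have p: "\<theta> (ep j) 1 = real (j - 1) * pi" "ep j \<noteq> 0" "\<beta> + ep j > 0" "\<beta> + ep j \<le> D" "ep j > 0"
      using ep[OF j] A3(1) by auto
    have m: "\<theta> (em j) 1 = real (j - 1) * pi" "em j \<noteq> 0" "\<beta> + em j > 0" "\<beta> + em j \<le> D" "em j < 0"
      using em[OF j] D by auto
    show "neumann_solution f (\<lambda>x :: real ^ 'n. F.u (ep j) (norm x))"
      "\<not> (\<lambda>x :: real ^ 'n. F.u (ep j) (norm x)) constant_on ball 0 1"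
      "changes_sign_exactly (\<lambda>r. F.u (ep j) r - \<beta>) {0<..<1} (j - 1)"
      "\<And>x :: real ^ 'n. x \<in> ball 0 1 \<Longrightarrow> F.u (ep j) (norm x) > 0"
      using plus[OF p(1-4)] by auto
    show "neumann_solution f (\<lambda>x :: real ^ 'n. F.u (em j) (norm x))"
      "\<not> (\<lambda>x :: real ^ 'n. F.u (em j) (norm x)) constant_on ball 0 1"
      "changes_sign_exactly (\<lambda>r. F.u (em j) r - \<beta>) {0<..<1} (j - 1)"
      "\<And>x :: real ^ 'n. x \<in> ball 0 1 \<Longrightarrow> F.u (em j) (norm x) > 0"
      using minus[OF m(1-4)] by auto
    show "\<exists>\<delta>>0. \<forall>r\<in>{0..<\<delta>}. F.u (ep j) r - \<beta> > 0"
      using F.u_sign_near_0[OF p(2)] p(5) by (simp add: zero_less_mult_iff)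
    show "\<exists>\<delta>>0. \<forall>r\<in>{0..<\<delta>}. F.u (em j) r - \<beta> < 0"
      using F.u_sign_near_0[OF m(2)] m(5) by (simp add: zero_less_mult_iff)
  next
    have 2: "2 \<in> {2..k}" using k by simp
    have p: "\<theta> (ep 2) 1 = pi" "ep 2 \<noteq> 0" "\<beta> + ep 2 > 0" "ep 2 > 0" using ep[OF 2] A3(1) by auto
    have m: "\<theta> (em 2) 1 = pi" "em 2 \<noteq> 0" "\<beta> + em 2 > 0" "em 2 < 0" using em[OF 2] by auto
    show "strict_antimono_on {0..1} (F.u (ep 2))"
    proof (rule monotone_onI)
      fix a b :: real assume "a \<in> {0..1}" "b \<in> {0..1}" "a < b"
      then show "F.u (ep 2) a > F.u (ep 2) b"
        using F.u_monotone[OF p(1,3,2), of a b] p(4) by (simp add: mult_less_0_iff)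
    qed
    show "strict_mono_on {0..1} (F.u (em 2))"
    proof (rule monotone_onI)
      fix a b :: real assume "a \<in> {0..1}" "b \<in> {0..1}" "a < b"
      then show "F.u (em 2) a < F.u (em 2) b"
        using F.u_monotone[OF m(1,3,2), of a b] m(4) by (simp add: mult_less_0_iff)
    qed
  qed
qed

end
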